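(* Let $\mu$ be a partition of the integer $k$ and $(S_1,S_2)$ a fixed couple of pair-partitions of $[2k]$ of type $\mu$, and let $G$, $\mathcal{P}^o$ be as in the context. Then, as functions on Young diagrams, $$\Sigma^{(2)}_\mu=\sum_{\Omega}(-1)^{\mathcal{L}(S_0(\Omega),S_1)}N^{(1)}_{S_0(\Omega),S_1,S_2},$$ where the sum runs over the orbits $\Omega$ of $\mathcal{P}^o$ under the diagonal action of $G$, and $S_0(\Omega)$ denotes the first component of an arbitrary element of $\Omega$.
   Context: Pair-partitions of $[2k]$ are identified with fixed-point-free involutions; $\mathfrak{S}_{2k}$ acts on them by: $\{\sigma(i),\sigma(j)\}$ is a pair of $\sigma\cdot P$ iff $\{i,j\}$ is a pair of $P$. For pair-partitions $A,B$, $\mathcal{L}(A,B)$ is the bipartite graph with a black vertex per pair of $A$, a white vertex per pair of $B$, and an edge labeled $i$ for each $i\in[2k]$ joining the pairs containing $i$; it is a union of loops of lengths $2\ell_1\ge2\ell_2\ge\cdots$, each viewed as the set of its labels; $(\ell_1,\ell_2,\dots)$ is the type; $(-1)^{\mathcal{L}(A,B)}=(-1)^{k-|\mathcal{L}(A,B)|}$ with $|\mathcal{L}(A,B)|$ the number of loops. The group $G$: for each loop $L_i$ of $\mathcal{L}(S_1,S_2)$ (of length $2\mu_i$) choose an element $j_{i,1}\in L_i$ and set $j_{i,2}=S_2(j_{i,1})$, $j_{i,3}=S_1(j_{i,2})$, $j_{i,4}=S_2(j_{i,3})$, and so on alternately up to $j_{i,2\mu_i}$ (so $S_1(j_{i,2\mu_i})=j_{i,1}$).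 Let $r_i\in\mathfrak{S}_{2k}$ send $j_{i,m}$ to $j_{i,2\mu_i+1-m}$ for $m\in[2\mu_i]$ and fix all other elements; $G$ is the group generated by the $r_i$. An orientation $\phi$ is a coloring of each element of $[2k]$ red or green; it is compatible with $\mathcal{L}(S_0,S_1)$ if each pair of $S_0$ and each pair of $S_1$ contains one red and one green element. $\mathcal{P}^o$ is the set of couples $(S_0,\phi)$ with $S_0$ a pair-partition of $[2k]$ and $\phi$ compatible with $\mathcal{L}(S_0,S_1)$. $\mathfrak{S}_{2k}$ acts on orientations: the color of $\sigma(i)$ in $\sigma\cdot\phi$ is the color of $i$ in $\phi$; $G$ acts diagonally on $\mathcal{P}^o$. $N^{(1)}_{S_0,S_1,S_2}(\lambda)$ is the number of functions $f$ from $[2k]$ to the boxes of $\lambda$ with, for all $l$: $f(l)=f(S_0(l))$; $f(l),f(S_1(l))$ in the same column; $f(l),f(S_2(l))$ in the same row. Zonal characters: $Z_\lambda=\sum_{|\rho|=|\lambda|}\theta^{(2)}_\rho(\lambda)p_\rho$ (Macdonald normalization); for $|\lambda|\ge|\mu|$, $\Sigma^{(2)}_\mu(\lambda)=\binom{|\lambda|-|\mu|+m_1(\mu)}{m_1(\mu)}z_\mu\theta^{(2)}_{\mu\cup1^{|\lambda|-|\mu|}}(\lambda)$ and $0$ otherwise. *)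

theory Defs
  imports Complex_Main "HOL-Library.FuncSet" "HOL-Library.Multiset"
begin

definition partitions :: "nat \<Rightarrow> nat list set" where
  "partitions n = {\<rho>. sorted_wrt (\<ge>) \<rho> \<and> 0 \<notin> set \<rho> \<and> sum_list \<rho> = n}"

definition is_partition :: "nat list \<Rightarrow> bool" where
  "is_partition la \<longleftrightarrow> la \<in> partitions (sum_list la)"

definition boxes :: "nat list \<Rightarrow> (nat \<times> nat) set" where
  "boxes la = {(i, j). i < length la \<and> j < la ! i}"

definition mult :: "nat list \<Rightarrow> nat \<Rightarrow> nat" where
  "mult \<rho> i = count (mset \<rho>) i"

definition zee :: "nat list \<Rightarrow> nat" where
  "zee \<rho> = (\<Prod>i\<in>set \<rho>. i ^ mult \<rho> i * fact (mult \<rho> i))"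

definition dominated :: "nat list \<Rightarrow> nat list \<Rightarrow> bool" where
  "dominated \<mu> la \<longleftrightarrow> (\<forall>i. sum_list (take i \<mu>) \<le> sum_list (take i la))"

definition conj_len :: "nat list \<Rightarrow> nat \<Rightarrow> nat" where
  "conj_len la j = card {i. i < length la \<and> j < la ! i}"

definition hook_c :: "real \<Rightarrow> nat list \<Rightarrow> real" where
  "hook_c \<alpha> la = (\<Prod>(i, j)\<in>boxes la.
      \<alpha> * real (la ! i - j - 1) + real (conj_len la j - i - 1) + 1)"

text \<open>Coefficient of the monomial x^mu in the power sum p_rho.\<close>
definition p_to_m :: "nat list \<Rightarrow> nat list \<Rightarrow> nat" where
  "p_to_m \<rho> \<mu> = card {f \<in> {..<length \<rho>} \<rightarrow>\<^sub>E {..<length \<mu>}.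
      \<forall>j<length \<mu>. (\<Sum>i\<in>{i. i < length \<rho> \<and> f i = j}. \<rho> ! i) = \<mu> ! j}"

text \<open>Coefficient of m_mu in the symmetric function sum_rho a(rho) p_rho of degree n.\<close>
definition m_coeff :: "nat \<Rightarrow> (nat list \<Rightarrow> real) \<Rightarrow> nat list \<Rightarrow> real" where
  "m_coeff n a \<mu> = (\<Sum>\<rho>\<in>partitions n. a \<rho> * real (p_to_m \<rho> \<mu>))"

text \<open>Characterisation (Macdonald VI.10) of the power-sum coefficients theta rho lambda of the
  Jack polynomials J^(alpha)_lambda, lambda a partition of n:
  orthogonality for the alpha-scalar product, unitriangularity of P_lambda in the monomial
  basis w.r.t. dominance, and J_lambda = c_lambda(alpha) P_lambda.
  The function is set to 0 outside partitions of n (for uniqueness).\<close>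
definition jack_family :: "real \<Rightarrow> nat \<Rightarrow> (nat list \<Rightarrow> nat list \<Rightarrow> real) \<Rightarrow> bool" where
  "jack_family \<alpha> n \<theta> \<longleftrightarrow>
     (\<forall>\<rho> la. \<rho> \<notin> partitions n \<or> la \<notin> partitions n \<longrightarrow> \<theta> \<rho> la = 0) \<and>
     (\<forall>la\<in>partitions n. \<forall>\<mu>\<in>partitions n. la \<noteq> \<mu> \<longrightarrow>
        (\<Sum>\<rho>\<in>partitions n. \<theta> \<rho> la * \<theta> \<rho> \<mu> * real (zee \<rho>) * \<alpha> ^ length \<rho>) = 0) \<and>
     (\<forall>la\<in>partitions n. \<forall>\<mu>\<in>partitions n. \<not> dominated \<mu> la \<longrightarrow>
        m_coeff n (\<lambda>\<rho>. \<theta> \<rho> la) \<mu> = 0) \<and>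
     (\<forall>la\<in>partitions n. m_coeff n (\<lambda>\<rho>. \<theta> \<rho> la) la = hook_c \<alpha> la)"

definition jack_theta :: "real \<Rightarrow> nat list \<Rightarrow> nat list \<Rightarrow> real" where
  "jack_theta \<alpha> \<rho> la = (THE \<theta>. jack_family \<alpha> (sum_list la) \<theta>) \<rho> la"

abbreviation zonal_theta :: "nat list \<Rightarrow> nat list \<Rightarrow> real" where
  "zonal_theta \<equiv> jack_theta 2"

definition Sigma2 :: "nat list \<Rightarrow> nat list \<Rightarrow> real" where
  "Sigma2 \<mu> la =
     (if sum_list la \<ge> sum_list \<mu> then
        real ((sum_list la - sum_list \<mu> + mult \<mu> 1) choose (mult \<mu> 1)) * real (zee \<mu>) *
        zonal_theta (\<mu> @ replicate (sum_list la - sum_list \<mu>) 1) la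
      else 0)"

text \<open>Pair-partitions of [2k] = fixed-point-free involutions of {1..2k}, identity elsewhere.\<close>
definition pair_partition :: "nat \<Rightarrow> (nat \<Rightarrow> nat) \<Rightarrow> bool" where
  "pair_partition k S \<longleftrightarrow>
     (\<forall>i\<in>{1..2*k}. S i \<in> {1..2*k} \<and> S i \<noteq> i \<and> S (S i) = i) \<and>
     (\<forall>i. i \<notin> {1..2*k} \<longrightarrow> S i = i)"

text \<open>Edges i, j of L(A,B) are adjacent iff j = A i or j = B i; loops = connected components,
  each viewed as its set of labels.\<close>
definition loop_step :: "nat \<Rightarrow> (nat \<Rightarrow> nat) \<Rightarrow> (nat \<Rightarrow> nat) \<Rightarrow> (nat \<times> nat) set" where
  "loop_step k A B = {(x, y). x \<in> {1..2*k} \<and> (y = A x \<or> y = B x)}"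

definition loop_of :: "nat \<Rightarrow> (nat \<Rightarrow> nat) \<Rightarrow> (nat \<Rightarrow> nat) \<Rightarrow> nat \<Rightarrow> nat set" where
  "loop_of k A B i = {j. (i, j) \<in> (loop_step k A B)\<^sup>*}"

definition loops :: "nat \<Rightarrow> (nat \<Rightarrow> nat) \<Rightarrow> (nat \<Rightarrow> nat) \<Rightarrow> nat set set" where
  "loops k A B = loop_of k A B ` {1..2*k}"

definition loop_type :: "nat \<Rightarrow> (nat \<Rightarrow> nat) \<Rightarrow> (nat \<Rightarrow> nat) \<Rightarrow> nat multiset" where
  "loop_type k A B = image_mset (\<lambda>L. card L div 2) (mset_set (loops k A B))"

definition loop_sign :: "nat \<Rightarrow> (nat \<Rightarrow> nat) \<Rightarrow> (nat \<Rightarrow> nat) \<Rightarrow> int" where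
  "loop_sign k A B = (-1) ^ (k - card (loops k A B))"

text \<open>Sequence j_{1}, j_{2}, ... (0-indexed here): j_{m+1} = S2 j_m for m odd (1-indexed),
  S1 j_m for m even.\<close>
fun jseq :: "(nat \<Rightarrow> nat) \<Rightarrow> (nat \<Rightarrow> nat) \<Rightarrow> nat \<Rightarrow> nat \<Rightarrow> nat" where
  "jseq S1 S2 c 0 = c"
| "jseq S1 S2 c (Suc m) = (if even m then S2 (jseq S1 S2 c m) else S1 (jseq S1 S2 c m))"

text \<open>r_L: sends j_m to j_{|L|+1-m} (1-indexed), fixes everything outside L.\<close>
definition reflection :: "(nat \<Rightarrow> nat) \<Rightarrow> (nat \<Rightarrow> nat) \<Rightarrow> nat set \<Rightarrow> nat \<Rightarrow> nat \<Rightarrow> nat" where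
  "reflection S1 S2 L c x =
     (if x \<in> L then jseq S1 S2 c (card L - 1 - (THE t. t < card L \<and> jseq S1 S2 c t = x))
      else x)"

inductive_set group_G :: "nat \<Rightarrow> (nat \<Rightarrow> nat) \<Rightarrow> (nat \<Rightarrow> nat) \<Rightarrow> (nat set \<Rightarrow> nat) \<Rightarrow> (nat \<Rightarrow> nat) set"
  for k S1 S2 b where
  G_id: "id \<in> group_G k S1 S2 b"
| G_step: "g \<in> group_G k S1 S2 b \<Longrightarrow> L \<in> loops k S1 S2 \<Longrightarrow>
             reflection S1 S2 L (b L) \<circ> g \<in> group_G k S1 S2 b"

text \<open>Orientation: True = red, False = green; False outside [2k].\<close>
definition orientation :: "nat \<Rightarrow> (nat \<Rightarrow> bool) \<Rightarrow> bool" where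
  "orientation k \<phi> \<longleftrightarrow> (\<forall>i. i \<notin> {1..2*k} \<longrightarrow> \<phi> i = False)"

definition compatible :: "nat \<Rightarrow> (nat \<Rightarrow> nat) \<Rightarrow> (nat \<Rightarrow> nat) \<Rightarrow> (nat \<Rightarrow> bool) \<Rightarrow> bool" where
  "compatible k S0 S1 \<phi> \<longleftrightarrow> (\<forall>i\<in>{1..2*k}. \<phi> (S0 i) \<noteq> \<phi> i \<and> \<phi> (S1 i) \<noteq> \<phi> i)"

definition P_o :: "nat \<Rightarrow> (nat \<Rightarrow> nat) \<Rightarrow> ((nat \<Rightarrow> nat) \<times> (nat \<Rightarrow> bool)) set" where
  "P_o k S1 = {(S0, \<phi>). pair_partition k S0 \<and> orientation k \<phi> \<and> compatible k S0 S1 \<phi>}"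

definition act :: "(nat \<Rightarrow> nat) \<Rightarrow> (nat \<Rightarrow> nat) \<times> (nat \<Rightarrow> bool) \<Rightarrow> (nat \<Rightarrow> nat) \<times> (nat \<Rightarrow> bool)" where
  "act \<sigma> x = (\<sigma> \<circ> fst x \<circ> inv \<sigma>, snd x \<circ> inv \<sigma>)"

definition orbits_G :: "nat \<Rightarrow> (nat \<Rightarrow> nat) \<Rightarrow> (nat \<Rightarrow> nat) \<Rightarrow> (nat set \<Rightarrow> nat)
    \<Rightarrow> ((nat \<Rightarrow> nat) \<times> (nat \<Rightarrow> bool)) set set" where
  "orbits_G k S1 S2 b = (\<lambda>x. (\<lambda>g. act g x) ` group_G k S1 S2 b) ` P_o k S1"

definition N1 :: "nat \<Rightarrow> (nat \<Rightarrow> nat) \<Rightarrow> (nat \<Rightarrow> nat) \<Rightarrow> (nat \<Rightarrow> nat) \<Rightarrow> nat list \<Rightarrow> nat" where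
  "N1 k S0 S1 S2 la = card {f \<in> {1..2*k} \<rightarrow>\<^sub>E boxes la. \<forall>l\<in>{1..2*k}.
      f l = f (S0 l) \<and> snd (f l) = snd (f (S1 l)) \<and> fst (f l) = fst (f (S2 l))}"

end

theory Submission
  imports "Jordan_Normal_Form.Char_Poly" Defs
begin

text \<open>
  For a pair \<open>(S1, S2)\<close> of matchings let \<open>X(S1, S2)\<close> be the sum over \<open>S0\<close> of \<open>(-2)\<close> to the number of loops of
  \<open>L(S0, S1)\<close> times the number of fillings. Since \<open>(-2)\<^sup>2 + 2 (-2) = 0\<close>, the three ways of matching four
  labels cancel, so only fillings in which every box is used by at most one pair contribute. Up to the
  factor counting pairs of a given type, \<open>X\<close> is the coefficient of the zonal polynomial:

  \<^item> Orthogonality: the type of \<open>(S1, S2)\<close> is that of \<open>(S2, S1)\<close>, so the scalar product of the polynomials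
    of \<open>\<lambda>\<close> and \<open>\<mu>\<close> is a sum of products of a factor matching columns of \<open>\<lambda>\<close> with rows of \<open>\<mu>\<close> and a
    factor with the roles exchanged. By cancellation the first forces \<open>\<mu> \<le> \<lambda>\<close>, the second \<open>\<lambda> \<le> \<mu>\<close>.
  \<^item> Triangularity is the same argument with a colouring in place of the rows of \<open>\<mu>\<close>.
  \<^item> The leading coefficient is the expectation, for a matrix of independent Gaussian variables, of the
    product over the columns of \<open>\<lambda>\<close> of the squared leading principal minors. Wick's rule and the Cayley
    identity for determinants remove one column at a time and produce the hook factors.

  The sum over orbits follows because the group acts freely and \<open>L(S0, S1)\<close> has \<open>2\<close> to the number of loops
  compatible orientations.
\<close>

section \<open>Matchings and their loops\<close>

text \<open>The Jack coefficients are given by a definite description, so a candidate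
  \<open>zonal\<close> is checked against the characterising conditions and uniqueness is proved
  separately. Matchings fit these conditions because of a count: the permutations fixing a pair of
  matchings of type \<rho> number z_rho 2^length(rho), exactly the weight of the scalar product at
  \<alpha> = 2. Weighted sums over \<rho> thus become plain sums over pairs of matchings. Once a
  filling and \<open>S0\<close> are fixed, columns restrict only \<open>S1\<close> and rows only
  \<open>S2\<close>, so these sums factor. The base -2 joins the sign of a loop to its two
  orientations: (-1)^(k - loops) 2^loops = (-1)^k (-2)^loops. The sum over orbits times 2^length(mu)
  is therefore (-1)^k X. Orthogonality and triangularity leave the scale open, and fixing it is the
  hard part. The Gaussian expectations involve polynomials of bounded degree only, so a finite
  signed quadrature stands in for the integral. A diagram with more than k boxes is reached by
  adding common pairs to both matchings; each needs a box of its own, and these choices account for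
  the binomial factor.\<close>

definition fixfree :: "'a set \<Rightarrow> ('a \<Rightarrow> 'a) \<Rightarrow> bool" where
  "fixfree V S \<longleftrightarrow> (\<forall>x\<in>V. S x \<in> V \<and> S x \<noteq> x \<and> S (S x) = x)"

text \<open>\<open>fixfree\<close> says nothing outside \<open>V\<close>, so the same function can
  be kept when labels are deleted from \<open>V\<close>. \<open>matchings\<close> pins the outside
  to the identity, so that a matching is determined by its pairs and can be counted.\<close>

definition matchings :: "'a set \<Rightarrow> ('a \<Rightarrow> 'a) set" where
  "matchings V = {S. fixfree V S \<and> (\<forall>x. x \<notin> V \<longrightarrow> S x = x)}"

definition matchings_of :: "'a set \<Rightarrow> ('a \<Rightarrow> 'b) \<Rightarrow> ('a \<Rightarrow> 'a) set" where
  "matchings_of V f = {S \<in> matchings V. \<forall>x\<in>V. f (S x) = f x}"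

definition step :: "'a set \<Rightarrow> ('a \<Rightarrow> 'a) \<Rightarrow> ('a \<Rightarrow> 'a) \<Rightarrow> ('a \<times> 'a) set" where
  "step V A B = {(x, y). x \<in> V \<and> (y = A x \<or> y = B x)}"

definition orb :: "'a set \<Rightarrow> ('a \<Rightarrow> 'a) \<Rightarrow> ('a \<Rightarrow> 'a) \<Rightarrow> 'a \<Rightarrow> 'a set" where
  "orb V A B x = {y. (x, y) \<in> (step V A B)\<^sup>*}"

definition orbs :: "'a set \<Rightarrow> ('a \<Rightarrow> 'a) \<Rightarrow> ('a \<Rightarrow> 'a) \<Rightarrow> 'a set set" where
  "orbs V A B = orb V A B ` V"

abbreviation num_loops :: "'a set \<Rightarrow> ('a \<Rightarrow> 'a) \<Rightarrow> ('a \<Rightarrow> 'a) \<Rightarrow> nat" where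
  "num_loops V A B \<equiv> card (orbs V A B)"

lemma fpfD:
  assumes "fixfree V S" "x \<in> V"
  shows "S x \<in> V" "S x \<noteq> x" "S (S x) = x"
  using assms by (auto simp: fixfree_def)

lemma fixfree_inj: "fixfree V S \<Longrightarrow> x \<in> V \<Longrightarrow> y \<in> V \<Longrightarrow> S x = S y \<longleftrightarrow> x = y"
  by (metis fixfree_def)

lemma matchings_fixfree: "S \<in> matchings V \<Longrightarrow> fixfree V S"
  by (simp add: matchings_def)

lemma matchings_outside: "S \<in> matchings V \<Longrightarrow> x \<notin> V \<Longrightarrow> S x = x"
  by (simp add: matchings_def)

lemma matchings_involution: "S \<in> matchings V \<Longrightarrow> S (S x) = x"
  unfolding matchings_def fixfree_def by (cases "x \<in> V") auto

lemma matchings_permutes: "S \<in> matchings V \<Longrightarrow> S permutes V"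
  unfolding permutes_def by (metis matchings_involution matchings_outside)

lemma finite_matchings [simp]: "finite V \<Longrightarrow> finite (matchings V)"
  by (rule finite_subset[OF _ finite_permutations[of V]]) (auto simp: matchings_permutes)

lemma finite_matchings_of [simp]: "finite V \<Longrightarrow> finite (matchings_of V f)"
  unfolding matchings_of_def by auto

lemma matchings_of_matchings: "S \<in> matchings_of V f \<Longrightarrow> S \<in> matchings V"
  by (simp add: matchings_of_def)

lemma matchings_of_const: "matchings_of V (\<lambda>_. c) = matchings V"
  by (simp add: matchings_of_def)

lemma matchings_empty [simp]: "matchings {} = {id}"
  by (auto simp: matchings_def fixfree_def)

section \<open>Loops as connected components\<close>

lemma step_cong:
  "(\<And>x. x \<in> V \<Longrightarrow> A x = A' x) \<Longrightarrow> (\<And>x. x \<in> V \<Longrightarrow> B x = B' x) \<Longrightarrow> step V A B = step V A' B'"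
  by (auto simp: step_def)

lemma orb_cong:
  "(\<And>x. x \<in> V \<Longrightarrow> A x = A' x) \<Longrightarrow> (\<And>x. x \<in> V \<Longrightarrow> B x = B' x) \<Longrightarrow> orb V A B = orb V A' B'"
  unfolding orb_def using step_cong[of V A A' B B'] by auto

lemma orbs_cong:
  "(\<And>x. x \<in> V \<Longrightarrow> A x = A' x) \<Longrightarrow> (\<And>x. x \<in> V \<Longrightarrow> B x = B' x) \<Longrightarrow> orbs V A B = orbs V A' B'"
  unfolding orbs_def using orb_cong[of V A A' B B'] by auto

lemma orb_commute: "orb V A B = orb V B A"
proof -
  have "step V A B = step V B A" by (auto simp: step_def)
  then show ?thesis unfolding orb_def by simp
qed

lemma orbs_commute: "orbs V A B = orbs V B A"
  unfolding orbs_def by (simp add: orb_commute)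

lemma orb_self [simp]: "x \<in> orb V A B x"
  by (simp add: orb_def)

lemma orb_step:
  assumes "y \<in> orb V A B x" "y \<in> V"
  shows "A y \<in> orb V A B x" "B y \<in> orb V A B x"
  using assms unfolding orb_def by (auto simp: step_def intro: rtrancl.rtrancl_into_rtrancl)

lemma orb_least:
  assumes "x \<in> C" and "\<And>y. y \<in> C \<Longrightarrow> y \<in> V \<Longrightarrow> A y \<in> C \<and> B y \<in> C"
  shows "orb V A B x \<subseteq> C"
proof
  fix y assume "y \<in> orb V A B x"
  then have "(x, y) \<in> (step V A B)\<^sup>*" by (simp add: orb_def)
  then show "y \<in> C"
    by induction (use assms in \<open>auto simp: step_def\<close>)
qed

lemma orb_subset: "fixfree V A \<Longrightarrow> fixfree V B \<Longrightarrow> x \<in> V \<Longrightarrow> orb V A B x \<subseteq> V"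
  by (rule orb_least) (auto simp: fixfree_def)

text \<open>Each step is undone by the same involution, so the labels from which \<open>x\<close>
  can be reached form a set closed under \<open>A\<close> and \<open>B\<close>. Reachability is
  therefore symmetric although \<open>step\<close> is directed.\<close>

lemma orb_eq:
  assumes V: "fixfree V A" "fixfree V B" "x \<in> V" and y: "y \<in> orb V A B x"
  shows "orb V A B y = orb V A B x"
proof
  show "orb V A B y \<subseteq> orb V A B x"
    by (rule orb_least) (use y orb_step in auto)
  have "orb V A B x \<subseteq> {z \<in> V. x \<in> orb V A B z}"
  proof (rule orb_least)
    fix z assume z: "z \<in> {z \<in> V. x \<in> orb V A B z}" "z \<in> V"
    have "orb V A B z \<subseteq> orb V A B (A z)"
    proof (rule orb_least)
      show "z \<in> orb V A B (A z)" using orb_step(1)[of "A z" V A B "A z"] V z by (simp add: fixfree_def)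
    qed (use orb_step in auto)
    moreover have "orb V A B z \<subseteq> orb V A B (B z)"
    proof (rule orb_least)
      show "z \<in> orb V A B (B z)" using orb_step(2)[of "B z" V A B "B z"] V z by (simp add: fixfree_def)
    qed (use orb_step in auto)
    ultimately show "A z \<in> {z \<in> V. x \<in> orb V A B z} \<and> B z \<in> {z \<in> V. x \<in> orb V A B z}"
      using z V by (auto simp: fixfree_def)
  qed (use V in auto)
  then have "x \<in> orb V A B y" using y by auto
  then show "orb V A B x \<subseteq> orb V A B y"
    by (intro orb_least) (use orb_step in auto)
qed

lemma orbs_eq_orb: "fixfree V A \<Longrightarrow> fixfree V B \<Longrightarrow> L \<in> orbs V A B \<Longrightarrow> x \<in> L \<Longrightarrow> L = orb V A B x"
  unfolding orbs_def using orb_eq[of V A B] by blast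

lemma orbs_disjoint:
  assumes "fixfree V A" "fixfree V B" "L \<in> orbs V A B" "M \<in> orbs V A B" "x \<in> L" "x \<in> M"
  shows "L = M"
  using orbs_eq_orb[OF assms(1,2,3,5)] orbs_eq_orb[OF assms(1,2,4,6)] by simp

lemma orbs_subset: "fixfree V A \<Longrightarrow> fixfree V B \<Longrightarrow> L \<in> orbs V A B \<Longrightarrow> L \<subseteq> V"
  unfolding orbs_def using orb_subset[of V A B] by auto

lemma finite_orbs [simp]: "finite V \<Longrightarrow> finite (orbs V A B)"
  unfolding orbs_def by simp

lemma orbs_empty [simp]: "orbs {} A B = {}"
  by (simp add: orbs_def)

section \<open>Removing two labels from a pair of matchings\<close>

lemma fixfree_delete:
  assumes "fixfree V A" "a \<in> V"
  shows "fixfree (V - {a, A a}) A"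
  using assms unfolding fixfree_def by (metis Diff_iff insert_iff singletonD)

text \<open>The deleted labels \<open>a\<close> and \<open>b\<close> were matched elsewhere by
  \<open>B\<close>; the two partners left alone are matched with each other.\<close>

lemma fixfree_contract:
  assumes "fixfree V B" "a \<in> V" "b \<in> V" "B a \<noteq> b" "a \<noteq> b"
  shows "fixfree (V - {a, b}) (B(B a := B b, B b := B a))"
proof -
  have "B b \<noteq> a" using assms by (metis fixfree_def)
  then show ?thesis using assms fixfree_inj[OF assms(1)] unfolding fixfree_def by (auto simp: fpfD)
qed

text \<open>Along a loop the stretch \<open>B a\<close>, \<open>a\<close>, \<open>A a\<close>,
  \<open>B (A a)\<close> is replaced by a single \<open>B\<close>-pair. The loop loses two labels
  but keeps the two outer ones, so no loop appears, vanishes, merges or splits.\<close>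

lemma num_loops_contract:
  assumes fin: "finite V" and A: "fixfree V A" and B: "fixfree V B" and a: "a \<in> V" and ne: "B a \<noteq> A a"
  shows "num_loops (V - {a, A a}) A (B(B a := B (A a), B (A a) := B a)) = num_loops V A B"
proof -
  define b c d where "b = A a" and "c = B a" and "d = B (A a)"
  define V' B' where "V' = V - {a, b}" and "B' = B(c := d, d := c)"
  have b: "b \<in> V" "A b = a" "b \<noteq> a" using A a by (auto simp: fixfree_def b_def)
  have c: "c \<in> V" "B c = a" "c \<noteq> a" "c \<noteq> b" using B a ne by (auto simp: fixfree_def c_def b_def)
  have d: "d \<in> V" "B d = b" "d \<noteq> a" "d \<noteq> b" "B b = d"
    using B b c by (auto simp: fixfree_def d_def b_def c_def)
  have cd': "c \<noteq> d" using c d b by auto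
  have cV: "c \<in> V'" "d \<in> V'" using c d by (auto simp: V'_def)
  have A': "fixfree V' A" using fixfree_delete[OF A a] by (simp add: V'_def b_def)
  have B': "fixfree V' B'"
    using fixfree_contract[OF B a b(1)] c b d by (simp add: V'_def B'_def c_def)
  have orb: "orb V' A B' x = orb V A B x - {a, b}" if x: "x \<in> V'" for x
  proof
    have xV: "x \<in> V" using x by (simp add: V'_def)
    have "orb V' A B' x \<subseteq> orb V A B x \<inter> V'"
    proof (rule orb_least)
      fix y assume y: "y \<in> orb V A B x \<inter> V'" "y \<in> V'"
      then have yV: "y \<in> V" "y \<in> orb V A B x" by (auto simp: V'_def)
      have "B' y \<in> orb V A B x"
      proof (cases "y = c \<or> y = d")
        case True
        then have "a \<in> orb V A B x \<or> b \<in> orb V A B x"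
          using orb_step(2)[OF yV(2,1)] c d by auto
        then have "a \<in> orb V A B x \<and> b \<in> orb V A B x"
          using orb_step(1)[of a V A B x] orb_step(1)[of b V A B x] a b by (auto simp: b_def)
        then have "c \<in> orb V A B x \<and> d \<in> orb V A B x"
          using orb_step(2)[of a V A B x] orb_step(2)[of b V A B x] a b d by (auto simp: c_def)
        then show ?thesis using True by (auto simp: B'_def)
      qed (use orb_step(2)[OF yV(2,1)] in \<open>auto simp: B'_def\<close>)
      then show "A y \<in> orb V A B x \<inter> V' \<and> B' y \<in> orb V A B x \<inter> V'"
        using orb_step(1)[OF yV(2,1)] A' B' y by (auto simp: fixfree_def)
    qed (use x in auto)
    then show "orb V' A B' x \<subseteq> orb V A B x - {a, b}" by (auto simp: V'_def)
    let ?O = "orb V' A B' x"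
    \<comment> \<open>The old loop is the new one with \<open>a\<close> and \<open>b\<close> put
      back exactly when it passes through the new pair of \<open>c\<close> and
      \<open>d\<close>.\<close>
    let ?C = "?O \<union> (if c \<in> ?O then {a, b} else {})"
    have cd: "c \<in> ?O \<longleftrightarrow> d \<in> ?O"
    proof
      show "c \<in> ?O \<Longrightarrow> d \<in> ?O" using orb_step(2)[of c V' A B' x] cV cd' by (auto simp: B'_def)
      show "d \<in> ?O \<Longrightarrow> c \<in> ?O" using orb_step(2)[of d V' A B' x] cV cd' by (auto simp: B'_def)
    qed
    have OV: "?O \<subseteq> V'" using orb_subset[OF A' B' x] .
    have "orb V A B x \<subseteq> ?C"
    proof (rule orb_least)
      fix y assume y: "y \<in> ?C" "y \<in> V"
      show "A y \<in> ?C \<and> B y \<in> ?C"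
      proof (cases "y \<in> ?O")
        case True
        then have "A y \<in> ?O" "B' y \<in> ?O" using orb_step[of y V' A B' x] OV by auto
        then show ?thesis using True cd c d by (cases "y = c \<or> y = d") (auto simp: B'_def)
      next
        case False
        then have "c \<in> ?O" "y = a \<or> y = b" using y by (auto split: if_splits)
        moreover have "A a = b" "B a = c" by (simp_all add: b_def c_def)
        ultimately show ?thesis using cd b(2) d(5) by (elim disjE) simp_all
      qed
    qed auto
    then show "orb V A B x - {a, b} \<subseteq> ?O" by (auto split: if_splits)
  qed
  \<comment> \<open>The surviving labels represent every loop: \<open>a\<close> lies on the loop of
    \<open>c\<close>, and \<open>b\<close> on that of \<open>d\<close>.\<close>
  have "orbs V A B = orb V A B ` V'"
  proof -
    have "orb V A B a = orb V A B c" "orb V A B b = orb V A B d"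
      using orb_eq[OF A B a, of c] orb_step(2)[of a V A B a] a
        orb_eq[OF A B b(1), of d] orb_step(2)[of b V A B b] b d(5) by (simp_all add: c_def)
    moreover have "V = insert a (insert b V')" using a b by (auto simp: V'_def)
    ultimately show ?thesis unfolding orbs_def using cV by auto
  qed
  moreover have "orbs V' A B' = (\<lambda>L. L - {a, b}) ` (orb V A B ` V')"
    unfolding orbs_def image_image using orb by auto
  moreover have "inj_on (\<lambda>L. L - {a, b}) (orb V A B ` V')"
  proof (rule inj_onI)
    fix L M assume "L \<in> orb V A B ` V'" "M \<in> orb V A B ` V'" and eq: "L - {a, b} = M - {a, b}"
    then obtain x y where xy: "x \<in> V'" "y \<in> V'" "L = orb V A B x" "M = orb V A B y" by auto
    then have "x \<in> L - {a, b}" by (auto simp: V'_def)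
    with eq have "x \<in> M" by auto
    then show "L = M" using orb_eq[OF A B, of y x] xy by (auto simp: V'_def)
  qed
  ultimately have "num_loops V' A B' = num_loops V A B" by (simp add: card_image)
  then show ?thesis by (simp add: V'_def B'_def b_def c_def d_def)
qed

text \<open>If \<open>A\<close> and \<open>B\<close> share the pair of \<open>a\<close>, that pair
  is a complete loop, and no other loop touches it.\<close>

lemma num_loops_delete:
  assumes fin: "finite V" and A: "fixfree V A" and B: "fixfree V B" and a: "a \<in> V" and eq: "B a = A a"
  shows "num_loops V A B = Suc (num_loops (V - {a, A a}) A B)"
proof -
  define V' where "V' = V - {a, A a}"
  have A': "fixfree V' A" and B': "fixfree V' B"
    using fixfree_delete[OF A a] fixfree_delete[OF B a] eq by (auto simp: V'_def)
  have bb: "A a \<in> V" "A (A a) = a" "B (A a) = a" using A B a eq by (auto simp: fixfree_def)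
  have oa: "orb V A B a = {a, A a}"
  proof
    show "orb V A B a \<subseteq> {a, A a}" by (rule orb_least) (use bb eq in auto)
    show "{a, A a} \<subseteq> orb V A B a" using orb_step(1)[of a V A B a] a by auto
  qed
  have orb: "orb V A B x = orb V' A B x" if "x \<in> V'" for x
  proof
    have sub: "orb V' A B x \<subseteq> V'" using orb_subset[OF A' B' that] .
    show "orb V A B x \<subseteq> orb V' A B x"
      by (rule orb_least) (use sub orb_step[of _ V' A B x] in auto)
    show "orb V' A B x \<subseteq> orb V A B x"
      by (rule orb_least) (use orb_step[of _ V A B x] in \<open>auto simp: V'_def\<close>)
  qed
  have V: "V = insert a (insert (A a) V')" using a bb by (auto simp: V'_def)
  have "orb V A B (A a) = orb V A B a" by (rule orb_eq[OF A B a]) (simp add: oa)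
  moreover have "orbs V A B = orb V A B ` insert a (insert (A a) V')"
    by (simp only: V[symmetric] orbs_def)
  ultimately have "orbs V A B = insert {a, A a} (orb V A B ` V')"
    by (simp add: oa)
  also have "orb V A B ` V' = orbs V' A B" unfolding orbs_def using orb by auto
  finally have "orbs V A B = insert {a, A a} (orbs V' A B)" .
  moreover have "{a, A a} \<notin> orbs V' A B"
    using orbs_subset[OF A' B'] by (auto simp: V'_def)
  ultimately show ?thesis using fin by (simp add: V'_def)
qed

lemma fixfree_even_card:
  assumes "finite V" "fixfree V A"
  shows "even (card V)"
  using assms
proof (induction "card V" arbitrary: V rule: less_induct)
  case less
  show ?case
  proof (cases "V = {}")
    case False
    then obtain a where a: "a \<in> V" by auto
    have Aa: "A a \<in> V" "A a \<noteq> a" using less.prems a by (auto simp: fixfree_def)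
    have c: "card V = Suc (Suc (card (V - {a, A a})))"
      using card.remove[of V a] card.remove[of "V - {a}" "A a"] a Aa less.prems(1)
      by (simp add: Diff_insert2 [symmetric] insert_commute)
    then have "even (card (V - {a, A a}))"
      using less.hyps[of "V - {a, A a}"] fixfree_delete[OF less.prems(2) a] less.prems by auto
    then show ?thesis using c by simp
  qed simp
qed

lemma card_delete_pair:
  assumes "finite V" "a \<in> V" "b \<in> V" "a \<noteq> b"
  shows "card V = Suc (Suc (card (V - {a, b})))"
  using card.remove[of V a] card.remove[of "V - {a}" b] assms
  by (simp add: Diff_insert2 [symmetric] insert_commute)

lemma matchings_upd: "S \<in> matchings (V - {a, b}) \<Longrightarrow> a \<in> V \<Longrightarrow> b \<in> V \<Longrightarrow> a \<noteq> b \<Longrightarrow> S(a := b, b := a) \<in> matchings V"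
  unfolding matchings_def fixfree_def by auto

section \<open>Weighted sums over all matchings\<close>

text \<open>Matchings are classified by the partner \<open>b\<close> of \<open>a\<close>, which must
  have the same value of \<open>f\<close>; the other pairs form a matching of the remaining
  labels.\<close>

lemma sum_matchings_of:
  fixes g :: "('a \<Rightarrow> 'a) \<Rightarrow> 'c::comm_monoid_add"
  assumes fin: "finite V" and a: "a \<in> V"
  shows "(\<Sum>S\<in>matchings_of V f. g S) =
    (\<Sum>b\<in>{b\<in>V - {a}. f b = f a}. \<Sum>S\<in>matchings_of (V - {a, b}) f. g (S(a := b, b := a)))"
proof -
  let ?B = "{b\<in>V - {a}. f b = f a}"
  have maps: "(\<lambda>S. S a) ` matchings_of V f \<subseteq> ?B"
    using a by (auto simp: matchings_of_def matchings_def fixfree_def)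
  have "(\<Sum>S\<in>matchings_of V f. g S) = (\<Sum>b\<in>?B. \<Sum>S\<in>{S\<in>matchings_of V f. S a = b}. g S)"
    using sum.group[OF finite_matchings_of[OF fin] _ maps, of g] fin by simp
  also have "\<dots> = (\<Sum>b\<in>?B. \<Sum>S\<in>matchings_of (V - {a, b}) f. g (S(a := b, b := a)))"
  proof (rule sum.cong[OF refl])
    fix b assume b: "b \<in> ?B"
    show "(\<Sum>S\<in>{S\<in>matchings_of V f. S a = b}. g S) = (\<Sum>S\<in>matchings_of (V - {a, b}) f. g (S(a := b, b := a)))"
    proof (rule sum.reindex_bij_witness
        [where i = "\<lambda>S. S(a := b, b := a)" and j = "\<lambda>S. S(a := a, b := b)"])
      fix S
      { assume S: "S \<in> {S \<in> matchings_of V f. S a = b}"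
        then have S': "S \<in> matchings V" "S a = b" "S b = a" "\<forall>x\<in>V. f (S x) = f x"
          using a by (auto simp: matchings_of_def matchings_def fixfree_def)
        show *: "(S(a := a, b := b))(a := b, b := a) = S" using S' b by auto
        have "S x \<noteq> a" "S x \<noteq> b" if "x \<noteq> a" "x \<noteq> b" for x
          using that matchings_involution[OF S'(1), of x] S'(2,3) by auto
        then show "S(a := a, b := b) \<in> matchings_of (V - {a, b}) f"
          using S' unfolding matchings_of_def matchings_def fixfree_def by auto
        show "g ((S(a := a, b := b))(a := b, b := a)) = g S" unfolding * .. }
      { assume S: "S \<in> matchings_of (V - {a, b}) f"
        then show "(S(a := b, b := a))(a := a, b := b) = S"
          using b by (auto simp: matchings_of_def matchings_def)
        have "S(a := b, b := a) \<in> matchings V" using matchings_upd[of S V a b] matchings_of_matchings[OF S] a b by auto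
        moreover have "\<forall>x\<in>V. f ((S(a := b, b := a)) x) = f x"
          using S b by (auto simp: matchings_of_def)
        ultimately show "S(a := b, b := a) \<in> {S \<in> matchings_of V f. S a = b}"
          using b by (simp add: matchings_of_def) }
    qed
  qed
  finally show ?thesis .
qed

text \<open>A pair added to \<open>S\<close> either closes a loop of its own, when \<open>B\<close>
  has the same pair, or lengthens a loop that \<open>S\<close> forms with the contracted
  \<open>B\<close>.\<close>

lemma num_loops_upd:
  assumes fin: "finite V" and a: "a \<in> V" and b: "b \<in> V" "b \<noteq> a"
    and S: "S \<in> matchings (V - {a, b})" and B: "fixfree V B"
  shows "num_loops V (S(a := b, b := a)) B =
    (if B a = b then Suc (num_loops (V - {a, b}) S B)
     else num_loops (V - {a, b}) S (B(B a := B b, B b := B a)))"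
proof -
  let ?A = "S(a := b, b := a)"
  have A: "fixfree V ?A" using matchings_upd[OF S a b(1)] b by (auto simp: matchings_def)
  have eq: "orbs (V - {a, b}) ?A B' = orbs (V - {a, b}) S B'" for B'
    by (rule orbs_cong) auto
  have Aa: "?A a = b" using b by simp
  show ?thesis
    using num_loops_delete[OF fin A B a] num_loops_contract[OF fin A B a] unfolding Aa eq by auto
qed

text \<open>Among the 2m + 1 possible partners of \<open>a\<close>, only \<open>B a\<close> closes a
  loop and gives a factor \<open>x\<close>; the 2m others give 1 each and leave a contracted problem
  of the same size. Hence the factor x + 2m, whatever \<open>B\<close> is.\<close>

lemma sum_matchings_power_num_loops:
  fixes x :: "'c::comm_ring_1"
  assumes "finite V" "fixfree V B"
  shows "(\<Sum>S\<in>matchings V. x ^ num_loops V S B) = (\<Prod>i<card V div 2. x + 2 * of_nat i)"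
  using assms
proof (induction "card V" arbitrary: V B rule: less_induct)
  case less
  show ?case
  proof (cases "V = {}")
    case False
    then obtain a where a: "a \<in> V" by auto
    define m where "m = card V div 2 - 1"
    have Ba: "B a \<in> V" "B a \<noteq> a" using less.prems a by (auto simp: fixfree_def)
    have c: "card V = Suc (Suc (card (V - {a, b})))" if "b \<in> V - {a}" for b
      using card_delete_pair[of V a b] that less.prems a by auto
    have m: "card (V - {a, b}) div 2 = m" if "b \<in> V - {a}" for b
      using c[OF that] by (simp add: m_def)
    have ev: "card V = 2 * Suc m" 
      using fixfree_even_card[OF less.prems] c[of "B a"] Ba m[of "B a"] by auto
    let ?P = "\<Prod>i<m. x + 2 * of_nat i"
    have inner: "(\<Sum>S\<in>matchings_of (V - {a, b}) (\<lambda>_. ()). x ^ num_loops V (S(a := b, b := a)) B) =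
       (if b = B a then x else 1) * ?P" if b: "b \<in> V - {a}" for b
    proof (cases "b = B a")
      case True
      have "(\<Sum>S\<in>matchings (V - {a, b}). x ^ num_loops V (S(a := b, b := a)) B) =
          (\<Sum>S\<in>matchings (V - {a, b}). x * x ^ num_loops (V - {a, b}) S B)"
        by (rule sum.cong[OF refl]) (use num_loops_upd[of V a b _ B] less.prems a b True in auto)
      also have "\<dots> = x * ?P"
        using less.hyps[of "V - {a, b}" B] c[OF b] m[OF b] less.prems fixfree_delete[OF less.prems(2) a] True
        by (simp add: sum_distrib_left[symmetric])
      finally show ?thesis using True by (simp add: matchings_of_const)
    next
      case F: False
      have "(\<Sum>S\<in>matchings (V - {a, b}). x ^ num_loops V (S(a := b, b := a)) B) =
          (\<Sum>S\<in>matchings (V - {a, b}). x ^ num_loops (V - {a, b}) S (B(B a := B b, B b := B a)))"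
        by (rule sum.cong[OF refl]) (use num_loops_upd[of V a b _ B] less.prems a b F in auto)
      also have "\<dots> = ?P"
        using less.hyps[of "V - {a, b}"] c[OF b] m[OF b] less.prems fixfree_contract[OF less.prems(2) a, of b] F b
        by auto
      finally show ?thesis using F by (simp add: matchings_of_const)
    qed
    have "(\<Sum>S\<in>matchings V. x ^ num_loops V S B) = (\<Sum>S\<in>matchings_of V (\<lambda>_. ()). x ^ num_loops V S B)" by (simp add: matchings_of_const)
    also have "\<dots> = (\<Sum>b\<in>V - {a}. (if b = B a then x else 1) * ?P)"
      unfolding sum_matchings_of[OF less.prems(1) a] using inner by (auto intro!: sum.cong)
    also have "\<dots> = (\<Sum>b\<in>V - {a}. (if b = B a then x else 1)) * ?P" by (simp add: sum_distrib_right)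
    also have "(\<Sum>b\<in>V - {a}. (if b = B a then x else 1)) = x + of_nat (card (V - {a} - {B a}))"
      using Ba less.prems(1) by (subst sum.remove[of _ "B a"]) auto
    also have "card (V - {a} - {B a}) = 2 * m"
      using ev a Ba less.prems(1) by (simp add: card_Diff_singleton_if)
    finally show ?thesis using ev by (simp add: mult.commute)
  qed simp
qed

text \<open>Labels outside the fibre of \<open>y\<close> are matched off pair by pair until only the
  fibre is left. There \<open>f\<close> imposes no constraint, at least four labels remain, and the
  product formula contains the factor -2 + 2.\<close>

lemma sum_matchings_of_neg2_power_eq_0:
  assumes "finite V" "fixfree V B" "card {v\<in>V. f v = y} > 2"
  shows "(\<Sum>S\<in>matchings_of V f. (-2::'c::comm_ring_1) ^ num_loops V S B) = 0"
  using assms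
proof (induction "card V" arbitrary: V B rule: less_induct)
  case less
  show ?case
  proof (cases "\<exists>a\<in>V. f a \<noteq> y")
    case True
    then obtain a where a: "a \<in> V" "f a \<noteq> y" by auto
    have "(\<Sum>S\<in>matchings_of (V - {a, b}) f. (-2::'c) ^ num_loops V (S(a := b, b := a)) B) = 0"
      if b: "b \<in> {b\<in>V - {a}. f b = f a}" for b
    proof -
      have c: "card V = Suc (Suc (card (V - {a, b})))"
        using card_delete_pair[of V a b] less.prems a b by auto
      have "{v\<in>V - {a, b}. f v = y} = {v\<in>V. f v = y}" using a b by auto
      then have fib: "card {v\<in>V - {a, b}. f v = y} > 2" using less.prems by simp
      show ?thesis
      proof (cases "b = B a")
        case True
        have "(\<Sum>S\<in>matchings_of (V - {a, b}) f. (-2::'c) ^ num_loops V (S(a := b, b := a)) B) =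
            (\<Sum>S\<in>matchings_of (V - {a, b}) f. (-2) * (-2) ^ num_loops (V - {a, b}) S B)"
          by (rule sum.cong[OF refl]) (use num_loops_upd[of V a b _ B] less.prems a b True in \<open>auto simp: matchings_of_matchings\<close>)
        also have "\<dots> = (-2) * (\<Sum>S\<in>matchings_of (V - {a, b}) f. (-2) ^ num_loops (V - {a, b}) S B)"
          by (rule sum_distrib_left[symmetric])
        also have "(\<Sum>S\<in>matchings_of (V - {a, b}) f. (-2::'c) ^ num_loops (V - {a, b}) S B) = 0"
          using less.hyps[of "V - {a, b}" B] c fib less.prems fixfree_delete[OF less.prems(2) a(1)] True by simp
        finally show ?thesis by (simp only: mult_zero_right)
      next
        case False
        have "(\<Sum>S\<in>matchings_of (V - {a, b}) f. (-2::'c) ^ num_loops V (S(a := b, b := a)) B) =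
            (\<Sum>S\<in>matchings_of (V - {a, b}) f. (-2) ^ num_loops (V - {a, b}) S (B(B a := B b, B b := B a)))"
          by (rule sum.cong[OF refl]) (use num_loops_upd[of V a b _ B] less.prems a b False in \<open>auto simp: matchings_of_matchings\<close>)
        then show ?thesis
          using less.hyps[of "V - {a, b}"] c fib less.prems fixfree_contract[OF less.prems(2) a(1), of b] False b
          by auto
      qed
    qed
    then show ?thesis unfolding sum_matchings_of[OF less.prems(1) a(1)] by (simp add: sum.neutral)
  next
    case False
    then have "matchings_of V f = matchings V" by (auto simp: matchings_of_def matchings_def fixfree_def)
    moreover have "{v\<in>V. f v = y} = V" using False by auto
    \<comment> \<open>\<open>B\<close> matches all of \<open>V\<close>, so the number of labels is
      even, and more than two means at least four.\<close>
    then have "card V div 2 \<ge> 2" using less.prems fixfree_even_card[OF less.prems(1,2)] by auto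
    then have "(\<Prod>i<card V div 2. (-2::'c) + 2 * of_nat i) = 0"
      using less.prems(1) by (intro prod_zero) (auto intro!: bexI[of _ 1])
    ultimately show ?thesis using sum_matchings_power_num_loops[OF less.prems(1,2), of "-2::'c"] by simp
  qed
qed

section \<open>Alternating colourings and signs\<close>

definition alternating :: "'a set \<Rightarrow> ('a \<Rightarrow> 'a) \<Rightarrow> ('a \<Rightarrow> 'a) \<Rightarrow> ('a \<Rightarrow> bool) set" where
  "alternating V A B =
     {\<phi>. (\<forall>x\<in>V. \<phi> (A x) \<noteq> \<phi> x \<and> \<phi> (B x) \<noteq> \<phi> x) \<and> (\<forall>x. x \<notin> V \<longrightarrow> \<phi> x = False)}"

text \<open>The colour of \<open>a\<close> is free, the colour of \<open>A a\<close> is its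
  opposite, and no other label is tied to these two.\<close>

lemma alternating_delete:
  assumes A: "fixfree V A" and B: "fixfree V B" and a: "a \<in> V" and eq: "B a = A a" and fin: "finite V"
  shows "card (alternating V A B) = 2 * card (alternating (V - {a, A a}) A B)"
proof -
  let ?V' = "V - {a, A a}"
  have b: "A a \<in> V" "A a \<noteq> a" "A (A a) = a" "B (A a) = a" using A B a eq by (auto simp: fixfree_def)
  have V': "A x \<in> ?V'" "B x \<in> ?V'" if "x \<in> ?V'" for x
    using fixfree_delete[OF A a] fixfree_delete[OF B a] eq that by (auto simp: fixfree_def)
  have "bij_betw (\<lambda>\<phi>. (\<phi> a, \<phi>(a := False, A a := False))) (alternating V A B)
      (UNIV \<times> alternating ?V' A B)"
  proof (rule bij_betw_byWitness[where f' = "\<lambda>(r, \<psi>). \<psi>(a := r, A a := \<not> r)"])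
    show "\<forall>\<phi>\<in>alternating V A B. (\<lambda>(r, \<psi>). \<psi>(a := r, A a := \<not> r)) (\<phi> a, \<phi>(a := False, A a := False)) = \<phi>"
      using a by (auto simp: alternating_def fun_eq_iff)
    show "\<forall>q\<in>UNIV \<times> alternating ?V' A B. (\<lambda>\<phi>. (\<phi> a, \<phi>(a := False, A a := False)))
        ((\<lambda>(r, \<psi>). \<psi>(a := r, A a := \<not> r)) q) = q"
      using b by (auto simp: alternating_def fun_eq_iff)
    show "(\<lambda>\<phi>. (\<phi> a, \<phi>(a := False, A a := False))) ` alternating V A B \<subseteq> UNIV \<times> alternating ?V' A B"
      using V' by (auto simp: alternating_def split: if_splits)
    show "(\<lambda>(r, \<psi>). \<psi>(a := r, A a := \<not> r)) ` (UNIV \<times> alternating ?V' A B) \<subseteq> alternating V A B"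
    proof safe
      fix r \<psi> assume psi: "\<psi> \<in> alternating ?V' A B"
      then have 1: "\<psi> (A x) \<noteq> \<psi> x" "\<psi> (B x) \<noteq> \<psi> x" if "x \<in> ?V'" for x
        using that unfolding alternating_def by blast+
      have 2: "\<psi> x = False" if "x \<notin> ?V'" for x
        using psi that unfolding alternating_def by blast
      let ?\<phi> = "\<psi>(a := r, A a := \<not> r)"
      have "?\<phi> (A x) \<noteq> ?\<phi> x \<and> ?\<phi> (B x) \<noteq> ?\<phi> x" if x: "x \<in> V" for x
      proof -
        consider "x = a" | "x = A a" | "x \<in> ?V'" using x by auto
        then show ?thesis
        proof cases
          case 3
          then show ?thesis using V'[of x] 1[of x] by auto
        qed (use b eq in auto)
      qed
      then show "?\<phi> \<in> alternating V A B" using 2 a b unfolding alternating_def by auto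
    qed
  qed
  then show ?thesis by (auto dest!: bij_betw_same_card simp: card_cartesian_product)
qed

text \<open>The two deleted labels are coloured by force: \<open>a\<close> opposite to
  \<open>B a\<close>, and \<open>A a\<close> like \<open>B a\<close>. The new pair keeps the
  alternation across the gap.\<close>

lemma alternating_contract:
  assumes A: "fixfree V A" and B: "fixfree V B" and a: "a \<in> V" and ne: "B a \<noteq> A a" and fin: "finite V"
  shows "card (alternating V A B) =
    card (alternating (V - {a, A a}) A (B(B a := B (A a), B (A a) := B a)))"
proof -
  define b c d where "b = A a" and "c = B a" and "d = B b"
  let ?V' = "V - {a, b}" and ?B' = "B(c := d, d := c)"
  have b: "b \<in> V" "A b = a" "b \<noteq> a" using A a by (auto simp: fixfree_def b_def)
  have c: "c \<in> V" "B c = a" "c \<noteq> a" "c \<noteq> b" using B a ne by (auto simp: fixfree_def c_def b_def)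
  have d: "d \<in> V" "B d = b" "d \<noteq> a" "d \<noteq> b" "B b = d" "c \<noteq> d"
    using B b c by (auto simp: fixfree_def d_def b_def c_def)
  have ab: "A a = b" "B a = c" by (simp_all add: b_def c_def)
  have VA: "A x \<in> ?V'" if "x \<in> ?V'" for x
    using fixfree_delete[OF A a] that by (auto simp: fixfree_def ab)
  have VB: "B x \<in> ?V'" if "x \<in> ?V'" "x \<noteq> c" "x \<noteq> d" for x
    using that B fixfree_inj[OF B] a b(1) c d ab by (auto simp: fixfree_def)
  have "bij_betw (\<lambda>\<phi>. \<phi>(a := False, b := False)) (alternating V A B) (alternating ?V' A ?B')"
  proof (rule bij_betw_byWitness[where f' = "\<lambda>\<psi>. \<psi>(a := \<not> \<psi> c, b := \<psi> c)"])
    have "\<phi> a = (\<not> \<phi> c)" "\<phi> b = \<phi> c" if "\<phi> \<in> alternating V A B" for \<phi>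
    proof -
      have "\<forall>x\<in>V. \<phi> (A x) \<noteq> \<phi> x \<and> \<phi> (B x) \<noteq> \<phi> x" using that by (simp add: alternating_def)
      from this[rule_format, OF a] show "\<phi> a = (\<not> \<phi> c)" "\<phi> b = \<phi> c" unfolding ab by auto
    qed
    then show "\<forall>\<phi>\<in>alternating V A B. (\<phi>(a := False, b := False))(a := \<not> (\<phi>(a := False, b := False)) c,
        b := (\<phi>(a := False, b := False)) c) = \<phi>"
      using c by (auto simp: fun_eq_iff)
    show "\<forall>\<psi>\<in>alternating ?V' A ?B'. (\<psi>(a := \<not> \<psi> c, b := \<psi> c))(a := False, b := False) = \<psi>"
      by (auto simp: alternating_def fun_eq_iff)
    show "(\<lambda>\<phi>. \<phi>(a := False, b := False)) ` alternating V A B \<subseteq> alternating ?V' A ?B'"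
    proof safe
      fix \<phi> assume "\<phi> \<in> alternating V A B"
      then have 1: "\<phi> (A x) \<noteq> \<phi> x" "\<phi> (B x) \<noteq> \<phi> x" if "x \<in> V" for x
        using that by (auto simp: alternating_def)
      have 2: "\<phi> x = False" if "x \<notin> V" for x
        using \<open>\<phi> \<in> _\<close> that by (auto simp: alternating_def)
      have "\<phi> c \<noteq> \<phi> d" using 1[OF a] 1[OF b(1)] ab d by auto
      then show "\<phi>(a := False, b := False) \<in> alternating ?V' A ?B'"
        using 1 2 VA VB c d unfolding alternating_def by auto
    qed
    show "(\<lambda>\<psi>. \<psi>(a := \<not> \<psi> c, b := \<psi> c)) ` alternating ?V' A ?B' \<subseteq> alternating V A B"
    proof safe
      fix \<psi> assume psi: "\<psi> \<in> alternating ?V' A ?B'"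
      then have 1: "\<psi> (A x) \<noteq> \<psi> x" "\<psi> (?B' x) \<noteq> \<psi> x" if "x \<in> ?V'" for x
        using that unfolding alternating_def by blast+
      have 2: "\<psi> x = False" if "x \<notin> ?V'" for x
        using psi that unfolding alternating_def by blast
      have cd: "\<psi> d \<noteq> \<psi> c" using 1(2)[of c] c d by auto
      have B1: "\<psi> (B x) \<noteq> \<psi> x" if "x \<in> ?V'" "x \<noteq> c" "x \<noteq> d" for x
        using 1(2)[of x] that by simp
      let ?\<phi> = "\<psi>(a := \<not> \<psi> c, b := \<psi> c)"
      have "?\<phi> (A x) \<noteq> ?\<phi> x \<and> ?\<phi> (B x) \<noteq> ?\<phi> x" if x: "x \<in> V" for x
      proof -
        consider "x = a" | "x = b" | "x = c" | "x = d" | "x \<in> ?V'" "x \<noteq> c" "x \<noteq> d" using x by auto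
        then show ?thesis
        proof cases
          case 1 then show ?thesis using ab b c by auto
        next
          case 2 then show ?thesis using b d cd by auto
        next
          case 3
          then have "x \<in> ?V'" using c by auto
          then show ?thesis using VA[of x] 1[of x] 3 b c by auto
        next
          case 4
          then have "x \<in> ?V'" using d by auto
          then show ?thesis using VA[of x] 1[of x] 4 d cd by auto
        next
          case 5
          then show ?thesis using VA[of x] VB[of x] 1(1)[of x] B1[of x] by auto
        qed
      qed
      then show "?\<phi> \<in> alternating V A B" using 2 a b unfolding alternating_def by auto
    qed
  qed
  then show ?thesis using bij_betw_same_card by (simp add: ab d)
qed

lemma card_alternating:
  assumes "finite V" "fixfree V A" "fixfree V B"
  shows "card (alternating V A B) = 2 ^ num_loops V A B"
  using assms
proof (induction "card V" arbitrary: V A B rule: less_induct)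
  case less
  show ?case
  proof (cases "V = {}")
    case True
    then have "alternating V A B = {\<lambda>_. False}" by (auto simp: alternating_def)
    then show ?thesis using True by simp
  next
    case False
    then obtain a where a: "a \<in> V" by auto
    have Aa: "A a \<in> V" "a \<noteq> A a" using less.prems a by (auto simp: fixfree_def)
    have c: "card (V - {a, A a}) < card V"
      using card_delete_pair[OF less.prems(1) a Aa] by simp
    note A' = fixfree_delete[OF less.prems(2) a]
    show ?thesis
    proof (cases "B a = A a")
      case True
      show ?thesis
        using less.hyps[OF c _ A'] fixfree_delete[OF less.prems(3) a] less.prems(1) True
          alternating_delete[OF less.prems(2,3) a True] num_loops_delete[OF less.prems a True]
        by simp
    next
      case F: False
      show ?thesis
        using less.hyps[OF c _ A' fixfree_contract[OF less.prems(3) a Aa(1) F Aa(2)]] less.prems(1)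
          alternating_contract[OF less.prems(2,3) a F] num_loops_contract[OF less.prems a F]
        by simp
    qed
  qed
qed

section \<open>The permutation of the red labels\<close>

text \<open>\<open>A\<close> after \<open>B\<close> changes the colour twice and so keeps red labels
  red. Its cycles on the red labels correspond to the loops, a loop of 2l labels giving a cycle of
  length l.\<close>

definition red_perm :: "'a set \<Rightarrow> ('a \<Rightarrow> 'a) \<Rightarrow> ('a \<Rightarrow> 'a) \<Rightarrow> ('a \<Rightarrow> bool) \<Rightarrow> 'a \<Rightarrow> 'a" where
  "red_perm V A B \<phi> v = (if v \<in> V \<and> \<phi> v then A (B v) else v)"

lemma red_perm_permutes:
  assumes "fixfree V A" "fixfree V B" "\<forall>x\<in>V. \<phi> (A x) \<noteq> \<phi> x \<and> \<phi> (B x) \<noteq> \<phi> x"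
  shows "red_perm V A B \<phi> permutes {v\<in>V. \<phi> v}"
proof (rule bij_imp_permutes)
  show "bij_betw (red_perm V A B \<phi>) {v \<in> V. \<phi> v} {v \<in> V. \<phi> v}"
    by (rule bij_betw_byWitness[where f' = "\<lambda>v. B (A v)"])
      (use assms in \<open>auto simp: red_perm_def fixfree_def\<close>)
qed (auto simp: red_perm_def)

text \<open>A loop of 2l labels contributes an l-cycle, of sign (-1)^(l-1). The induction avoids
  cycle decompositions: a contraction splits off one transposition, and deleting a loop of two
  labels removes a fixed point.\<close>

lemma sign_red_perm:
  assumes "finite V" "fixfree V A" "fixfree V B" "\<forall>x\<in>V. \<phi> (A x) \<noteq> \<phi> x \<and> \<phi> (B x) \<noteq> \<phi> x"
  shows "sign (red_perm V A B \<phi>) = (-1) ^ (card V div 2 + num_loops V A B)"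
  using assms
proof (induction "card V" arbitrary: V A B rule: less_induct)
  case less
  show ?case
  proof (cases "V = {}")
    case True
    then show ?thesis by (simp add: red_perm_def[abs_def])
  next
    case False
    then obtain x where "x \<in> V" by auto
    then have "\<exists>a\<in>V. \<phi> a" using less.prems by (metis fixfree_def)
    then obtain a where a: "a \<in> V" "\<phi> a" by auto
    define b where "b = A a"
    have b: "b \<in> V" "a \<noteq> b" "A b = a" "\<not> \<phi> b" using less.prems a by (auto simp: fixfree_def b_def)
    have c: "card V = Suc (Suc (card (V - {a, b})))"
      using card_delete_pair[OF less.prems(1) a(1) b(1,2)] .
    note A' = fixfree_delete[OF less.prems(2) a(1), folded b_def]
    show ?thesis
    proof (cases "B a = b")
      case True
      have B': "fixfree (V - {a, b}) B" using fixfree_delete[OF less.prems(3) a(1)] True by simp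
      have "red_perm V A B \<phi> = red_perm (V - {a, b}) A B \<phi>"
        using b True by (auto simp: red_perm_def fun_eq_iff)
      then show ?thesis
        using less.hyps[OF _ _ A' B'] less.prems c
          num_loops_delete[OF less.prems(1-3) a(1)] True by (simp add: b_def)
    next
      case F: False
      define c d where "c = B a" and "d = B b"
      let ?B' = "B(c := d, d := c)"
      have cc: "c \<in> V" "B c = a" "c \<noteq> a" "c \<noteq> b" "\<not> \<phi> c"
        using less.prems a F by (auto simp: fixfree_def c_def)
      have dd: "d \<in> V" "B d = b" "d \<noteq> b" "\<phi> d"
        using fpfD[OF less.prems(3) b(1)] less.prems(4) b(1,4) by (auto simp: d_def)
      have dd': "d \<noteq> a" "c \<noteq> d" using dd(2) cc(2) F b(2) by auto
      note dd = dd dd'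
      have ab: "A a = b" "B a = c" "B b = d" by (simp_all add: b_def c_def d_def)
      have B': "fixfree (V - {a, b}) ?B'"
        using fixfree_contract[OF less.prems(3) a(1) b(1) F b(2)] by (simp add: ab)
      have alt: "\<forall>x\<in>V - {a, b}. \<phi> (A x) \<noteq> \<phi> x \<and> \<phi> (?B' x) \<noteq> \<phi> x"
        using less.prems(4) cc dd by auto
      let ?p = "red_perm (V - {a, b}) A ?B' \<phi>"
      have "red_perm V A B \<phi> v = (?p \<circ> transpose a d) v" for v
      proof -
        consider "v = a" | "v = d" | "v \<noteq> a" "v \<noteq> d" by auto
        then show ?thesis
        proof cases
          case 1 then show ?thesis using a b dd cc ab by (simp add: red_perm_def)
        next
          case 2 then show ?thesis using a b dd cc ab by (simp add: red_perm_def)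
        next
          case 3 then show ?thesis using b cc by (auto simp: red_perm_def)
        qed
      qed
      then have "red_perm V A B \<phi> = ?p \<circ> transpose a d" by auto
      moreover have "permutation ?p"
        by (rule permutes_imp_permutation[OF _ red_perm_permutes[OF A' B' alt]]) (use less.prems(1) in simp)
      ultimately have s: "sign (red_perm V A B \<phi>) = - sign ?p"
        using dd by (simp add: sign_compose permutation_swap_id sign_swap_id)
      have n: "num_loops (V - {a, b}) A ?B' = num_loops V A B"
        using num_loops_contract[OF less.prems(1-3) a(1)] F by (simp add: ab)
      have IH: "sign ?p = (-1) ^ (card (V - {a, b}) div 2 + num_loops (V - {a, b}) A ?B')"
        by (rule less.hyps[OF _ _ A' B' alt]) (use less.prems(1) c in simp_all)
      show ?thesis unfolding s IH n c by simp
    qed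
  qed
qed

section \<open>Walking along a loop\<close>

lemma jseq_in:
  assumes "fixfree V A" "fixfree V B" "c \<in> V"
  shows "jseq A B c t \<in> V"
  using assms by (induction t) (auto simp: fixfree_def)

text \<open>If two terms at odd distance were equal, stepping the left one forward and the right one
  backward would apply the same involution and bring them closer by two. In the end two consecutive
  terms would coincide, against the absence of fixed points.\<close>

lemma jseq_odd_diff:
  assumes "fixfree V A" "fixfree V B" "c \<in> V"
  shows "jseq A B c t \<noteq> jseq A B c (t + 2 * n + 1)"
proof (induction n arbitrary: t)
  case 0
  show ?case
    using fpfD(2)[OF assms(1) jseq_in[OF assms], of t, THEN not_sym]
      fpfD(2)[OF assms(2) jseq_in[OF assms], of t, THEN not_sym] by simp
next
  case (Suc n)
  let ?j = "jseq A B c"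
  have V: "?j u \<in> V" for u using jseq_in[OF assms] .
  have "?j t = ?j (t + 2 * Suc n + 1) \<Longrightarrow> ?j (Suc t) = ?j (t + 2 * n + 2)"
    using fpfD(3)[OF assms(1) V, of "t + 2 * n + 2"] fpfD(3)[OF assms(2) V, of "t + 2 * n + 2"] by auto
  then show ?case using Suc[of "Suc t"] by auto
qed

text \<open>Terms at even distance are produced by the same involution, so an equality can be pulled
  back step by step to the start.\<close>

lemma jseq_cancel:
  assumes "fixfree V A" "fixfree V B" "c \<in> V" "jseq A B c t = jseq A B c (t + 2 * n)"
  shows "jseq A B c (2 * n) = c"
  using assms(4)
proof (induction t)
  case (Suc t)
  have V: "jseq A B c u \<in> V" for u using jseq_in[OF assms(1-3)] .
  have "jseq A B c t = jseq A B c (t + 2 * n)"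
    using Suc.prems fixfree_inj[OF assms(1) V V, of t "t + 2 * n"] fixfree_inj[OF assms(2) V V, of t "t + 2 * n"]
    by (auto split: if_splits)
  then show ?case using Suc.IH by simp
qed simp

lemma jseq_period_add:
  assumes "jseq A B c p = c" "even p"
  shows "jseq A B c (t + p) = jseq A B c t"
  by (induction t) (use assms in auto)

text \<open>By pigeonhole some term repeats, necessarily at even distance, and the repetition can be
  moved to the start. The least period enumerates the loop without repetition, since the set of
  terms is closed under both involutions.\<close>

lemma orb_jseq:
  assumes fin: "finite V" and A: "fixfree V A" and B: "fixfree V B" and c: "c \<in> V"
  defines "p \<equiv> card (orb V A B c)"
  shows "even p" "p > 0" "jseq A B c p = c" "bij_betw (jseq A B c) {..<p} (orb V A B c)"
    "range (jseq A B c) = orb V A B c"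
proof -
  let ?j = "jseq A B c"
  have "range ?j \<subseteq> V" using jseq_in[OF A B c] by auto
  then have "finite (range ?j)" using fin by (rule finite_subset)
  then have "\<not> inj ?j" using finite_imageD[of ?j UNIV] by auto
  then obtain s t where "s < t" "?j s = ?j t" unfolding inj_def by (metis nat_neq_iff)
  moreover have "even (t - s)"
  proof (rule ccontr)
    assume "odd (t - s)"
    then obtain n where "t - s = 2 * n + 1" by (elim oddE)
    then have "t = s + 2 * n + 1" using \<open>s < t\<close> by simp
    then show False using jseq_odd_diff[OF A B c, of s n] \<open>?j s = ?j t\<close> by simp
  qed
  then obtain n where "t - s = 2 * n" by (elim evenE)
  then have n: "t = s + 2 * n" "n > 0" using \<open>s < t\<close> by auto
  ultimately have "n > 0 \<and> ?j (2 * n) = c" using jseq_cancel[OF A B c, of s n] by simp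
  define q where "q = (LEAST n. n > 0 \<and> ?j (2 * n) = c)"
  have q: "q > 0" "?j (2 * q) = c"
    using LeastI[of "\<lambda>n. n > 0 \<and> ?j (2 * n) = c", OF \<open>n > 0 \<and> _\<close>] by (auto simp: q_def)
  have q_least: "m = 0 \<or> q \<le> m" if "?j (2 * m) = c" for m
    using Least_le[of "\<lambda>n. n > 0 \<and> ?j (2 * n) = c" m] that by (auto simp: q_def)
  have inj: "inj_on ?j {..<2 * q}"
  proof (rule linorder_inj_onI)
    fix x y assume xy: "x < y" "x \<in> {..<2 * q}" "y \<in> {..<2 * q}"
    show "?j x \<noteq> ?j y"
    proof
      assume eq: "?j x = ?j y"
      show False
      proof (cases "even (y - x)")
        case True
        then obtain m where "y - x = 2 * m" by (elim evenE)
        then have m: "y = x + 2 * m" "m > 0" "m < q" using xy by auto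
        then show False using jseq_cancel[OF A B c, of x m] eq q_least[of m] by simp
      next
        case False
        then obtain m where "y - x = 2 * m + 1" by (elim oddE)
        then have "y = x + 2 * m + 1" using xy by simp
        then show False using jseq_odd_diff[OF A B c, of x m] eq by simp
      qed
    qed
  qed auto
  have V: "?j u \<in> V" for u using jseq_in[OF A B c] .
  have per: "?j (u + 2 * q) = ?j u" for u by (rule jseq_period_add) (use q in auto)
  show rng: "range ?j = orb V A B c"
  proof
    have "?j u \<in> orb V A B c" for u
      by (induction u) (use orb_step[of _ V A B c] V in auto)
    then show "range ?j \<subseteq> orb V A B c" by auto
    show "orb V A B c \<subseteq> range ?j"
    proof (rule orb_least)
      show "c \<in> range ?j" by (rule range_eqI[of _ _ 0]) simp
      fix y assume "y \<in> range ?j"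
      \<comment> \<open>Adding a period gives \<open>y\<close> a predecessor in the sequence, even
        when it is the starting label.\<close>
      then obtain u where u: "y = ?j (Suc u)" by (metis per q(1) rangeE add_gr_0 gr0_conv_Suc mult_pos_pos zero_less_numeral)
      have "\<exists>w. A y = ?j w" "\<exists>w. B y = ?j w"
        using fpfD(3)[OF A V, of u] fpfD(3)[OF B V, of u] u
        by (cases "even u"; auto intro: exI[of _ u] exI[of _ "Suc (Suc u)"])+
      then show "A y \<in> range ?j \<and> B y \<in> range ?j" by auto
    qed
  qed
  have "?j u \<in> ?j ` {..<2 * q}" for u
  proof (induction u rule: less_induct)
    case (less u)
    then show ?case using per[of "u - 2 * q"] q(1) by (cases "u < 2 * q") auto
  qed
  then have img: "?j ` {..<2 * q} = orb V A B c" unfolding rng[symmetric] by auto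
  have "p = 2 * q" unfolding p_def img[symmetric] using card_image[OF inj] by simp
  then show "even p" "p > 0" "jseq A B c p = c" "bij_betw (jseq A B c) {..<p} (orb V A B c)"
    using q inj img by (auto simp: bij_betw_def)
qed

text \<open>At even positions \<open>B\<close> leads forward and \<open>A\<close> backward, at odd
  positions conversely. A step back along \<open>A\<close> is written as adding the period minus
  one, because it also occurs at position 0.\<close>

lemma jseq_nbrs:
  assumes fin: "finite V" and A: "fixfree V A" and B: "fixfree V B" and c: "c \<in> V"
  shows "A (jseq A B c t) = jseq A B c (if odd t then t + 1 else t + card (orb V A B c) - 1)"
    and "B (jseq A B c t) = jseq A B c (if even t then t + 1 else t - 1)"
proof -
  let ?j = "jseq A B c" and ?p = "card (orb V A B c)"
  note p = orb_jseq[OF fin A B c]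
  have V: "?j u \<in> V" for u using jseq_in[OF A B c] .
  show "A (?j t) = ?j (if odd t then t + 1 else t + ?p - 1)"
  proof (cases "odd t")
    case False
    obtain m where m: "t + ?p = Suc m" using p(2) by (metis add_gr_0 gr0_conv_Suc)
    then have "odd m" using False p(1) by (metis even_Suc even_add)
    have "?j t = ?j (Suc m)" using jseq_period_add[OF p(3,1), of t] m by simp
    then show ?thesis using fpfD(3)[OF A V, of m] \<open>odd m\<close> m False by simp
  qed simp
  show "B (?j t) = ?j (if even t then t + 1 else t - 1)"
    using fpfD(3)[OF B V, of "t - 1"] by (cases t) auto
qed

section \<open>Isomorphisms of pairs of matchings\<close>

definition isoms :: "'a set \<Rightarrow> ('a \<Rightarrow> 'a) \<Rightarrow> ('a \<Rightarrow> 'a) \<Rightarrow> 'b set \<Rightarrow> ('b \<Rightarrow> 'b) \<Rightarrow> ('b \<Rightarrow> 'b) \<Rightarrow> ('a \<Rightarrow> 'b) set" where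
  "isoms V A B W A' B' =
     {h \<in> V \<rightarrow>\<^sub>E W. bij_betw h V W \<and> (\<forall>x\<in>V. h (A x) = A' (h x) \<and> h (B x) = B' (h x))}"

definition loop_mset :: "'a set \<Rightarrow> ('a \<Rightarrow> 'a) \<Rightarrow> ('a \<Rightarrow> 'a) \<Rightarrow> nat multiset" where
  "loop_mset V A B = image_mset (\<lambda>L. card L div 2) (mset_set (orbs V A B))"

text \<open>The order of the automorphism group of a pair of matchings with these half-lengths: a
  loop of 2i labels has 2i automorphisms, and loops of equal length may be permuted.\<close>

definition zee_double :: "nat multiset \<Rightarrow> nat" where
  "zee_double M = (\<Prod>i\<in>set_mset M. (2 * i) ^ count M i * fact (count M i))"

lemma loop_mset_commute: "loop_mset V A B = loop_mset V B A"
  by (simp add: loop_mset_def orbs_commute)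

lemma size_loop_mset: "finite V \<Longrightarrow> size (loop_mset V A B) = num_loops V A B"
  by (simp add: loop_mset_def)

lemma zee_double_superset:
  assumes "finite S" "set_mset M \<subseteq> S"
  shows "zee_double M = (\<Prod>i\<in>S. (2 * i) ^ count M i * fact (count M i))"
  unfolding zee_double_def by (rule prod.mono_neutral_left) (use assms in \<open>auto simp: not_in_iff\<close>)

lemma zee_double_add: "zee_double (add_mset k N) = 2 * k * Suc (count N k) * zee_double N"
proof -
  let ?S = "insert k (set_mset N)" and ?N = "add_mset k N"
  have "zee_double ?N = (\<Prod>i\<in>?S. (2 * i) ^ count ?N i * fact (count ?N i))"
    by (rule zee_double_superset) auto
  also have "\<dots> = (2 * k) ^ Suc (count N k) * fact (Suc (count N k)) *
      (\<Prod>i\<in>?S - {k}. (2 * i) ^ count ?N i * fact (count ?N i))"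
    by (subst prod.remove[of _ k]) auto
  also have "(\<Prod>i\<in>?S - {k}. (2 * i) ^ count ?N i * fact (count ?N i)) =
      (\<Prod>i\<in>?S - {k}. (2 * i) ^ count N i * fact (count N i))"
    by (rule prod.cong) auto
  also have "(2 * k) ^ Suc (count N k) * fact (Suc (count N k)) * \<dots> =
      2 * k * Suc (count N k) * ((2 * k) ^ count N k * fact (count N k) * \<dots>)"
    by (simp only: power_Suc fact_Suc of_nat_id mult_ac)
  also have "(2 * k) ^ count N k * fact (count N k) * (\<Prod>i\<in>?S - {k}. (2 * i) ^ count N i * fact (count N i))
     = (\<Prod>i\<in>?S. (2 * i) ^ count N i * fact (count N i))"
    by (subst prod.remove[of ?S k]) auto
  also have "\<dots> = zee_double N" by (rule zee_double_superset[symmetric]) auto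
  finally show ?thesis .
qed

lemma zee_double_pos: "0 \<notin># M \<Longrightarrow> zee_double M > 0"
  unfolding zee_double_def by (intro prod_pos) (metis fact_gt_zero mult_pos_pos not_gr0 zero_less_numeral zero_less_power)

lemma orb_iso_image:
  assumes A: "fixfree V A" and B: "fixfree V B" and A': "fixfree W A'" and B': "fixfree W B'"
    and h: "bij_betw h V W" "\<And>x. x \<in> V \<Longrightarrow> h (A x) = A' (h x) \<and> h (B x) = B' (h x)"
    and x: "x \<in> V"
  shows "orb W A' B' (h x) = h ` orb V A B x"
proof
  have OV: "orb V A B x \<subseteq> V" by (rule orb_subset[OF A B x])
  show "orb W A' B' (h x) \<subseteq> h ` orb V A B x"
  proof (rule orb_least)
    fix y assume "y \<in> h ` orb V A B x"
    then obtain z where z: "y = h z" "z \<in> orb V A B x" "z \<in> V" using OV by auto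
    then show "A' y \<in> h ` orb V A B x \<and> B' y \<in> h ` orb V A B x"
      using h(2)[OF z(3)] orb_step[OF z(2,3)] by (metis imageI)
  qed simp
  have "orb V A B x \<subseteq> {z \<in> V. h z \<in> orb W A' B' (h x)}"
  proof (rule orb_least)
    fix y assume y: "y \<in> {z \<in> V. h z \<in> orb W A' B' (h x)}"
    then have "h y \<in> W" using h(1) by (auto simp: bij_betw_def)
    then show "A y \<in> {z \<in> V. h z \<in> orb W A' B' (h x)} \<and> B y \<in> {z \<in> V. h z \<in> orb W A' B' (h x)}"
      using y orb_step[of "h y" W A' B' "h x"] h(2)[of y] A B by (auto simp: fixfree_def)
  qed (use x in auto)
  then show "h ` orb V A B x \<subseteq> orb W A' B' (h x)" by auto
qed

lemma orbs_iso_image: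
  assumes "fixfree V A" "fixfree V B" "fixfree W A'" "fixfree W B'"
    and h: "bij_betw h V W" "\<And>x. x \<in> V \<Longrightarrow> h (A x) = A' (h x) \<and> h (B x) = B' (h x)"
  shows "orbs W A' B' = (`) h ` orbs V A B"
proof -
  have "orbs W A' B' = orb W A' B' ` h ` V" using h(1) by (simp add: orbs_def bij_betw_def)
  also have "\<dots> = (\<lambda>x. h ` orb V A B x) ` V" unfolding image_image
    by (rule image_cong) (use orb_iso_image[OF assms(1-4) h] in auto)
  finally show ?thesis by (simp add: orbs_def image_image)
qed

lemma num_loops_iso:
  assumes "fixfree V A" "fixfree V B" "fixfree W A'" "fixfree W B'"
    and h: "bij_betw h V W" "\<And>x. x \<in> V \<Longrightarrow> h (A x) = A' (h x) \<and> h (B x) = B' (h x)"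
  shows "num_loops W A' B' = num_loops V A B" "loop_mset W A' B' = loop_mset V A B"
proof -
  have inj: "inj_on ((`) h) (orbs V A B)"
    by (rule inj_on_subset[OF inj_on_image_Pow[of h V]])
      (use h(1) orbs_subset[OF assms(1,2)] in \<open>auto simp: bij_betw_def\<close>)
  have eq: "orbs W A' B' = (`) h ` orbs V A B" by (rule orbs_iso_image[OF assms(1-4) h])
  show "num_loops W A' B' = num_loops V A B" unfolding eq by (rule card_image[OF inj])
  have "card (h ` L) = card L" if "L \<in> orbs V A B" for L
    by (rule card_image) (use that h(1) orbs_subset[OF assms(1,2)] in \<open>auto simp: bij_betw_def intro: inj_on_subset\<close>)
  then have "image_mset (\<lambda>L. card (h ` L) div 2) (mset_set (orbs V A B)) =
      image_mset (\<lambda>L. card L div 2) (mset_set (orbs V A B))"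
    by (intro image_mset_cong) (metis count_mset_set(2,3) elem_mset_set mset_set.infinite set_mset_empty empty_iff)
  then show "loop_mset W A' B' = loop_mset V A B" unfolding loop_mset_def eq
    by (simp add: image_mset_mset_set[OF inj, symmetric] multiset.map_comp comp_def)
qed

lemma orb_restrict:
  assumes A: "fixfree V A" and B: "fixfree V B" and L: "L \<in> orbs V A B" and x: "x \<in> V - L"
  shows "orb (V - L) A B x = orb V A B x"
proof
  have OV: "orb V A B x \<subseteq> V - L"
  proof -
    have "orb V A B x \<in> orbs V A B" using x by (auto simp: orbs_def)
    then have "z \<notin> L" if "z \<in> orb V A B x" for z
      using orbs_disjoint[OF A B L, of "orb V A B x" z] that x by auto
    then show ?thesis using orb_subset[OF A B, of x] x by auto
  qed
  show "orb V A B x \<subseteq> orb (V - L) A B x"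
  proof -
    have "orb V A B x \<subseteq> orb (V - L) A B x \<inter> orb V A B x"
      by (rule orb_least) (use OV orb_step[of _ "V - L" A B x] orb_step[of _ V A B x] in auto)
    then show ?thesis by auto
  qed
  show "orb (V - L) A B x \<subseteq> orb V A B x"
    by (rule orb_least) (use orb_step[of _ V A B x] in auto)
qed

lemma fixfree_minus_orb:
  assumes A: "fixfree V A" and B: "fixfree V B" and L: "L \<in> orbs V A B"
  shows "fixfree (V - L) A" "fixfree (V - L) B"
proof -
  have "A x \<notin> L" "B x \<notin> L" if "x \<in> V - L" for x
  proof -
    have "L = orb V A B y" if "y \<in> L" for y using orbs_eq_orb[OF A B L that] .
    then show "A x \<notin> L" "B x \<notin> L"
      using orb_step[of "A x" V A B "A x"] orb_step[of "B x" V A B "B x"] that A B by (auto simp: fixfree_def)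
  qed
  then show "fixfree (V - L) A" "fixfree (V - L) B" using A B by (auto simp: fixfree_def)
qed

lemma orbs_minus_orb:
  assumes A: "fixfree V A" and B: "fixfree V B" and L: "L \<in> orbs V A B"
  shows "orbs (V - L) A B = orbs V A B - {L}"
proof
  show "orbs (V - L) A B \<subseteq> orbs V A B - {L}"
  proof
    fix M assume "M \<in> orbs (V - L) A B"
    then obtain x where x: "x \<in> V - L" "M = orb (V - L) A B x" by (auto simp: orbs_def)
    then have "M = orb V A B x" using orb_restrict[OF A B L] by simp
    then show "M \<in> orbs V A B - {L}" using x by (auto simp: orbs_def)
  qed
  show "orbs V A B - {L} \<subseteq> orbs (V - L) A B"
  proof
    fix M assume M: "M \<in> orbs V A B - {L}"
    then obtain x where x: "x \<in> V" "M = orb V A B x" by (auto simp: orbs_def)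
    then have "x \<notin> L" using M orbs_eq_orb[OF A B L, of x] by auto
    then show "M \<in> orbs (V - L) A B" using x orb_restrict[OF A B L, of x] by (auto simp: orbs_def)
  qed
qed

lemma loop_mset_minus_orb:
  assumes "finite V" "fixfree V A" "fixfree V B" "L \<in> orbs V A B"
  shows "loop_mset V A B = add_mset (card L div 2) (loop_mset (V - L) A B)"
proof -
  have "mset_set (orbs V A B) = add_mset L (mset_set (orbs (V - L) A B))"
    unfolding orbs_minus_orb[OF assms(2-4)] by (rule mset_set.remove) (use assms(1,4) in auto)
  then show ?thesis by (simp add: loop_mset_def)
qed

text \<open>Both loops are walked along in parallel, the t-th term going to the t-th term. The
  common period makes this well defined, and the neighbours of a term depend only on its
  position.\<close>

lemma orb_isoms:
  fixes V W :: "nat set"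
  assumes V: "finite V" "fixfree V A" "fixfree V B" "x \<in> V" and W: "finite W" "fixfree W A'" "fixfree W B'" "y \<in> W"
    and eq: "card (orb V A B x) = card (orb W A' B' y)"
  obtains \<tau> where "bij_betw \<tau> (orb V A B x) (orb W A' B' y)" "\<tau> x = y"
    "\<And>v. v \<in> orb V A B x \<Longrightarrow> \<tau> (A v) = A' (\<tau> v) \<and> \<tau> (B v) = B' (\<tau> v)"
proof -
  let ?L = "orb V A B x" and ?M = "orb W A' B' y"
  let ?j = "jseq A B x" and ?j' = "jseq A' B' y"
  define p where "p = card ?L"
  define \<tau> where "\<tau> v = ?j' (inv_into {..<p} ?j v)" for v
  note P = orb_jseq[OF V, folded p_def] and P' = orb_jseq[OF W, folded eq p_def]
  have j: "\<tau> (?j t) = ?j' t" for t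
  proof (induction t rule: less_induct)
    case (less t)
    show ?case
    proof (cases "t < p")
      case True
      then show ?thesis using P(4) unfolding \<tau>_def by (simp add: bij_betw_def inv_into_f_f)
    next
      case False
      then show ?thesis
        using less[of "t - p"] P(2) jseq_period_add[OF P(3,1), of "t - p"]
          jseq_period_add[OF P'(3,1), of "t - p"] by simp
    qed
  qed
  show ?thesis
  proof
    have "bij_betw (?j' \<circ> inv_into {..<p} ?j) ?L ?M"
      by (rule bij_betw_trans[OF bij_betw_inv_into[OF P(4)] P'(4)])
    then show "bij_betw \<tau> ?L ?M" by (simp add: \<tau>_def[abs_def] comp_def)
    show "\<tau> x = y" using j[of 0] by simp
    fix v assume "v \<in> ?L"
    then obtain t where t: "v = ?j t" using P(5) by auto
    show "\<tau> (A v) = A' (\<tau> v) \<and> \<tau> (B v) = B' (\<tau> v)"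
      by (simp only: t jseq_nbrs[OF V] jseq_nbrs[OF W] j eq)
  qed
qed

text \<open>The set where the two maps agree contains \<open>x\<close> and is closed under
  \<open>A\<close> and \<open>B\<close>, so it is the whole loop.\<close>

lemma intertwiner_eq_on_orb:
  assumes A: "fixfree V A" and B: "fixfree V B" and x: "x \<in> V" and eq: "h x = g x"
    and h: "\<And>v. v \<in> orb V A B x \<Longrightarrow> h (A v) = A' (h v) \<and> h (B v) = B' (h v)"
    and g: "\<And>v. v \<in> orb V A B x \<Longrightarrow> g (A v) = A' (g v) \<and> g (B v) = B' (g v)"
    and v: "v \<in> orb V A B x"
  shows "h v = g v"
proof -
  have "orb V A B x \<subseteq> {v \<in> orb V A B x. h v = g v}"
    by (rule orb_least) (use eq h g orb_step[of _ V A B x] in auto)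
  then show ?thesis using v by auto
qed

text \<open>The image of one label \<open>x\<close> can be any label on a loop of the same length,
  and it fixes the map on the loop of \<open>x\<close>. What remains is an isomorphism between the
  complements; \<open>zee_double_add\<close> is the same recursion.\<close>

lemma card_isoms:
  fixes V W :: "nat set"
  assumes "finite V" "fixfree V A" "fixfree V B" "finite W" "fixfree W A'" "fixfree W B'"
    and "loop_mset V A B = M" "loop_mset W A' B' = M"
  shows "card (isoms V A B W A' B') = zee_double M"
  using assms
proof (induction M arbitrary: V W rule: measure_induct_rule[of size])
  case (less M)
  note V = less.prems(1-3) and W = less.prems(4-6)
  show ?case
  proof (cases "M = {#}")
    case True
    have "orbs V A B = {}" "orbs W A' B' = {}"
      using less.prems True by (auto simp: loop_mset_def mset_set_empty_iff)
    then have "V = {}" "W = {}" by (auto simp: orbs_def)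
    then have "isoms V A B W A' B' = {\<lambda>_. undefined}" by (auto simp: isoms_def bij_betw_def)
    then show ?thesis using True by (simp add: zee_double_def)
  next
    case False
    have "V \<noteq> {}"
    proof
      assume "V = {}"
      then show False using less.prems(7) False by (simp add: loop_mset_def)
    qed
    then obtain x where x: "x \<in> V" by auto
    define L where "L = orb V A B x"
    define k where "k = card L div 2"
    have L: "L \<in> orbs V A B" "x \<in> L" "L \<subseteq> V" using x orb_subset[OF V(2,3) x] by (auto simp: orbs_def L_def)
    have cL: "card L = 2 * k" "k > 0"
      using orb_jseq(1,2)[OF V x] by (auto simp: k_def L_def elim!: evenE)
    define N where "N = loop_mset (V - L) A B"
    have M: "M = add_mset k N"
      using loop_mset_minus_orb[OF V L(1)] less.prems(7) by (simp add: N_def k_def)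
    define Y where "Y = {y\<in>W. card (orb W A' B' y) = 2 * k}"
    have disj: "disjoint (orbs W A' B')"
      using orbs_disjoint[OF W(2,3)] by (auto simp: disjoint_def)
    have cardY: "card Y = 2 * k * Suc (count N k)"
    proof -
      let ?K = "{L \<in> orbs W A' B'. card L div 2 = k}"
      have ev: "card L = 2 * (card L div 2)" if "L \<in> orbs W A' B'" for L
        using that orb_jseq(1)[OF W] by (auto simp: orbs_def)
      have "Y = \<Union>?K"
      proof
        show "Y \<subseteq> \<Union>?K" unfolding Y_def orbs_def by fastforce
        show "\<Union>?K \<subseteq> Y"
        proof safe
          fix y L assume "y \<in> L" "L \<in> orbs W A' B'" "k = card L div 2"
          then show "y \<in> Y" using orbs_eq_orb[OF W(2,3), of L y] orbs_subset[OF W(2,3), of L] ev[of L]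
            unfolding Y_def by auto
        qed
      qed
      moreover have "card (\<Union>?K) = sum card ?K"
        by (rule card_Union_disjoint)
          (use disj finite_subset[OF orbs_subset[OF W(2,3)] W(1)] in \<open>auto simp: pairwise_def disjoint_def\<close>)
      moreover have "sum card ?K = (\<Sum>L\<in>?K. 2 * k)" by (rule sum.cong) (use ev in auto)
      moreover have "card ?K = count M k"
        using less.prems(8) W(1) by (auto simp: loop_mset_def count_image_mset vimage_def Int_def conj_commute
            intro!: arg_cong[of _ _ card])
      ultimately show ?thesis using M by simp
    qed
    have part: "isoms V A B W A' B' = (\<Union>y\<in>Y. {h \<in> isoms V A B W A' B'. h x = y})"
    proof -
      have "h x \<in> Y" if "h \<in> isoms V A B W A' B'" for h
      proof -
        have h: "bij_betw h V W" "\<And>x. x \<in> V \<Longrightarrow> h (A x) = A' (h x) \<and> h (B x) = B' (h x)"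
          using that by (auto simp: isoms_def)
        have "card (h ` L) = card L"
          by (rule card_image) (use h(1) L in \<open>auto simp: bij_betw_def intro: inj_on_subset\<close>)
        then show ?thesis
          using orb_iso_image[OF V(2,3) W(2,3) h x] h(1) x cL by (auto simp: Y_def L_def bij_betw_def)
      qed
      then show ?thesis by auto
    qed
    have fib: "card {h \<in> isoms V A B W A' B'. h x = y} = zee_double N" if y: "y \<in> Y" for y
    proof -
      define L' where "L' = orb W A' B' y"
      have yW: "y \<in> W" using y by (simp add: Y_def)
      have L': "L' \<in> orbs W A' B'" "y \<in> L'" "L' \<subseteq> W" "card L' = 2 * k"
        using y orb_subset[OF W(2,3) yW] by (auto simp: orbs_def L'_def Y_def)
      obtain \<tau> where t: "bij_betw \<tau> L L'" "\<tau> x = y"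
        "\<And>v. v \<in> L \<Longrightarrow> \<tau> (A v) = A' (\<tau> v) \<and> \<tau> (B v) = B' (\<tau> v)"
        using orb_isoms[OF V x W yW] cL L' unfolding L_def L'_def by metis
      note V' = fixfree_minus_orb[OF V(2,3) L(1)] and W' = fixfree_minus_orb[OF W(2,3) L'(1)]
      have IH: "card (isoms (V - L) A B (W - L') A' B') = zee_double N"
      proof (rule less.IH)
        show "size N < size M" by (simp add: M)
        show "loop_mset (W - L') A' B' = N"
          using loop_mset_minus_orb[OF W L'(1)] less.prems(8) M L'(4) by simp
      qed (use V W V' W' in \<open>auto simp: N_def\<close>)
      have AL: "A v \<in> L" "B v \<in> L" if "v \<in> L" for v
        using orb_step[of v V A B x] that L(3) by (auto simp: L_def)
      \<comment> \<open>A map between the complements is completed by the isomorphism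
        \<open>\<tau>\<close> of the two loops, the only one that sends \<open>x\<close> to
        \<open>y\<close>.\<close>
      have "bij_betw (\<lambda>h. restrict h (V - L)) {h \<in> isoms V A B W A' B'. h x = y}
         (isoms (V - L) A B (W - L') A' B')"
      proof (rule bij_betw_byWitness[where f' = "\<lambda>g v. if v \<in> V - L then g v else if v \<in> L then \<tau> v else undefined"])
        have h\<tau>: "h v = \<tau> v" if h: "h \<in> isoms V A B W A' B'" "h x = y" and v: "v \<in> L" for h v
          by (rule intertwiner_eq_on_orb[OF V(2,3) x, of h \<tau> A' B'])
            (use h v t L(3) in \<open>auto simp: isoms_def L_def\<close>)
        then show "\<forall>h\<in>{h \<in> isoms V A B W A' B'. h x = y}.
            (\<lambda>v. if v \<in> V - L then restrict h (V - L) v else if v \<in> L then \<tau> v else undefined) = h"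
          using L(3) by (auto simp: fun_eq_iff isoms_def PiE_def extensional_def)
        show "\<forall>g\<in>isoms (V - L) A B (W - L') A' B'. restrict
            (\<lambda>v. if v \<in> V - L then g v else if v \<in> L then \<tau> v else undefined) (V - L) = g"
          by (auto simp: fun_eq_iff isoms_def PiE_def extensional_def)
        show "(\<lambda>h. restrict h (V - L)) ` {h \<in> isoms V A B W A' B'. h x = y} \<subseteq> isoms (V - L) A B (W - L') A' B'"
        proof safe
          fix h assume h: "h \<in> isoms V A B W A' B'" "y = h x"
          then have bij: "bij_betw h V W" and hAB: "\<And>v. v \<in> V \<Longrightarrow> h (A v) = A' (h v) \<and> h (B v) = B' (h v)"
            by (auto simp: isoms_def)
          have "h ` L = L'" unfolding L'_def h(2) L_def
            using orb_iso_image[OF V(2,3) W(2,3) bij hAB x] by simp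
          then have "bij_betw h (V - L) (W - L')"
            using bij L(3) by (auto simp: bij_betw_def inj_on_image_set_diff[OF _ Diff_subset] intro: inj_on_diff)
          then have "bij_betw (restrict h (V - L)) (V - L) (W - L')"
            by (simp add: bij_betw_def inj_on_def)
          then show "restrict h (V - L) \<in> isoms (V - L) A B (W - L') A' B'"
            using hAB V' unfolding isoms_def by (auto simp: fixfree_def bij_betw_def)
        qed
        show "(\<lambda>g v. if v \<in> V - L then g v else if v \<in> L then \<tau> v else undefined) `
            isoms (V - L) A B (W - L') A' B' \<subseteq> {h \<in> isoms V A B W A' B'. h x = y}"
        proof safe
          fix g assume g: "g \<in> isoms (V - L) A B (W - L') A' B'"
          let ?h = "\<lambda>v. if v \<in> V - L then g v else if v \<in> L then \<tau> v else undefined"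
          show "?h x = y" using L(2) t(2) by simp
          have "bij_betw ?h (V - L) (W - L')"
            using g by (subst bij_betw_cong[of _ _ g]) (auto simp: isoms_def)
          moreover have "bij_betw ?h L L'"
            using t(1) by (subst bij_betw_cong[of _ _ \<tau>]) auto
          ultimately have "bij_betw ?h ((V - L) \<union> L) ((W - L') \<union> L')"
            by (rule bij_betw_combine) auto
          moreover have "(V - L) \<union> L = V" "(W - L') \<union> L' = W" using L(3) L'(3) by auto
          ultimately have bij: "bij_betw ?h V W" by simp
          moreover have "?h (A v) = A' (?h v) \<and> ?h (B v) = B' (?h v)" if v: "v \<in> V" for v
          proof (cases "v \<in> L")
            case True
            then show ?thesis using AL[OF True] t(3)[OF True] by simp
          next
            case False
            then have "v \<in> V - L" "A v \<in> V - L" "B v \<in> V - L" using v V' by (auto simp: fixfree_def)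
            then show ?thesis using g by (simp add: isoms_def)
          qed
          moreover have "?h \<in> V \<rightarrow>\<^sub>E W"
            using bij L(3) by (auto simp: PiE_def extensional_def bij_betw_def)
          ultimately show "?h \<in> isoms V A B W A' B'" unfolding isoms_def by blast
        qed
      qed
      then show ?thesis using IH by (simp add: bij_betw_same_card)
    qed
    have fin: "finite (isoms V A B W A' B')"
      by (rule finite_subset[of _ "V \<rightarrow>\<^sub>E W"]) (auto simp: isoms_def intro!: finite_PiE V(1) W(1))
    have "card (isoms V A B W A' B') = (\<Sum>y\<in>Y. card {h \<in> isoms V A B W A' B'. h x = y})"
      by (subst part, rule card_UN_disjoint) (use fin W(1) in \<open>auto simp: Y_def\<close>)
    also have "\<dots> = card Y * zee_double N" using fib by simp
    also have "\<dots> = zee_double M" unfolding cardY M zee_double_add by simp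
    finally show ?thesis .
  qed
qed

section \<open>Sums over fillings\<close>

definition conj_by :: "('a \<Rightarrow> 'a) \<Rightarrow> ('a \<Rightarrow> 'a) \<Rightarrow> 'a \<Rightarrow> 'a" where
  "conj_by h S = h \<circ> S \<circ> inv_into UNIV h"

lemma conj_by_apply: "h permutes V \<Longrightarrow> conj_by h S (h x) = h (S x)"
  by (simp add: conj_by_def permutes_inverses)

lemma conj_by_matchings:
  assumes "h permutes V" "S \<in> matchings V"
  shows "conj_by h S \<in> matchings V"
proof -
  have "conj_by h S x \<in> V \<and> conj_by h S x \<noteq> x \<and> conj_by h S (conj_by h S x) = x" if x: "x \<in> V" for x
  proof -
    obtain y where y: "x = h y" "y \<in> V" using x permutes_image[OF assms(1)] by auto
    have "S y \<in> V" "S y \<noteq> y" "S (S y) = y" using fpfD[OF matchings_fixfree[OF assms(2)] y(2)] by auto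
    then show ?thesis
      unfolding y(1) conj_by_apply[OF assms(1)]
      using permutes_in_image[OF assms(1)] injD[OF permutes_inj[OF assms(1)]] by auto
  qed
  moreover have "conj_by h S x = x" if "x \<notin> V" for x
    using that assms(1) matchings_outside[OF assms(2), of x] permutes_not_in[OF permutes_inv[OF assms(1)] that]
    by (simp add: conj_by_def permutes_not_in)
  ultimately show ?thesis by (simp add: matchings_def fixfree_def)
qed

lemma conj_by_inv:
  assumes "h permutes V"
  shows "conj_by (inv_into UNIV h) (conj_by h S) = S" "conj_by h (conj_by (inv_into UNIV h) S) = S"
  using assms by (auto simp: conj_by_def fun_eq_iff permutes_inverses permutes_inv_inv)

lemma conj_by_eq_iff:
  assumes h: "h permutes V" and S: "S \<in> matchings V" and T: "T \<in> matchings V"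
  shows "conj_by h S = T \<longleftrightarrow> (\<forall>x\<in>V. h (S x) = T (h x))"
proof
  assume "conj_by h S = T"
  then show "\<forall>x\<in>V. h (S x) = T (h x)" using conj_by_apply[OF h] by auto
next
  assume *: "\<forall>x\<in>V. h (S x) = T (h x)"
  show "conj_by h S = T"
  proof
    fix y
    show "conj_by h S y = T y"
    proof (cases "y \<in> V")
      case True
      then obtain x where "y = h x" "x \<in> V" using permutes_image[OF h] by auto
      then show ?thesis using * conj_by_apply[OF h] by auto
    next
      case False
      then show ?thesis using matchings_outside[OF conj_by_matchings[OF h S]] matchings_outside[OF T] by auto
    qed
  qed
qed

lemma num_loops_conj_by:
  assumes h: "h permutes V" and A: "A \<in> matchings V" and B: "B \<in> matchings V"
  shows "num_loops V (conj_by h A) (conj_by h B) = num_loops V A B"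
    "loop_mset V (conj_by h A) (conj_by h B) = loop_mset V A B"
  using num_loops_iso[OF matchings_fixfree[OF A] matchings_fixfree[OF B] matchings_fixfree[OF conj_by_matchings[OF h A]] matchings_fixfree[OF conj_by_matchings[OF h B]]
      permutes_imp_bij[OF h]] conj_by_apply[OF h] by auto

lemma conj_by_matchings_of:
  assumes h: "h permutes V" and S: "S \<in> matchings_of V (f \<circ> h)"
  shows "conj_by h S \<in> matchings_of V f"
proof -
  have "f (conj_by h S x) = f x" if x: "x \<in> V" for x
  proof -
    obtain y where y: "x = h y" "y \<in> V" using x permutes_image[OF h] by auto
    show ?thesis using S y(2) unfolding y(1) conj_by_apply[OF h] by (auto simp: matchings_of_def)
  qed
  then show ?thesis using conj_by_matchings[OF h matchings_of_matchings[OF S]] by (simp add: matchings_of_def)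
qed

lemma card_perm_isoms:
  assumes A: "A \<in> matchings V" and B: "B \<in> matchings V" and A': "A' \<in> matchings V" and B': "B' \<in> matchings V"
  shows "card {h. h permutes V \<and> conj_by h A = A' \<and> conj_by h B = B'} = card (isoms V A B V A' B')"
proof (rule bij_betw_same_card)
  show "bij_betw (\<lambda>h. restrict h V) {h. h permutes V \<and> conj_by h A = A' \<and> conj_by h B = B'}
     (isoms V A B V A' B')"
  proof (rule bij_betw_byWitness[where f' = "\<lambda>g x. if x \<in> V then g x else x"])
    show "\<forall>h\<in>{h. h permutes V \<and> conj_by h A = A' \<and> conj_by h B = B'}.
        (\<lambda>x. if x \<in> V then restrict h V x else x) = h"
      by (auto simp: fun_eq_iff permutes_not_in)
    show "\<forall>g\<in>isoms V A B V A' B'. restrict (\<lambda>x. if x \<in> V then g x else x) V = g"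
      by (auto simp: fun_eq_iff isoms_def PiE_def extensional_def)
    show "(\<lambda>h. restrict h V) ` {h. h permutes V \<and> conj_by h A = A' \<and> conj_by h B = B'} \<subseteq> isoms V A B V A' B'"
    proof safe
      fix h assume h: "h permutes V" "A' = conj_by h A" "B' = conj_by h B"
      have "\<forall>x\<in>V. h (A x) = conj_by h A (h x) \<and> h (B x) = conj_by h B (h x)"
        using conj_by_apply[OF h(1)] by auto
      moreover have "bij_betw (restrict h V) V V"
        using permutes_imp_bij[OF h(1)] by (simp add: bij_betw_def inj_on_def)
      ultimately show "restrict h V \<in> isoms V A B V (conj_by h A) (conj_by h B)"
        using matchings_fixfree[OF A] matchings_fixfree[OF B] permutes_in_image[OF h(1)] by (auto simp: isoms_def fixfree_def)
    qed
    show "(\<lambda>g x. if x \<in> V then g x else x) ` isoms V A B V A' B' \<subseteq>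
        {h. h permutes V \<and> conj_by h A = A' \<and> conj_by h B = B'}"
    proof safe
      fix g assume g: "g \<in> isoms V A B V A' B'"
      let ?h = "\<lambda>x. if x \<in> V then g x else x"
      have "bij_betw ?h V V" using g by (subst bij_betw_cong[of _ _ g]) (auto simp: isoms_def)
      then show h: "?h permutes V" by (rule bij_imp_permutes) auto
      show "conj_by ?h A = A'" "conj_by ?h B = B'"
        using g matchings_fixfree[OF A] matchings_fixfree[OF B]
        unfolding conj_by_eq_iff[OF h A A'] conj_by_eq_iff[OF h B B'] by (auto simp: isoms_def fixfree_def)
    qed
  qed
qed

lemma loop_mset_pos: 
  assumes "finite V" "fixfree V A" "fixfree V B"
  shows "0 \<notin># loop_mset V A B"
proof
  assume "0 \<in># loop_mset V A B"
  then obtain x where x: "x \<in> V" "card (orb V A B x) div 2 = 0"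
    using assms(1) by (auto simp: loop_mset_def orbs_def)
  have "A x \<in> orb V A B x" "A x \<noteq> x" using orb_step[of x V A B x] x assms by (auto simp: fixfree_def)
  then have "card {x, A x} \<le> card (orb V A B x)"
    by (intro card_mono finite_subset[OF orb_subset[OF assms(2,3) x(1)] assms(1)]) auto
  then show False using x \<open>A x \<noteq> x\<close> by auto
qed

lemma sum_loop_mset:
  fixes V :: "nat set"
  assumes "finite V" "fixfree V A" "fixfree V B"
  shows "2 * sum_mset (loop_mset V A B) = card V"
proof -
  have "\<Union>(orbs V A B) = V" using orb_subset[OF assms(2,3)] by (auto simp: orbs_def intro: orb_self)
  moreover have "card (\<Union>(orbs V A B)) = sum card (orbs V A B)"
    by (rule card_Union_disjoint)
      (use orbs_disjoint[OF assms(2,3)] finite_subset[OF orbs_subset[OF assms(2,3)] assms(1)]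
       in \<open>auto simp: pairwise_def disjnt_def\<close>)
  moreover have "sum card (orbs V A B) = (\<Sum>L\<in>orbs V A B. 2 * (card L div 2))"
    by (rule sum.cong) (use orb_jseq(1)[OF assms] in \<open>auto simp: orbs_def\<close>)
  ultimately show ?thesis by (simp add: loop_mset_def sum_unfold_sum_mset sum_mset_distrib_left multiset.map_comp comp_def)
qed

text \<open>Orbit and stabiliser: every permutation carries the pair of \<open>S\<close> and
  \<open>T\<close> to a pair of the same type, and the permutations that reach a given pair are the
  isomorphisms to it, \<open>zee_double\<close> many.\<close>

lemma card_same_loop_mset:
  fixes V :: "nat set"
  assumes V: "finite V" and S: "S \<in> matchings V" and T: "T \<in> matchings V"
  shows "card {(A, B). A \<in> matchings V \<and> B \<in> matchings V \<and> loop_mset V A B = loop_mset V S T} * zee_double (loop_mset V S T) = fact (card V)"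
proof -
  let ?P = "{(A, B). A \<in> matchings V \<and> B \<in> matchings V \<and> loop_mset V A B = loop_mset V S T}"
  let ?F = "\<lambda>p. {h. h permutes V \<and> conj_by h S = fst p \<and> conj_by h T = snd p}"
  have fin: "finite ?P" by (rule finite_subset[of _ "matchings V \<times> matchings V"]) (use V in auto)
  have "fact (card V) = card {h. h permutes V}" using V by (simp add: card_permutations)
  also have "{h. h permutes V} = (\<Union>p\<in>?P. ?F p)"
    using conj_by_matchings[OF _ S] conj_by_matchings[OF _ T] num_loops_conj_by(2)[OF _ S T] by auto
  also have "card \<dots> = (\<Sum>p\<in>?P. card (?F p))"
    by (rule card_UN_disjoint) (use V fin in \<open>auto intro: finite_subset[OF _ finite_permutations[OF V]]\<close>)
  also have "\<dots> = (\<Sum>p\<in>?P. zee_double (loop_mset V S T))"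
  proof (rule sum.cong[OF refl])
    fix p assume p: "p \<in> ?P"
    then show "card (?F p) = zee_double (loop_mset V S T)"
      using card_perm_isoms[OF S T, of "fst p" "snd p"]
        card_isoms[OF V matchings_fixfree[OF S] matchings_fixfree[OF T] V matchings_fixfree matchings_fixfree refl, of "fst p" "snd p"] by auto
  qed
  finally show ?thesis by simp
qed

text \<open>The number of isomorphisms depends only on the common type and is positive, so one
  exists.\<close>

lemma same_loop_mset_conj:
  fixes V :: "nat set"
  assumes V: "finite V" and S: "S \<in> matchings V" "T \<in> matchings V" and A: "A \<in> matchings V" "B \<in> matchings V"
    and eq: "loop_mset V A B = loop_mset V S T"
  obtains h where "h permutes V" "conj_by h S = A" "conj_by h T = B"
proof -
  have "card {h. h permutes V \<and> conj_by h S = A \<and> conj_by h T = B} = zee_double (loop_mset V S T)"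
    using card_perm_isoms[OF S A] card_isoms[OF V matchings_fixfree[OF S(1)] matchings_fixfree[OF S(2)] V matchings_fixfree[OF A(1)] matchings_fixfree[OF A(2)] refl eq]
    by simp
  also have "\<dots> > 0" by (rule zee_double_pos[OF loop_mset_pos[OF V matchings_fixfree[OF S(1)] matchings_fixfree[OF S(2)]]])
  finally have "{h. h permutes V \<and> conj_by h S = A \<and> conj_by h T = B} \<noteq> {}"
    by (rule contrapos_pn) (simp only: card.empty less_irrefl not_False_eq_True)
  then show ?thesis using that by auto
qed

section \<open>Fillings of a diagram\<close>

lemma boxes_Sigma: "boxes la = Sigma {..<length la} (\<lambda>i. {..<la ! i})"
  by (auto simp: boxes_def)

lemma finite_boxes [simp]: "finite (boxes la)"
  by (simp add: boxes_Sigma)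

lemma card_boxes: "card (boxes la) = sum_list la"
  by (simp add: boxes_Sigma sum_list_sum_nth atLeast0LessThan)

definition fillings :: "nat set \<Rightarrow> (nat \<Rightarrow> nat) \<Rightarrow> (nat \<Rightarrow> nat) \<Rightarrow> nat list \<Rightarrow> (nat \<Rightarrow> nat \<times> nat) set" where
  "fillings V S T la = {f \<in> V \<rightarrow>\<^sub>E boxes la. S \<in> matchings_of V (snd \<circ> f) \<and> T \<in> matchings_of V (fst \<circ> f)}"

definition weight :: "nat set \<Rightarrow> (nat \<Rightarrow> nat) \<Rightarrow> (nat \<Rightarrow> nat) \<Rightarrow> real" where
  "weight V A B = (-2) ^ num_loops V A B"

text \<open>The quantity X of the overview with the sums exchanged; \<open>A\<close> plays the part
  of \<open>S0\<close>. With the filling fixed, the sum over \<open>A\<close> is the one to which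
  the cancellation at -2 applies.\<close>

definition filling_sum :: "nat set \<Rightarrow> (nat \<Rightarrow> nat) \<Rightarrow> (nat \<Rightarrow> nat) \<Rightarrow> nat list \<Rightarrow> real" where
  "filling_sum V S T la = (\<Sum>f\<in>fillings V S T la. \<Sum>A\<in>matchings_of V f. weight V A S)"

lemma finite_fillings [simp]: "finite V \<Longrightarrow> finite (fillings V S T la)"
  by (rule finite_subset[of _ "V \<rightarrow>\<^sub>E boxes la"]) (auto simp: fillings_def intro: finite_PiE)

lemma fillings_conj:
  assumes h: "h permutes V" and f: "f \<in> fillings V S T la" and S: "S \<in> matchings V" and T: "T \<in> matchings V"
  shows "f \<circ> inv_into UNIV h \<in> fillings V (conj_by h S) (conj_by h T) la"
proof -
  have "S \<in> matchings_of V ((snd \<circ> (f \<circ> inv_into UNIV h)) \<circ> h)" "T \<in> matchings_of V ((fst \<circ> (f \<circ> inv_into UNIV h)) \<circ> h)"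
    using f h by (auto simp: fillings_def comp_def permutes_inverses)
  moreover have "f \<circ> inv_into UNIV h \<in> V \<rightarrow>\<^sub>E boxes la"
    using f permutes_in_image[OF permutes_inv[OF h]] permutes_not_in[OF permutes_inv[OF h]]
    by (auto simp: fillings_def PiE_def extensional_def)
  ultimately show ?thesis using conj_by_matchings_of[OF h] by (auto simp: fillings_def)
qed

lemma filling_sum_conj:
  assumes h: "h permutes V" and S: "S \<in> matchings V" and T: "T \<in> matchings V"
  shows "filling_sum V (conj_by h S) (conj_by h T) la = filling_sum V S T la"
proof -
  note h' = permutes_inv[OF h]
  show ?thesis unfolding filling_sum_def
  proof (rule sum.reindex_bij_witness[where i = "\<lambda>f. f \<circ> inv_into UNIV h" and j = "\<lambda>f. f \<circ> h"])
    fix f assume f: "f \<in> fillings V (conj_by h S) (conj_by h T) la"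
    show "(f \<circ> h) \<circ> inv_into UNIV h = f" using h by (auto simp: fun_eq_iff permutes_inverses)
    show "f \<circ> h \<in> fillings V S T la"
      using fillings_conj[OF h' f conj_by_matchings[OF h S] conj_by_matchings[OF h T]] h
      by (simp add: conj_by_inv[OF h] permutes_inv_inv)
    show "(\<Sum>A\<in>matchings_of V (f \<circ> h). weight V A S) = (\<Sum>A\<in>matchings_of V f. weight V A (conj_by h S))"
    proof (rule sum.reindex_bij_witness[where i = "conj_by (inv_into UNIV h)" and j = "conj_by h"])
      fix A assume A: "A \<in> matchings_of V (f \<circ> h)"
      show "conj_by (inv_into UNIV h) (conj_by h A) = A" by (rule conj_by_inv[OF h])
      show "conj_by h A \<in> matchings_of V f" by (rule conj_by_matchings_of[OF h A])
      show "weight V (conj_by h A) (conj_by h S) = weight V A S"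
        by (simp add: weight_def num_loops_conj_by(1)[OF h matchings_of_matchings[OF A] S])
    next
      fix A assume A: "A \<in> matchings_of V f"
      show "conj_by h (conj_by (inv_into UNIV h) A) = A" by (rule conj_by_inv[OF h])
      have "A \<in> matchings_of V ((f \<circ> h) \<circ> inv_into UNIV h)" using A h by (simp add: comp_def permutes_inverses)
      then show "conj_by (inv_into UNIV h) A \<in> matchings_of V (f \<circ> h)" by (rule conj_by_matchings_of[OF h'])
    qed
  next
    fix f assume f: "f \<in> fillings V S T la"
    show "(f \<circ> inv_into UNIV h) \<circ> h = f" using h by (auto simp: fun_eq_iff permutes_inverses)
    show "f \<circ> inv_into UNIV h \<in> fillings V (conj_by h S) (conj_by h T) la" by (rule fillings_conj[OF h f S T])
  qed
qed

text \<open>Relabelling does not change the sum, and pairs of equal type differ by a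
  relabelling.\<close>

lemma filling_sum_loop_mset:
  assumes "finite V" "S \<in> matchings V" "T \<in> matchings V" "A \<in> matchings V" "B \<in> matchings V" "loop_mset V A B = loop_mset V S T"
  shows "filling_sum V A B la = filling_sum V S T la"
  using same_loop_mset_conj[OF assms] filling_sum_conj assms(2,3) by metis

definition standard :: "nat set \<Rightarrow> nat list \<Rightarrow> (nat \<Rightarrow> nat \<times> nat) set" where
  "standard V la = {f \<in> V \<rightarrow>\<^sub>E boxes la. \<forall>y\<in>boxes la. card {v\<in>V. f v = y} = 2}"

lemma finite_standard [simp]: "finite V \<Longrightarrow> finite (standard V la)"
  by (rule finite_subset[of _ "V \<rightarrow>\<^sub>E boxes la"]) (auto simp: standard_def intro: finite_PiE)

text \<open>A nonzero contribution excludes boxes with more than two labels. With twice as many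
  labels as boxes the average is two, so every box holds exactly two.\<close>

lemma standardI:
  assumes V: "finite V" "card V = 2 * sum_list la" and B: "fixfree V B"
    and f: "f \<in> V \<rightarrow>\<^sub>E boxes la" and ne: "(\<Sum>A\<in>matchings_of V f. weight V A B) \<noteq> 0"
  shows "f \<in> standard V la"
proof -
  have le: "card {v\<in>V. f v = y} \<le> 2" for y
    using sum_matchings_of_neg2_power_eq_0[OF V(1) B, of f y, where 'c = real] ne
    unfolding weight_def by force
  have "V = (\<Union>y\<in>boxes la. {v\<in>V. f v = y})" using f by auto
  then have "card V = (\<Sum>y\<in>boxes la. card {v\<in>V. f v = y})"
    using V(1) by (subst card_UN_disjoint[symmetric]) auto
  also have "(\<Sum>y\<in>boxes la. 2) = card V" using V(2) by (simp add: card_boxes)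
  ultimately have "(\<Sum>y\<in>boxes la. card {v\<in>V. f v = y}) = (\<Sum>y\<in>boxes la. 2)" by simp
  then have "\<forall>y\<in>boxes la. card {v\<in>V. f v = y} = 2"
    using sum_mono_inv[of "\<lambda>y. card {v\<in>V. f v = y}" "boxes la" "\<lambda>_. 2"] le by auto
  then show ?thesis using f by (simp add: standard_def)
qed

text \<open>A real indicator, so that the conditions on \<open>S\<close> and on \<open>T\<close>
  appear as factors and double sums can be separated.\<close>

definition fixed :: "nat set \<Rightarrow> (nat \<Rightarrow> 'a) \<Rightarrow> (nat \<Rightarrow> nat) \<Rightarrow> real" where
  "fixed V c S = (if S \<in> matchings_of V c then 1 else 0)"

text \<open>The matching is determined by a standard filling, since each box holds two labels;
  carrying it along turns two nested sums into one.\<close>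

definition tableaux :: "nat set \<Rightarrow> nat list \<Rightarrow> ((nat \<Rightarrow> nat \<times> nat) \<times> (nat \<Rightarrow> nat)) set" where
  "tableaux V la = Sigma (standard V la) (matchings_of V)"

lemma finite_tableaux [simp]: "finite V \<Longrightarrow> finite (tableaux V la)"
  by (simp add: tableaux_def)

text \<open>The summand splits into a factor in \<open>S\<close> alone, from the columns, and a
  factor in \<open>T\<close> alone, from the rows. Orthogonality and triangularity both rest on this
  separation.\<close>

lemma filling_sum_standard:
  assumes V: "finite V" "card V = 2 * sum_list la" and S: "S \<in> matchings V" and T: "T \<in> matchings V"
  shows "filling_sum V S T la = (\<Sum>(f, A)\<in>tableaux V la. (weight V A S * fixed V (snd \<circ> f) S) * fixed V (fst \<circ> f) T)"
proof -
  have "filling_sum V S T la = (\<Sum>f\<in>V \<rightarrow>\<^sub>E boxes la. \<Sum>A\<in>matchings_of V f. (weight V A S * fixed V (snd \<circ> f) S) * fixed V (fst \<circ> f) T)"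
    unfolding filling_sum_def fixed_def
    by (rule sum.mono_neutral_cong_left) (use V in \<open>auto simp: fillings_def intro: finite_PiE\<close>)
  also have "\<dots> = (\<Sum>f\<in>standard V la. \<Sum>A\<in>matchings_of V f. (weight V A S * fixed V (snd \<circ> f) S) * fixed V (fst \<circ> f) T)"
  proof (rule sum.mono_neutral_right)
    show "finite (V \<rightarrow>\<^sub>E boxes la)" using V by (auto intro: finite_PiE)
    show "\<forall>f\<in>(V \<rightarrow>\<^sub>E boxes la) - standard V la.
        (\<Sum>A\<in>matchings_of V f. (weight V A S * fixed V (snd \<circ> f) S) * fixed V (fst \<circ> f) T) = 0"
      using standardI[OF V matchings_fixfree[OF S]] by (force simp: sum_distrib_right[symmetric])
  qed (auto simp: standard_def)
  also have "\<dots> = (\<Sum>(f, A)\<in>tableaux V la. (weight V A S * fixed V (snd \<circ> f) S) * fixed V (fst \<circ> f) T)"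
    unfolding tableaux_def by (rule sum.Sigma) (use V in auto)
  finally show ?thesis .
qed

section \<open>Orthogonality\<close>

definition labels :: "nat \<Rightarrow> nat set" where
  "labels n = {1..2 * n}"

lemma finite_labels [simp]: "finite (labels n)"
  by (simp add: labels_def)

lemma card_labels [simp]: "card (labels n) = 2 * n"
  by (simp add: labels_def)

definition part_of :: "nat multiset \<Rightarrow> nat list" where
  "part_of M = rev (sorted_list_of_multiset M)"

section \<open>Partitions as types of pairs of matchings\<close>

lemma partitionsD:
  assumes "\<rho> \<in> partitions n"
  shows "sorted_wrt (\<ge>) \<rho>" "0 \<notin> set \<rho>" "sum_list \<rho> = n"
  using assms by (auto simp: partitions_def)

lemma mset_part_of [simp]: "mset (part_of M) = M"
  by (simp add: part_of_def)

lemma part_of_partitions: "0 \<notin># M \<Longrightarrow> sum_mset M = n \<Longrightarrow> part_of M \<in> partitions n"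
  by (simp add: partitions_def part_of_def sum_mset_sum_list[symmetric] sorted_wrt_rev)

lemma part_of_mset: "\<rho> \<in> partitions n \<Longrightarrow> part_of (mset \<rho>) = \<rho>"
proof -
  assume "\<rho> \<in> partitions n"
  then have "sorted (rev \<rho>)" by (simp add: partitions_def sorted_wrt_rev)
  then have "sort \<rho> = rev \<rho>" by (metis properties_for_sort mset_rev)
  then show ?thesis by (simp add: part_of_def)
qed

lemma finite_partitions [simp]: "finite (partitions n)"
proof (rule finite_subset)
  show "partitions n \<subseteq> {xs. set xs \<subseteq> {..n} \<and> length xs \<le> n}"
  proof
    fix \<rho> assume "\<rho> \<in> partitions n"
    then have 0: "0 \<notin> set \<rho>" and s: "sum_list \<rho> = n" by (auto dest: partitionsD)
    have "length \<rho> \<le> sum_list \<rho>" using 0 by (induction \<rho>) auto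
    moreover have "x \<le> sum_list \<rho>" if "x \<in> set \<rho>" for x using member_le_sum_list[OF that] by simp
    ultimately show "\<rho> \<in> {xs. set xs \<subseteq> {..n} \<and> length xs \<le> n}" using s by auto
  qed
  show "finite {xs. set xs \<subseteq> {..n} \<and> length xs \<le> n}" by (rule finite_lists_length_le) simp
qed

lemma part_of_loop_mset:
  assumes "S \<in> matchings (labels n)" "T \<in> matchings (labels n)"
  shows "part_of (loop_mset (labels n) S T) \<in> partitions n"
proof (rule part_of_partitions)
  show "0 \<notin># loop_mset (labels n) S T" by (rule loop_mset_pos) (use assms matchings_fixfree in auto)
  show "sum_mset (loop_mset (labels n) S T) = n"
  proof -
    have "2 * sum_mset (loop_mset (labels n) S T) = card (labels n)"
      by (rule sum_loop_mset) (use assms matchings_fixfree in auto)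
    then show ?thesis by (simp only: card_labels)
  qed
qed

text \<open>Each pair of matchings has exactly one partition as its type, so a sum over partitions
  becomes a double sum in which \<open>S\<close> and \<open>T\<close> vary independently.\<close>

lemma sum_over_types:
  fixes g :: "nat list \<Rightarrow> (nat \<Rightarrow> nat) \<Rightarrow> (nat \<Rightarrow> nat) \<Rightarrow> real"
  shows "(\<Sum>\<rho>\<in>partitions n. \<Sum>(S, T)\<in>{(S, T). S \<in> matchings (labels n) \<and> T \<in> matchings (labels n) \<and> loop_mset (labels n) S T = mset \<rho>}.
      g \<rho> S T) =
    (\<Sum>S\<in>matchings (labels n). \<Sum>T\<in>matchings (labels n). g (part_of (loop_mset (labels n) S T)) S T)"
proof -
  let ?N = "labels n"
  let ?P = "matchings ?N \<times> matchings ?N" and ?r = "\<lambda>(S, T). part_of (loop_mset ?N S T)"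
  have "(\<Sum>S\<in>matchings ?N. \<Sum>T\<in>matchings ?N. g (part_of (loop_mset ?N S T)) S T) =
      (\<Sum>p\<in>?P. g (?r p) (fst p) (snd p))"
    by (subst sum.cartesian_product) (auto intro!: sum.cong)
  also have "\<dots> = (\<Sum>\<rho>\<in>partitions n. \<Sum>p\<in>{p\<in>?P. ?r p = \<rho>}. g (?r p) (fst p) (snd p))"
    by (rule sum.group[symmetric]) (use part_of_loop_mset in auto)
  also have "\<dots> = (\<Sum>\<rho>\<in>partitions n. \<Sum>(S, T)\<in>{(S, T). S \<in> matchings ?N \<and> T \<in> matchings ?N \<and> loop_mset ?N S T = mset \<rho>}. g \<rho> S T)"
  proof (rule sum.cong[OF refl])
    fix \<rho> assume "\<rho> \<in> partitions n"
    then have "{p\<in>?P. ?r p = \<rho>} = {(S, T). S \<in> matchings ?N \<and> T \<in> matchings ?N \<and> loop_mset ?N S T = mset \<rho>}"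
      using part_of_mset by (auto simp: split_beta)
    then show "(\<Sum>p\<in>{p\<in>?P. ?r p = \<rho>}. g (?r p) (fst p) (snd p)) =
        (\<Sum>(S, T)\<in>{(S, T). S \<in> matchings ?N \<and> T \<in> matchings ?N \<and> loop_mset ?N S T = mset \<rho>}. g \<rho> S T)"
      using \<open>\<rho> \<in> partitions n\<close> by (auto intro!: sum.cong simp: split_beta part_of_mset)
  qed
  finally show ?thesis ..
qed

text \<open>The number of pairs of type \<rho> is (2n)! divided by z_rho 2^length(rho), so this is
  (-1)^n times the common filling sum divided by that weight. As a sum over pairs it can be added up
  over all types at once.\<close>

definition zonal :: "nat \<Rightarrow> nat list \<Rightarrow> nat list \<Rightarrow> real" where
  "zonal n \<rho> la = (if \<rho> \<in> partitions n \<and> la \<in> partitions n then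
     (-1) ^ n / fact (2 * n) *
     (\<Sum>(S, T)\<in>{(S, T). S \<in> matchings (labels n) \<and> T \<in> matchings (labels n) \<and> loop_mset (labels n) S T = mset \<rho>}.
        filling_sum (labels n) S T la) else 0)"

text \<open>Identifies the number of automorphisms with the weight of the scalar product at \<alpha>
  = 2.\<close>

lemma zee_double_zee: "zee_double (mset \<rho>) = zee \<rho> * 2 ^ length \<rho>"
proof -
  have "(\<Prod>i\<in>set \<rho>. (2::nat) ^ count (mset \<rho>) i) = 2 ^ length \<rho>"
    by (simp add: power_sum[symmetric] size_multiset_overloaded_eq[symmetric] flip: set_mset_mset)
  moreover have "zee_double (mset \<rho>) = (\<Prod>i\<in>set \<rho>. 2 ^ count (mset \<rho>) i * (i ^ count (mset \<rho>) i * fact (count (mset \<rho>) i)))"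
    unfolding zee_double_def by (simp add: power_mult_distrib mult_ac)
  ultimately show ?thesis unfolding prod.distrib zee_def mult_def by (simp add: mult_ac)
qed

lemma zonal_eq_filling_sum:
  assumes la: "la \<in> partitions n" and S: "S \<in> matchings (labels n)" "T \<in> matchings (labels n)"
    and \<rho>: "\<rho> \<in> partitions n" "loop_mset (labels n) S T = mset \<rho>"
  shows "zonal n \<rho> la * (real (zee \<rho>) * 2 ^ length \<rho>) = (-1) ^ n * filling_sum (labels n) S T la"
proof -
  let ?N = "labels n"
  let ?P = "{(A, B). A \<in> matchings ?N \<and> B \<in> matchings ?N \<and> loop_mset ?N A B = mset \<rho>}"
  have "(\<Sum>(A, B)\<in>?P. filling_sum ?N A B la) = (\<Sum>p\<in>?P. filling_sum ?N S T la)"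
  proof (rule sum.cong[OF refl], clarify)
    fix A B assume "A \<in> matchings ?N" "B \<in> matchings ?N" "loop_mset ?N A B = mset \<rho>"
    then show "filling_sum ?N A B la = filling_sum ?N S T la" by (intro filling_sum_loop_mset S) (simp_all add: \<rho>)
  qed
  then have z: "zonal n \<rho> la = (-1) ^ n / fact (2 * n) * (real (card ?P) * filling_sum ?N S T la)"
    using la \<rho> by (simp add: zonal_def)
  have w: "real (card ?P) * (real (zee \<rho>) * 2 ^ length \<rho>) = fact (2 * n)"
  proof -
    have "card ?P * zee_double (mset \<rho>) = fact (2 * n)" using card_same_loop_mset[of ?N S T] S \<rho> by simp
    then have "real (card ?P * zee_double (mset \<rho>)) = fact (2 * n)" by (simp only: of_nat_fact)
    then show ?thesis by (simp add: zee_double_zee)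
  qed
  have "zonal n \<rho> la * (real (zee \<rho>) * 2 ^ length \<rho>) =
      (-1) ^ n / fact (2 * n) * filling_sum ?N S T la * (real (card ?P) * (real (zee \<rho>) * 2 ^ length \<rho>))"
    unfolding z by (simp only: mult_ac)
  also have "\<dots> = (-1) ^ n * filling_sum ?N S T la" unfolding w by simp
  finally show ?thesis .
qed

lemma zee_pos: "\<rho> \<in> partitions n \<Longrightarrow> zee \<rho> > 0"
  unfolding zee_def by (rule prod_pos) (use partitionsD(2) in \<open>auto intro!: Nat.gr0I\<close>)

lemma sum_tableaux_swap:
  fixes a :: "'p \<Rightarrow> 's \<Rightarrow> real" and b :: "'p \<Rightarrow> 't \<Rightarrow> real"
  shows "(\<Sum>S\<in>X. \<Sum>T\<in>Y. (\<Sum>p\<in>P. a p S * b p T) * (\<Sum>q\<in>Q. c q T * d q S)) =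
    (\<Sum>p\<in>P. \<Sum>q\<in>Q. (\<Sum>S\<in>X. a p S * d q S) * (\<Sum>T\<in>Y. b p T * c q T))"
proof -
  have "(\<Sum>S\<in>X. \<Sum>T\<in>Y. (\<Sum>p\<in>P. a p S * b p T) * (\<Sum>q\<in>Q. c q T * d q S)) =
     (\<Sum>S\<in>X. \<Sum>T\<in>Y. \<Sum>p\<in>P. \<Sum>q\<in>Q. (a p S * d q S) * (b p T * c q T))"
    unfolding sum_product by (intro sum.cong refl) (simp only: mult_ac)
  also have "\<dots> = (\<Sum>S\<in>X. \<Sum>p\<in>P. \<Sum>T\<in>Y. \<Sum>q\<in>Q. (a p S * d q S) * (b p T * c q T))"
    by (rule sum.cong[OF refl], rule sum.swap)
  also have "\<dots> = (\<Sum>p\<in>P. \<Sum>S\<in>X. \<Sum>T\<in>Y. \<Sum>q\<in>Q. (a p S * d q S) * (b p T * c q T))"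
    by (rule sum.swap)
  also have "\<dots> = (\<Sum>p\<in>P. \<Sum>S\<in>X. \<Sum>q\<in>Q. \<Sum>T\<in>Y. (a p S * d q S) * (b p T * c q T))"
    by (intro sum.cong[OF refl] sum.swap)
  also have "\<dots> = (\<Sum>p\<in>P. \<Sum>q\<in>Q. \<Sum>S\<in>X. \<Sum>T\<in>Y. (a p S * d q S) * (b p T * c q T))"
    by (intro sum.cong[OF refl] sum.swap)
  also have "\<dots> = (\<Sum>p\<in>P. \<Sum>q\<in>Q. (\<Sum>S\<in>X. a p S * d q S) * (\<Sum>T\<in>Y. b p T * c q T))"
    by (simp add: sum_product)
  finally show ?thesis .
qed

text \<open>Compares the columns of a tableau with a colouring \<open>c\<close>: the rows of another
  tableau for orthogonality, or an assignment of the labels to the variables of a monomial for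
  triangularity.\<close>

definition col_sum :: "nat set \<Rightarrow> (nat \<Rightarrow> nat \<times> nat) \<times> (nat \<Rightarrow> nat) \<Rightarrow> (nat \<Rightarrow> nat) \<Rightarrow> real" where
  "col_sum V p c = (\<Sum>S\<in>matchings V. (weight V (snd p) S * fixed V (snd \<circ> fst p) S) * fixed V c S)"

definition row_sum :: "nat set \<Rightarrow> (nat \<Rightarrow> nat \<times> nat) \<times> (nat \<Rightarrow> nat) \<Rightarrow> (nat \<Rightarrow> nat) \<Rightarrow> real" where
  "row_sum V p c = (\<Sum>S\<in>matchings V. fixed V (fst \<circ> fst p) S * fixed V c S)"

text \<open>One coefficient absorbs the weight and becomes a filling sum, the other stays a sum over
  pairs. The first is evaluated with \<open>S\<close> and \<open>T\<close> exchanged, which has the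
  same type. Then \<open>S\<close> meets the columns of \<open>la\<close> and the rows of
  \<open>mu\<close>, while \<open>T\<close> meets the rows of \<open>la\<close> and the columns of
  \<open>mu\<close>.\<close>

lemma zonal_scalar_product:
  assumes la: "la \<in> partitions n" and mu: "mu \<in> partitions n"
  shows "(\<Sum>\<rho>\<in>partitions n. zonal n \<rho> la * zonal n \<rho> mu * real (zee \<rho>) * 2 ^ length \<rho>) =
    1 / fact (2 * n) * (\<Sum>p\<in>tableaux (labels n) la. \<Sum>q\<in>tableaux (labels n) mu.
       col_sum (labels n) p (fst \<circ> fst q) * col_sum (labels n) q (fst \<circ> fst p))"
proof -
  let ?N = "labels n"
  let ?P = "\<lambda>\<rho>. {(S, T). S \<in> matchings ?N \<and> T \<in> matchings ?N \<and> loop_mset ?N S T = mset \<rho>}"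
  have card: "card ?N = 2 * sum_list la" "card ?N = 2 * sum_list mu"
    using partitionsD(3)[OF la] partitionsD(3)[OF mu] by auto
  have "(\<Sum>\<rho>\<in>partitions n. zonal n \<rho> la * zonal n \<rho> mu * real (zee \<rho>) * 2 ^ length \<rho>) =
      (\<Sum>\<rho>\<in>partitions n. \<Sum>(S, T)\<in>?P \<rho>. 1 / fact (2 * n) * (filling_sum ?N S T la * filling_sum ?N T S mu))"
  proof (rule sum.cong[OF refl])
    fix \<rho> assume \<rho>: "\<rho> \<in> partitions n"
    have "zonal n \<rho> la * zonal n \<rho> mu * real (zee \<rho>) * 2 ^ length \<rho> =
       (\<Sum>(S, T)\<in>?P \<rho>. (-1) ^ n / fact (2 * n) * (filling_sum ?N S T la * (zonal n \<rho> mu * (real (zee \<rho>) * 2 ^ length \<rho>))))"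
      using la \<rho> by (simp add: zonal_def sum_distrib_right sum_distrib_left split_beta mult_ac)
    also have "\<dots> = (\<Sum>(S, T)\<in>?P \<rho>. 1 / fact (2 * n) * (filling_sum ?N S T la * filling_sum ?N T S mu))"
    proof (rule sum.cong[OF refl], clarify)
      fix S T assume ST: "S \<in> matchings ?N" "T \<in> matchings ?N" "loop_mset ?N S T = mset \<rho>"
      have "zonal n \<rho> mu * (real (zee \<rho>) * 2 ^ length \<rho>) = (-1) ^ n * filling_sum ?N T S mu"
        using zonal_eq_filling_sum[OF mu ST(2,1) \<rho>] ST(3) by (simp add: loop_mset_commute)
      then show "(-1) ^ n / fact (2 * n) * (filling_sum ?N S T la * (zonal n \<rho> mu * (real (zee \<rho>) * 2 ^ length \<rho>))) =
          1 / fact (2 * n) * (filling_sum ?N S T la * filling_sum ?N T S mu)"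
        by (simp add: power_mult_distrib[symmetric] flip: mult.assoc)
    qed
    finally show "zonal n \<rho> la * zonal n \<rho> mu * real (zee \<rho>) * 2 ^ length \<rho> = \<dots>" .
  qed
  also have "\<dots> = (\<Sum>S\<in>matchings ?N. \<Sum>T\<in>matchings ?N. 1 / fact (2 * n) * (filling_sum ?N S T la * filling_sum ?N T S mu))"
    by (rule sum_over_types)
  also have "\<dots> = 1 / fact (2 * n) * (\<Sum>S\<in>matchings ?N. \<Sum>T\<in>matchings ?N. filling_sum ?N S T la * filling_sum ?N T S mu)"
    by (simp add: sum_distrib_left)
  also have "(\<Sum>S\<in>matchings ?N. \<Sum>T\<in>matchings ?N. filling_sum ?N S T la * filling_sum ?N T S mu) =
    (\<Sum>S\<in>matchings ?N. \<Sum>T\<in>matchings ?N.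
      (\<Sum>p\<in>tableaux ?N la. (weight ?N (snd p) S * fixed ?N (snd \<circ> fst p) S) * fixed ?N (fst \<circ> fst p) T) *
      (\<Sum>q\<in>tableaux ?N mu. (weight ?N (snd q) T * fixed ?N (snd \<circ> fst q) T) * fixed ?N (fst \<circ> fst q) S))"
    using filling_sum_standard[of ?N la] filling_sum_standard[of ?N mu] card
    by (intro sum.cong refl arg_cong2[of _ _ _ _ "(*)"]) (auto simp: split_beta)
  also have "\<dots> = (\<Sum>p\<in>tableaux ?N la. \<Sum>q\<in>tableaux ?N mu.
       col_sum ?N p (fst \<circ> fst q) * col_sum ?N q (fst \<circ> fst p))"
    by (rule trans[OF sum_tableaux_swap]) (simp only: col_sum_def mult_ac)
  finally show ?thesis .
qed

section \<open>Nonvanishing column sums and dominance\<close>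

lemma col_sum_eq:
  assumes V: "finite V"
  shows "col_sum V (f, A) c = (\<Sum>S\<in>matchings_of V (\<lambda>v. (snd (f v), c v)). weight V A S)"
  unfolding col_sum_def fixed_def
  by (rule sum.mono_neutral_cong_right) (use V in \<open>auto simp: matchings_of_def\<close>)

lemma row_sum_eq:
  assumes V: "finite V"
  shows "row_sum V (f, A) c = card (matchings_of V (\<lambda>v. (fst (f v), c v)))"
proof -
  have "row_sum V (f, A) c = (\<Sum>S\<in>matchings_of V (\<lambda>v. (fst (f v), c v)). 1)"
    unfolding row_sum_def fixed_def
    by (rule sum.mono_neutral_cong_right) (use V in \<open>auto simp: matchings_of_def\<close>)
  then show ?thesis by simp
qed

text \<open>The matchings in the sum respect the pair (column, colour), so a class of three or more
  labels would make the sum vanish.\<close>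

lemma col_sum_fibre:
  assumes V: "finite V" and A: "A \<in> matchings V" and ne: "col_sum V (f, A) c \<noteq> 0"
  shows "card {v\<in>V. snd (f v) = j \<and> c v = y} \<le> 2"
proof (rule ccontr)
  assume "\<not> ?thesis"
  then have "2 < card {v\<in>V. (snd (f v), c v) = (j, y)}" by (simp add: prod_eq_iff)
  from sum_matchings_of_neg2_power_eq_0[OF V matchings_fixfree[OF A] this, where 'c = real]
  show False using ne unfolding col_sum_eq[OF V] weight_def by (simp add: orbs_commute)
qed

lemma boxes_down: "la \<in> partitions n \<Longrightarrow> (r, j) \<in> boxes la \<Longrightarrow> r' \<le> r \<Longrightarrow> (r', j) \<in> boxes la"
  using sorted_wrt_nth_less[of "(\<ge>)" la r' r] partitionsD(1)[of la n]
  unfolding boxes_def by (cases "r' = r") auto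

lemma card_less_fibres:
  assumes "finite V"
  shows "card {v\<in>V. P v \<and> c v < (i::nat)} = (\<Sum>y<i. card {v\<in>V. P v \<and> c v = y})"
proof -
  have "{v\<in>V. P v \<and> c v < i} = (\<Union>y<i. {v\<in>V. P v \<and> c v = y})" by auto
  then show ?thesis using assms by (simp only:) (subst card_UN_disjoint, auto)
qed

text \<open>In a column with at least i boxes the colours below i have at most two labels each, at
  most 2i in all, and 2i is what the first i rows hold. In a shorter column the first i rows contain
  every label.\<close>

lemma col_count_le:
  assumes la: "la \<in> partitions n" and V: "finite V" and f: "f \<in> standard V la" and A: "A \<in> matchings V"
    and ne: "col_sum V (f, A) c \<noteq> 0"
  shows "card {v\<in>V. snd (f v) = j \<and> c v < i} \<le> card {v\<in>V. snd (f v) = j \<and> fst (f v) < i}"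
proof (cases "\<forall>r<i. (r, j) \<in> boxes la")
  case True
  have "card {v\<in>V. snd (f v) = j \<and> fst (f v) = r} = 2" if "r < i" for r
  proof -
    have "{v\<in>V. snd (f v) = j \<and> fst (f v) = r} = {v\<in>V. f v = (r, j)}" by auto
    then show ?thesis using f True that by (auto simp: standard_def)
  qed
  then have "card {v\<in>V. snd (f v) = j \<and> fst (f v) < i} = 2 * i"
    unfolding card_less_fibres[OF V] by simp
  moreover have "card {v\<in>V. snd (f v) = j \<and> c v < i} \<le> (\<Sum>y<i. 2)"
    unfolding card_less_fibres[OF V] by (rule sum_mono) (rule col_sum_fibre[OF V A ne])
  ultimately show ?thesis by simp
next
  case False
  then obtain r where r: "r < i" "(r, j) \<notin> boxes la" by auto
  have "fst (f v) < i" if "v \<in> V" "snd (f v) = j" for v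
  proof (rule ccontr)
    assume *: "\<not> fst (f v) < i"
    have "(fst (f v), j) \<in> boxes la" using f that by (auto simp: standard_def)
    then show False using boxes_down[OF la, of "fst (f v)" j r] * r by auto
  qed
  then show ?thesis by (intro card_mono) (use V in auto)
qed

definition content :: "nat set \<Rightarrow> (nat \<Rightarrow> nat) \<Rightarrow> nat list \<Rightarrow> bool" where
  "content V c \<mu> \<longleftrightarrow> c ` V \<subseteq> {..<length \<mu>} \<and> (\<forall>j<length \<mu>. card {v\<in>V. c v = j} = 2 * \<mu> ! j)"

lemma content_less:
  assumes "finite V" "content V c \<mu>"
  shows "card {v\<in>V. c v < i} = 2 * sum_list (take i \<mu>)"
proof -
  have "card {v\<in>V. c v < i} = (\<Sum>y<i. card {v\<in>V. c v = y})"
    using card_less_fibres[OF assms(1), of "\<lambda>_. True" c i] by simp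
  also have "\<dots> = (\<Sum>y<min i (length \<mu>). card {v\<in>V. c v = y})"
  proof (rule sum.mono_neutral_right)
    have "card {v\<in>V. c v = y} = 0" if "y \<ge> length \<mu>" for y
    proof -
      have "{v\<in>V. c v = y} = {}" using assms(2) that by (auto simp: content_def)
      then show ?thesis by (simp only: card.empty)
    qed
    then show "\<forall>y\<in>{..<i} - {..<min i (length \<mu>)}. card {v\<in>V. c v = y} = 0"
      by (auto simp: min_def split: if_splits)
  qed auto
  also have "\<dots> = 2 * sum_list (take i \<mu>)"
    using assms(2) by (auto simp: content_def sum_list_sum_nth sum_distrib_left atLeast0LessThan min.commute intro!: sum.cong)
  finally show ?thesis .
qed

lemma standard_content:
  assumes V: "finite V" and f: "f \<in> standard V la"
  shows "content V (fst \<circ> f) la"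
proof -
  have "card {v\<in>V. fst (f v) = i} = 2 * la ! i" if i: "i < length la" for i
  proof -
    have eq: "{v\<in>V. fst (f v) = i} = (\<Union>j<la ! i. {v\<in>V. f v = (i, j)})"
      using f by (auto simp: standard_def boxes_def PiE_def Pi_def)
    have "card {v\<in>V. f v = (i, j)} = 2" if "j < la ! i" for j
      using f i that by (auto simp: standard_def boxes_def)
    then show ?thesis unfolding eq using V by (subst card_UN_disjoint) auto
  qed
  moreover have "(fst \<circ> f) ` V \<subseteq> {..<length la}"
    using f by (fastforce simp: standard_def boxes_def PiE_def Pi_def)
  ultimately show ?thesis by (simp add: content_def)
qed

lemma card_partition_snd:
  assumes V: "finite V" and f: "f \<in> standard V la"
  shows "card {v\<in>V. P v} = (\<Sum>j\<in>snd ` boxes la. card {v\<in>V. snd (f v) = j \<and> P v})"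
proof -
  have "{v\<in>V. P v} = (\<Union>j\<in>snd ` boxes la. {v\<in>V. snd (f v) = j \<and> P v})"
    using f by (auto simp: standard_def)
  then show ?thesis using V by (simp only:) (subst card_UN_disjoint, auto)
qed

text \<open>Adding the comparison over all columns bounds the labels of the first i colours by those
  in the first i rows.\<close>

lemma col_sum_dominated:
  assumes la: "la \<in> partitions n" and V: "finite V" and f: "f \<in> standard V la" and A: "A \<in> matchings V"
    and ne: "col_sum V (f, A) c \<noteq> 0" and c: "content V c \<mu>"
  shows "dominated \<mu> la"
  unfolding dominated_def
proof
  fix i
  have "2 * sum_list (take i \<mu>) = card {v\<in>V. c v < i}" using content_less[OF V c] by simp
  also have "\<dots> \<le> card {v\<in>V. fst (f v) < i}"
    unfolding card_partition_snd[OF V f, of "\<lambda>v. c v < i"] card_partition_snd[OF V f, of "\<lambda>v. fst (f v) < i"]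
    by (rule sum_mono) (rule col_count_le[OF la V f A ne])
  also have "\<dots> = 2 * sum_list (take i la)" using content_less[OF V standard_content[OF V f], of i] by simp
  finally show "sum_list (take i \<mu>) \<le> sum_list (take i la)" by simp
qed

lemma dominated_antisym:
  assumes la: "la \<in> partitions n" and mu: "mu \<in> partitions m" and d: "dominated la mu" "dominated mu la"
  shows "la = mu"
proof -
  have eq: "sum_list (take i la) = sum_list (take i mu)" for i
    using d unfolding dominated_def by (simp add: order_antisym)
  \<comment> \<open>Entries past the end count as 0, so equal partial sums give equal entries before
    the lengths are known to agree.\<close>
  have nth: "(if i < length xs then xs ! i else 0) = sum_list (take (Suc i) xs) - sum_list (take i xs)"
    for i and xs :: "nat list" by (simp add: take_Suc_conv_app_nth)
  have nth_eq: "(if i < length la then la ! i else 0) = (if i < length mu then mu ! i else 0)" for i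
    unfolding nth eq ..
  have pos: "la ! i \<noteq> 0" if "i < length la" for i using partitionsD(2)[OF la] that by (metis nth_mem)
  have pos': "mu ! i \<noteq> 0" if "i < length mu" for i using partitionsD(2)[OF mu] that by (metis nth_mem)
  have iff: "i < length la \<longleftrightarrow> i < length mu" for i
    using nth_eq[of i] pos[of i] pos'[of i] by (auto split: if_splits)
  have "length la = length mu" using iff[of "length la"] iff[of "length mu"] by auto
  moreover have "la ! i = mu ! i" if "i < length la" for i
    using nth_eq[of i] that iff[of i] by simp
  ultimately show ?thesis by (intro nth_equalityI) auto
qed

lemma zonal_orthogonal:
  assumes la: "la \<in> partitions n" and mu: "mu \<in> partitions n" and ne: "la \<noteq> mu"
  shows "(\<Sum>\<rho>\<in>partitions n. zonal n \<rho> la * zonal n \<rho> mu * real (zee \<rho>) * 2 ^ length \<rho>) = 0"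
proof -
  have "col_sum (labels n) p (fst \<circ> fst q) * col_sum (labels n) q (fst \<circ> fst p) = 0"
    if p: "p \<in> tableaux (labels n) la" and q: "q \<in> tableaux (labels n) mu" for p q
  proof (rule ccontr)
    assume *: "\<not> ?thesis"
    obtain f A g B where pq: "p = (f, A)" "q = (g, B)" by fastforce
    have f: "f \<in> standard (labels n) la" "A \<in> matchings (labels n)"
      and g: "g \<in> standard (labels n) mu" "B \<in> matchings (labels n)"
      using p q matchings_of_matchings by (auto simp: tableaux_def pq)
    have "dominated mu la"
      by (rule col_sum_dominated[OF la _ f, of "fst \<circ> g"]) (use * standard_content[OF _ g(1)] in \<open>auto simp: pq\<close>)
    moreover have "dominated la mu"
      by (rule col_sum_dominated[OF mu _ g, of "fst \<circ> f"]) (use * standard_content[OF _ f(1)] in \<open>auto simp: pq\<close>)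
    ultimately show False using dominated_antisym[OF la mu] ne by simp
  qed
  then show ?thesis unfolding zonal_scalar_product[OF la mu] by (simp add: sum.neutral)
qed

section \<open>Triangularity and uniqueness\<close>

definition contents :: "nat \<Rightarrow> nat list \<Rightarrow> (nat \<Rightarrow> nat) set" where
  "contents n \<mu> = {c \<in> labels n \<rightarrow>\<^sub>E {..<length \<mu>}. content (labels n) c \<mu>}"

lemma finite_contents [simp]: "finite (contents n \<mu>)"
  by (rule finite_subset[of _ "labels n \<rightarrow>\<^sub>E {..<length \<mu>}"]) (auto simp: contents_def intro: finite_PiE)

text \<open>Lists \<open>X\<close> so that the values of \<open>g\<close> come in the order of
  \<rho>; this attaches the parts of a partition to individual loops.\<close>

lemma mset_eq_image_bij:
  assumes "finite X" "image_mset g (mset_set X) = mset \<rho>"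
  obtains e where "bij_betw e {..<length \<rho>} X" "\<And>i. i < length \<rho> \<Longrightarrow> g (e i) = \<rho> ! i"
proof -
  obtain xs where xs: "set xs = X" "distinct xs" using finite_distinct_list[OF assms(1)] by auto
  then have "mset_set X = mset xs" by (metis mset_set_set)
  then have "mset \<rho> = mset (map g xs)" using assms(2) by simp
  then obtain p where p: "p permutes {..<length (map g xs)}" "permute_list p (map g xs) = \<rho>"
    by (rule mset_eq_permutation)
  have len: "length \<rho> = length xs" using p(2) by auto
  have p': "p permutes {..<length xs}" using p by simp
  have "bij_betw ((!) xs \<circ> p) {..<length xs} X"
    using bij_betw_trans[OF permutes_imp_bij[OF p'] bij_betw_nth[OF xs(2) refl refl]] xs(1) by simp
  moreover have "g (((!) xs \<circ> p) i) = \<rho> ! i" if "i < length \<rho>" for i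
  proof -
    have "p i < length xs" using permutes_in_image[OF p', of i] that len by simp
    then show ?thesis using that p p' len
      by (metis comp_apply length_map nth_map permute_list_nth)
  qed
  ultimately show ?thesis using that len by simp
qed

text \<open>A colouring respected by both matchings is constant on loops, so it distributes the
  loops, that is the parts of \<rho>, over the colours. A product of power sums contributes to a
  monomial in the same way.\<close>

lemma p_to_m_colourings:
  assumes S: "S \<in> matchings (labels n)" and T: "T \<in> matchings (labels n)" and \<rho>: "loop_mset (labels n) S T = mset \<rho>"
  shows "real (p_to_m \<rho> \<mu>) = (\<Sum>c\<in>contents n \<mu>. fixed (labels n) c S * fixed (labels n) c T)"
proof -
  let ?N = "labels n"
  note ff = matchings_fixfree[OF S] matchings_fixfree[OF T]
  obtain e where e: "bij_betw e {..<length \<rho>} (orbs ?N S T)"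
    "\<And>i. i < length \<rho> \<Longrightarrow> card (e i) div 2 = \<rho> ! i"
    using mset_eq_image_bij[of "orbs ?N S T" "\<lambda>L. card L div 2" \<rho>] \<rho> by (auto simp: loop_mset_def)
  have eO: "e i \<in> orbs ?N S T" if "i < length \<rho>" for i
    using bij_betwE[OF e(1)] that by auto
  have card_e: "card (e i) = 2 * \<rho> ! i" if "i < length \<rho>" for i
  proof -
    have "even (card (e i))" using eO[OF that] orb_jseq(1)[OF finite_labels ff] by (auto simp: orbs_def)
    then show ?thesis using e(2)[OF that] by auto
  qed
  define g where "g v = inv_into {..<length \<rho>} e (orb ?N S T v)" for v
  have g: "g v < length \<rho>" "e (g v) = orb ?N S T v" if "v \<in> ?N" for v
  proof -
    have "orb ?N S T v \<in> e ` {..<length \<rho>}" using e(1) that by (auto simp: bij_betw_def orbs_def)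
    then show "g v < length \<rho>" "e (g v) = orb ?N S T v"
      unfolding g_def using inv_into_into[of _ e "{..<length \<rho>}"] f_inv_into_f[of _ e "{..<length \<rho>}"] by auto
  qed
  have g_eq: "g v = i" if "i < length \<rho>" "v \<in> e i" for i v
  proof -
    have "orb ?N S T v = e i" using orbs_eq_orb[OF ff eO[OF that(1)] that(2)] by simp
    then show ?thesis unfolding g_def using e(1) that(1) by (simp add: bij_betw_def inv_into_f_f)
  qed
  have e_sub: "e i \<subseteq> ?N" if "i < length \<rho>" for i using orbs_subset[OF ff eO[OF that]] .
  have some: "(SOME v. v \<in> e i) \<in> e i" if "i < length \<rho>" for i
  proof -
    have "e i \<noteq> {}" using eO[OF that] by (auto simp: orbs_def intro: orb_self)
    then show ?thesis by (rule some_in_eq[THEN iffD2])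
  qed
  \<comment> \<open>The labels of colour \<open>j\<close> are those on the loops assigned to
    \<open>j\<close>; a part of size m stands for 2m labels.\<close>
  have count: "card {v\<in>?N. f (g v) = j} = 2 * (\<Sum>i\<in>{i. i < length \<rho> \<and> f i = j}. \<rho> ! i)" for f :: "nat \<Rightarrow> nat" and j
  proof -
    have "{v\<in>?N. f (g v) = j} = (\<Union>i\<in>{i. i < length \<rho> \<and> f i = j}. e i)"
    proof (intro equalityI subsetI)
      fix v assume "v \<in> {v\<in>?N. f (g v) = j}"
      then have "g v < length \<rho>" "f (g v) = j" "v \<in> e (g v)" using g[of v] by auto
      then show "v \<in> (\<Union>i\<in>{i. i < length \<rho> \<and> f i = j}. e i)" by blast
    next
      fix v assume "v \<in> (\<Union>i\<in>{i. i < length \<rho> \<and> f i = j}. e i)"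
      then obtain i where "i < length \<rho>" "f i = j" "v \<in> e i" by blast
      then show "v \<in> {v\<in>?N. f (g v) = j}" using g_eq[of i v] e_sub[of i] by auto
    qed
    also have "card \<dots> = (\<Sum>i\<in>{i. i < length \<rho> \<and> f i = j}. card (e i))"
    proof (rule card_UN_disjoint)
      show "\<forall>i\<in>{i. i < length \<rho> \<and> f i = j}. finite (e i)"
        using finite_subset[OF e_sub finite_labels] by auto
      show "\<forall>i\<in>{i. i < length \<rho> \<and> f i = j}. \<forall>i'\<in>{i. i < length \<rho> \<and> f i = j}. i \<noteq> i' \<longrightarrow> e i \<inter> e i' = {}"
        using g_eq by blast
    qed auto
    also have "\<dots> = 2 * (\<Sum>i\<in>{i. i < length \<rho> \<and> f i = j}. \<rho> ! i)"
      by (simp add: sum_distrib_left card_e)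
    finally show ?thesis .
  qed
  let ?F = "{f \<in> {..<length \<rho>} \<rightarrow>\<^sub>E {..<length \<mu>}.
      \<forall>j<length \<mu>. (\<Sum>i\<in>{i. i < length \<rho> \<and> f i = j}. \<rho> ! i) = \<mu> ! j}"
  let ?C = "{c \<in> contents n \<mu>. S \<in> matchings_of ?N c \<and> T \<in> matchings_of ?N c}"
  have "bij_betw (\<lambda>f. restrict (f \<circ> g) ?N) ?F ?C"
  proof (rule bij_betw_byWitness[where f' = "\<lambda>c. restrict (\<lambda>i. c (SOME v. v \<in> e i)) {..<length \<rho>}"])
    show "\<forall>f\<in>?F. restrict (\<lambda>i. restrict (f \<circ> g) ?N (SOME v. v \<in> e i)) {..<length \<rho>} = f"
    proof
      fix f assume f: "f \<in> ?F"
      show "restrict (\<lambda>i. restrict (f \<circ> g) ?N (SOME v. v \<in> e i)) {..<length \<rho>} = f"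
      proof
        fix i
        show "restrict (\<lambda>i. restrict (f \<circ> g) ?N (SOME v. v \<in> e i)) {..<length \<rho>} i = f i"
        proof (cases "i < length \<rho>")
          case True
          then have "(SOME v. v \<in> e i) \<in> ?N" "g (SOME v. v \<in> e i) = i"
            using some[OF True] e_sub[OF True] g_eq[OF True] by auto
          then show ?thesis using True by simp
        next
          case False
          then show ?thesis using f by (auto simp: PiE_def extensional_def)
        qed
      qed
    qed
    have const: "c u = c v" if "c \<in> ?C" "v \<in> ?N" "u \<in> orb ?N S T v" for c u v
    proof -
      have "orb ?N S T v \<subseteq> {u \<in> ?N. c u = c v}"
        by (rule orb_least) (use that ff in \<open>auto simp: matchings_of_def fixfree_def\<close>)
      then show ?thesis using that by auto
    qed
    have inv: "c (SOME u. u \<in> e (g v)) = c v" if "c \<in> ?C" "v \<in> ?N" for c v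
      by (rule const[OF that]) (use some[OF g(1)[OF that(2)]] g(2)[OF that(2)] in simp)
    show "\<forall>c\<in>?C. restrict (restrict (\<lambda>i. c (SOME v. v \<in> e i)) {..<length \<rho>} \<circ> g) ?N = c"
    proof
      fix c assume c: "c \<in> ?C"
      then have "c \<in> ?N \<rightarrow>\<^sub>E {..<length \<mu>}" by (simp add: contents_def)
      then show "restrict (restrict (\<lambda>i. c (SOME v. v \<in> e i)) {..<length \<rho>} \<circ> g) ?N = c"
        using inv[OF c] g(1) by (auto simp: fun_eq_iff PiE_def extensional_def restrict_def)
    qed
    show "(\<lambda>f. restrict (f \<circ> g) ?N) ` ?F \<subseteq> ?C"
    proof safe
      fix f assume f: "f \<in> {..<length \<rho>} \<rightarrow>\<^sub>E {..<length \<mu>}"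
        "\<forall>j<length \<mu>. (\<Sum>i\<in>{i. i < length \<rho> \<and> f i = j}. \<rho> ! i) = \<mu> ! j"
      have gST: "g (S v) = g v" "g (T v) = g v" if "v \<in> ?N" for v
      proof -
        have "orb ?N S T (S v) = orb ?N S T v" "orb ?N S T (T v) = orb ?N S T v"
          using orb_step[OF orb_self that] by (intro orb_eq[OF ff that]; simp)+
        then show "g (S v) = g v" "g (T v) = g v" by (simp_all only: g_def)
      qed
      have "{v\<in>?N. restrict (f \<circ> g) ?N v = j} = {v\<in>?N. f (g v) = j}" for j by auto
      then have "content ?N (restrict (f \<circ> g) ?N) \<mu>"
        using f g(1) by (auto simp: content_def count PiE_def Pi_def simp del: restrict_apply)
      then show "restrict (f \<circ> g) ?N \<in> contents n \<mu>"
        using f(1) g(1) by (auto simp: contents_def)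
      show "S \<in> matchings_of ?N (restrict (f \<circ> g) ?N)" "T \<in> matchings_of ?N (restrict (f \<circ> g) ?N)"
        using S T ff gST by (auto simp: matchings_of_def fixfree_def)
    qed
    show "(\<lambda>c. restrict (\<lambda>i. c (SOME v. v \<in> e i)) {..<length \<rho>}) ` ?C \<subseteq> ?F"
    proof (rule image_subsetI)
      fix c assume c: "c \<in> ?C"
      let ?f = "restrict (\<lambda>i. c (SOME v. v \<in> e i)) {..<length \<rho>}"
      have "c \<in> ?N \<rightarrow>\<^sub>E {..<length \<mu>}" using c by (simp add: contents_def)
      moreover have "(SOME v. v \<in> e i) \<in> ?N" if "i < length \<rho>" for i
        using some[OF that] e_sub[OF that] by auto
      ultimately have 1: "?f \<in> {..<length \<rho>} \<rightarrow>\<^sub>E {..<length \<mu>}" by auto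
      have "(\<Sum>i\<in>{i. i < length \<rho> \<and> ?f i = j}. \<rho> ! i) = \<mu> ! j" if "j < length \<mu>" for j
      proof -
        have "{v\<in>?N. ?f (g v) = j} = {v\<in>?N. c v = j}" using inv[OF c] g(1) by auto
        moreover have "card {v\<in>?N. c v = j} = 2 * \<mu> ! j" using c that by (auto simp: contents_def content_def)
        ultimately show ?thesis using count[of ?f j] by simp
      qed
      then show "?f \<in> ?F" using 1 by blast
    qed
  qed
  then have "p_to_m \<rho> \<mu> = card ?C" unfolding p_to_m_def by (rule bij_betw_same_card)
  also have "real (card ?C) = (\<Sum>c\<in>?C. 1)" by simp
  also have "\<dots> = (\<Sum>c\<in>contents n \<mu>. fixed ?N c S * fixed ?N c T)"
    by (rule sum.mono_neutral_cong_left) (auto simp: fixed_def)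
  finally show ?thesis .
qed

text \<open>Colourings take the place of the second tableau: they restrict \<open>S\<close> and
  \<open>T\<close> in the same way, so the double sum factors as in the scalar product.\<close>

lemma m_coeff_zonal:
  assumes la: "la \<in> partitions n"
  shows "m_coeff n (\<lambda>\<rho>. zonal n \<rho> la) \<mu> = (-1) ^ n / fact (2 * n) *
    (\<Sum>p\<in>tableaux (labels n) la. \<Sum>c\<in>contents n \<mu>. col_sum (labels n) p c * row_sum (labels n) p c)"
proof -
  let ?N = "labels n"
  let ?P = "\<lambda>\<rho>. {(S, T). S \<in> matchings ?N \<and> T \<in> matchings ?N \<and> loop_mset ?N S T = mset \<rho>}"
  have card: "card ?N = 2 * sum_list la" using partitionsD(3)[OF la] by auto
  have "m_coeff n (\<lambda>\<rho>. zonal n \<rho> la) \<mu> =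
      (\<Sum>\<rho>\<in>partitions n. \<Sum>(S, T)\<in>?P \<rho>. (-1) ^ n / fact (2 * n) * (filling_sum ?N S T la * real (p_to_m \<rho> \<mu>)))"
    unfolding m_coeff_def using la
    by (intro sum.cong refl) (simp add: zonal_def sum_distrib_right sum_distrib_left split_beta mult_ac)
  also have "\<dots> = (\<Sum>S\<in>matchings ?N. \<Sum>T\<in>matchings ?N.
      (-1) ^ n / fact (2 * n) * (filling_sum ?N S T la * real (p_to_m (part_of (loop_mset ?N S T)) \<mu>)))"
    by (rule sum_over_types)
  also have "\<dots> = (-1) ^ n / fact (2 * n) *
      (\<Sum>S\<in>matchings ?N. \<Sum>T\<in>matchings ?N. filling_sum ?N S T la * real (p_to_m (part_of (loop_mset ?N S T)) \<mu>))"
    by (simp add: sum_distrib_left)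
  also have "(\<Sum>S\<in>matchings ?N. \<Sum>T\<in>matchings ?N. filling_sum ?N S T la * real (p_to_m (part_of (loop_mset ?N S T)) \<mu>)) =
    (\<Sum>S\<in>matchings ?N. \<Sum>T\<in>matchings ?N.
      (\<Sum>p\<in>tableaux ?N la. (weight ?N (snd p) S * fixed ?N (snd \<circ> fst p) S) * fixed ?N (fst \<circ> fst p) T) *
      (\<Sum>c\<in>contents n \<mu>. fixed ?N c T * fixed ?N c S))"
    using filling_sum_standard[of ?N la] card p_to_m_colourings[of _ n]
    by (intro sum.cong refl arg_cong2[of _ _ _ _ "(*)"]) (auto simp: split_beta mult.commute)
  also have "\<dots> = (\<Sum>p\<in>tableaux ?N la. \<Sum>c\<in>contents n \<mu>. col_sum ?N p c * row_sum ?N p c)"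
    by (rule trans[OF sum_tableaux_swap]) (simp only: col_sum_def row_sum_def)
  finally show ?thesis .
qed

lemma m_coeff_zonal_triangular:
  assumes la: "la \<in> partitions n" and ndom: "\<not> dominated \<mu> la"
  shows "m_coeff n (\<lambda>\<rho>. zonal n \<rho> la) \<mu> = 0"
proof -
  have "col_sum (labels n) p c = 0" if p: "p \<in> tableaux (labels n) la" and c: "c \<in> contents n \<mu>" for p c
  proof (rule ccontr)
    assume *: "col_sum (labels n) p c \<noteq> 0"
    obtain f A where pq: "p = (f, A)" by fastforce
    have f: "f \<in> standard (labels n) la" "A \<in> matchings (labels n)"
      using p matchings_of_matchings by (auto simp: tableaux_def pq)
    have "dominated \<mu> la"
      by (rule col_sum_dominated[OF la _ f, of c]) (use * c in \<open>auto simp: pq contents_def\<close>)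
    then show False using ndom by simp
  qed
  then show ?thesis unfolding m_coeff_zonal[OF la] by (simp add: sum.neutral)
qed

section \<open>Power sums, monomials and uniqueness\<close>

text \<open>A nonzero coefficient means that the parts of \<rho> arise by grouping the parts of
  \<sigma>. No group is empty, so \<rho> has no more parts than \<sigma>; with equally many, each
  group is a single part.\<close>

lemma p_to_m_length:
  assumes \<sigma>: "\<sigma> \<in> partitions n" and \<rho>: "\<rho> \<in> partitions n" and ne: "p_to_m \<sigma> \<rho> \<noteq> 0"
    and len: "length \<sigma> \<le> length \<rho>"
  shows "\<sigma> = \<rho>"
proof -
  have "{f \<in> {..<length \<sigma>} \<rightarrow>\<^sub>E {..<length \<rho>}.
      \<forall>j<length \<rho>. (\<Sum>i\<in>{i. i < length \<sigma> \<and> f i = j}. \<sigma> ! i) = \<rho> ! j} \<noteq> {}"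
    (is "?F \<noteq> {}") using ne unfolding p_to_m_def by (intro notI) (simp only: card.empty)
  then obtain f where "f \<in> ?F" by blast
  then have f: "f \<in> {..<length \<sigma>} \<rightarrow>\<^sub>E {..<length \<rho>}"
    "\<forall>j<length \<rho>. (\<Sum>i\<in>{i. i < length \<sigma> \<and> f i = j}. \<sigma> ! i) = \<rho> ! j" by blast+
  have surj: "f ` {..<length \<sigma>} = {..<length \<rho>}"
  proof
    show "f ` {..<length \<sigma>} \<subseteq> {..<length \<rho>}" using f(1) by auto
    show "{..<length \<rho>} \<subseteq> f ` {..<length \<sigma>}"
    proof
      fix j assume j: "j \<in> {..<length \<rho>}"
      then have "\<rho> ! j \<noteq> 0" using partitionsD(2)[OF \<rho>] by (metis lessThan_iff nth_mem)
      then have "{i. i < length \<sigma> \<and> f i = j} \<noteq> {}" using f(2)[rule_format, of j] j by (intro notI) simp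
      then show "j \<in> f ` {..<length \<sigma>}" by auto
    qed
  qed
  then have leq: "length \<sigma> = length \<rho>" using card_image_le[of "{..<length \<sigma>}" f] len by simp
  then have inj: "inj_on f {..<length \<sigma>}" using surj by (intro eq_card_imp_inj_on) simp_all
  have nth: "\<rho> ! f i = \<sigma> ! i" if i: "i < length \<sigma>" for i
  proof -
    have "{k. k < length \<sigma> \<and> f k = f i} = {i}" using inj i by (auto simp: inj_on_def)
    moreover have "f i < length \<rho>" using f(1) i by auto
    ultimately show ?thesis using f(2)[rule_format, of "f i"] by simp
  qed
  have "mset \<rho> = image_mset ((!) \<rho>) (mset_set {..<length \<rho>})"
    by (metis atLeast0LessThan map_nth mset_map mset_set_upto_eq_mset_upto)
  also have "mset_set {..<length \<rho>} = image_mset f (mset_set {..<length \<sigma>})"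
    using image_mset_mset_set[OF inj] surj by simp
  also have "image_mset ((!) \<rho>) \<dots> = image_mset ((!) \<sigma>) (mset_set {..<length \<sigma>})"
    by (simp add: multiset.map_comp) (rule image_mset_cong, use nth in auto)
  also have "\<dots> = mset \<sigma>"
    by (metis atLeast0LessThan map_nth mset_map mset_set_upto_eq_mset_upto)
  finally show ?thesis using part_of_mset[OF \<sigma>] part_of_mset[OF \<rho>] by metis
qed

lemma p_to_m_self: "p_to_m \<rho> \<rho> \<noteq> 0"
proof -
  let ?F = "{f \<in> {..<length \<rho>} \<rightarrow>\<^sub>E {..<length \<rho>}.
      \<forall>j<length \<rho>. (\<Sum>i\<in>{i. i < length \<rho> \<and> f i = j}. \<rho> ! i) = \<rho> ! j}"
  have "{i. i < length \<rho> \<and> restrict id {..<length \<rho>} i = j} = {j}" if "j < length \<rho>" for j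
    using that by auto
  then have "restrict id {..<length \<rho>} \<in> ?F" by simp
  moreover have "finite ?F" by (rule finite_subset[of _ "{..<length \<rho>} \<rightarrow>\<^sub>E {..<length \<rho>}"]) (auto intro: finite_PiE)
  ultimately show ?thesis unfolding p_to_m_def by (metis (no_types, lifting) card_0_eq empty_iff)
qed

text \<open>Triangularity by length: at a partition of greatest length in the support of
  \<open>a\<close>, only its own power sum contributes to the monomial coefficient.\<close>

lemma m_coeff_inj:
  assumes "\<forall>\<mu>\<in>partitions n. m_coeff n a \<mu> = 0" "\<rho> \<in> partitions n"
  shows "a \<rho> = 0"
proof (rule ccontr)
  assume "a \<rho> \<noteq> 0"
  let ?X = "{\<rho> \<in> partitions n. a \<rho> \<noteq> 0}"
  have "finite (length ` ?X)" "length ` ?X \<noteq> {}" using assms(2) \<open>a \<rho> \<noteq> 0\<close> by auto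
  then have "Max (length ` ?X) \<in> length ` ?X" "\<forall>l\<in>length ` ?X. l \<le> Max (length ` ?X)"
    by (auto intro: Max_in)
  then obtain \<sigma> where \<sigma>: "\<sigma> \<in> ?X" "\<forall>l\<in>length ` ?X. l \<le> length \<sigma>" by (metis (no_types, lifting) imageE)
  have "m_coeff n a \<sigma> = (\<Sum>\<tau>\<in>partitions n. if \<tau> = \<sigma> then a \<sigma> * real (p_to_m \<sigma> \<sigma>) else 0)"
    unfolding m_coeff_def using p_to_m_length[of _ n \<sigma>] \<sigma> by (intro sum.cong refl) fastforce
  also have "\<dots> = a \<sigma> * real (p_to_m \<sigma> \<sigma>)" using \<sigma>(1) by simp
  finally show False using assms(1) \<sigma>(1) p_to_m_self[of \<sigma>] by auto
qed

lemma hook_c_pos: "\<alpha> > 0 \<Longrightarrow> hook_c \<alpha> la > 0"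
  unfolding hook_c_def by (rule prod_pos) (auto intro!: add_nonneg_pos add_nonneg_nonneg)

lemma m_coeff_diff: "m_coeff n (\<lambda>\<rho>. a \<rho> - t * b \<rho>) \<mu> = m_coeff n a \<mu> - t * m_coeff n b \<mu>"
  unfolding m_coeff_def by (simp add: left_diff_distrib sum_subtractf sum_distrib_left mult.assoc)

lemma dominated_trans: "dominated la mu \<Longrightarrow> dominated mu nu \<Longrightarrow> dominated la nu"
  unfolding dominated_def using le_trans by blast

text \<open>\<open>a\<close> involves only monomials in the down-set \<open>U\<close>. At a maximal
  \<kappa> of \<open>U\<close> its coefficient is cleared by a multiple of the Jack function of
  \<kappa>, whose monomials stay in \<open>U\<close> and which is orthogonal to that of
  \<open>la\<close>. Repetition reduces \<open>a\<close> to zero.\<close>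

lemma jack_family_orthogonal_lower:
  assumes J: "jack_family \<alpha> n \<theta>" and \<alpha>: "\<alpha> > 0"
    and U: "U \<subseteq> partitions n" "\<And>\<kappa> \<mu>. \<kappa> \<in> U \<Longrightarrow> \<mu> \<in> partitions n \<Longrightarrow> dominated \<mu> \<kappa> \<Longrightarrow> \<mu> \<in> U"
    and la: "la \<in> partitions n" "la \<notin> U"
    and a: "\<And>\<mu>. \<mu> \<in> partitions n \<Longrightarrow> \<mu> \<notin> U \<Longrightarrow> m_coeff n a \<mu> = 0"
  shows "(\<Sum>\<rho>\<in>partitions n. a \<rho> * \<theta> \<rho> la * real (zee \<rho>) * \<alpha> ^ length \<rho>) = 0"
proof -
  have "finite U" using U(1) finite_partitions finite_subset by blast
  then show ?thesis using U la a
  proof (induction "card U" arbitrary: U a)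
    case 0
    then have "a \<rho> = 0" if "\<rho> \<in> partitions n" for \<rho> using m_coeff_inj[of n a \<rho>] that by auto
    then show ?case by simp
  next
    case (Suc m)
    define R where "R \<kappa> \<kappa>' \<longleftrightarrow> dominated \<kappa> \<kappa>' \<and> \<kappa> \<noteq> \<kappa>'" for \<kappa> \<kappa>'
    have anti: "\<kappa> = \<kappa>'" if "\<kappa> \<in> U" "\<kappa>' \<in> U" "dominated \<kappa> \<kappa>'" "dominated \<kappa>' \<kappa>" for \<kappa> \<kappa>'
      using that dominated_antisym Suc.prems(2) by blast
    have "U \<noteq> {}" using Suc.hyps(2) by auto
    then obtain \<kappa> where \<kappa>: "\<kappa> \<in> U" "\<forall>\<kappa>'\<in>U. \<kappa>' \<noteq> \<kappa> \<longrightarrow> \<not> R \<kappa> \<kappa>'"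
    proof -
      have "asymp_on U R" using anti by (auto simp: R_def intro!: asymp_onI)
      moreover have "transp_on U R"
      proof (rule transp_onI)
        fix x y z assume "x \<in> U" "y \<in> U" "z \<in> U" "R x y" "R y z"
        then show "R x z" using anti[of x y] dominated_trans[of x y z] by (auto simp: R_def)
      qed
      ultimately show ?thesis
        using Finite_Set.bex_max_element[of U R] Suc.prems(1) \<open>U \<noteq> {}\<close> that by metis
    qed
    define t where "t = m_coeff n a \<kappa> / hook_c \<alpha> \<kappa>"
    define a' where "a' \<rho> = a \<rho> - t * \<theta> \<rho> \<kappa>" for \<rho>
    have \<kappa>P: "\<kappa> \<in> partitions n" using \<kappa> Suc.prems(2) by auto
    have "(\<Sum>\<rho>\<in>partitions n. a' \<rho> * \<theta> \<rho> la * real (zee \<rho>) * \<alpha> ^ length \<rho>) = 0"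
    proof (rule Suc.hyps(1))
      show "m = card (U - {\<kappa>})" using Suc.hyps(2) \<kappa>(1) Suc.prems(1) by simp
      show "\<mu> \<in> U - {\<kappa>}" if "\<kappa>' \<in> U - {\<kappa>}" "\<mu> \<in> partitions n" "dominated \<mu> \<kappa>'" for \<kappa>' \<mu>
        using that \<kappa> Suc.prems(3)[of \<kappa>' \<mu>] by (auto simp: R_def)
      show "m_coeff n a' \<mu> = 0" if \<mu>: "\<mu> \<in> partitions n" "\<mu> \<notin> U - {\<kappa>}" for \<mu>
      proof (cases "\<mu> = \<kappa>")
        case True
        have "m_coeff n (\<lambda>\<rho>. \<theta> \<rho> \<kappa>) \<kappa> = hook_c \<alpha> \<kappa>" using J \<kappa>P by (auto simp: jack_family_def)
        then show ?thesis using hook_c_pos[OF \<alpha>, of \<kappa>] unfolding a'_def[abs_def] m_coeff_diff True t_def by simp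
      next
        case False
        then have "\<mu> \<notin> U" "\<not> dominated \<mu> \<kappa>" using \<mu> \<kappa>(1) Suc.prems(3)[of \<kappa> \<mu>] by auto
        then have "m_coeff n (\<lambda>\<rho>. \<theta> \<rho> \<kappa>) \<mu> = 0" "m_coeff n a \<mu> = 0"
          using J \<kappa>P \<mu>(1) Suc.prems(6) unfolding jack_family_def by blast+
        then show ?thesis unfolding a'_def[abs_def] m_coeff_diff by simp
      qed
    qed (use Suc.prems in auto)
    moreover have "(\<Sum>\<rho>\<in>partitions n. \<theta> \<rho> \<kappa> * \<theta> \<rho> la * real (zee \<rho>) * \<alpha> ^ length \<rho>) = 0"
    proof -
      have "\<kappa> \<noteq> la" using \<kappa>(1) Suc.prems(5) by auto
      then show ?thesis using J \<kappa>P la unfolding jack_family_def by blast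
    qed
    ultimately show ?case
      unfolding a'_def by (simp add: left_diff_distrib sum_subtractf mult.assoc sum_distrib_left[symmetric])
  qed
qed

text \<open>The difference of two candidates at \<open>la\<close> has only monomials strictly below
  \<open>la\<close>, so it is orthogonal to both candidates and hence to itself. The form is
  positive definite for \<alpha> > 0.\<close>

lemma jack_family_unique:
  assumes J: "jack_family \<alpha> n \<theta>" and J': "jack_family \<alpha> n \<theta>'" and \<alpha>: "\<alpha> > 0"
  shows "\<theta> = \<theta>'"
proof (intro ext)
  fix \<rho> la
  show "\<theta> \<rho> la = \<theta>' \<rho> la"
  proof (cases "\<rho> \<in> partitions n \<and> la \<in> partitions n")
    case False
    then show ?thesis using J J' by (auto simp: jack_family_def)
  next
    case True
    then have la: "la \<in> partitions n" by simp
    let ?U = "{\<mu> \<in> partitions n. dominated \<mu> la \<and> \<mu> \<noteq> la}"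
    define d where "d \<rho> = \<theta> \<rho> la - 1 * \<theta>' \<rho> la" for \<rho>
    have down: "\<mu> \<in> ?U" if "\<kappa> \<in> ?U" "\<mu> \<in> partitions n" "dominated \<mu> \<kappa>" for \<kappa> \<mu>
      using that dominated_trans[of \<mu> \<kappa> la] dominated_antisym[of \<kappa> n la n] la by auto
    have dU: "m_coeff n d \<mu> = 0" if "\<mu> \<in> partitions n" "\<mu> \<notin> ?U" for \<mu>
    proof (cases "\<mu> = la")
      case True
      then show ?thesis using J J' la unfolding d_def[abs_def] m_coeff_diff by (auto simp: jack_family_def)
    next
      case False
      then have "\<not> dominated \<mu> la" using that by auto
      then have "m_coeff n (\<lambda>\<rho>. \<theta> \<rho> la) \<mu> = 0" "m_coeff n (\<lambda>\<rho>. \<theta>' \<rho> la) \<mu> = 0"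
        using J J' la that(1) unfolding jack_family_def by blast+
      then show ?thesis unfolding d_def[abs_def] m_coeff_diff by simp
    qed
    have "(\<Sum>\<rho>\<in>partitions n. d \<rho> * \<theta> \<rho> la * real (zee \<rho>) * \<alpha> ^ length \<rho>) = 0"
      by (rule jack_family_orthogonal_lower[OF J \<alpha> _ down la _ dU]) auto
    moreover have "(\<Sum>\<rho>\<in>partitions n. d \<rho> * \<theta>' \<rho> la * real (zee \<rho>) * \<alpha> ^ length \<rho>) = 0"
      by (rule jack_family_orthogonal_lower[OF J' \<alpha> _ down la _ dU]) auto
    moreover have "(\<Sum>\<rho>\<in>partitions n. (d \<rho>)\<^sup>2 * (real (zee \<rho>) * \<alpha> ^ length \<rho>)) =
        (\<Sum>\<rho>\<in>partitions n. d \<rho> * \<theta> \<rho> la * real (zee \<rho>) * \<alpha> ^ length \<rho>) -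
        (\<Sum>\<rho>\<in>partitions n. d \<rho> * \<theta>' \<rho> la * real (zee \<rho>) * \<alpha> ^ length \<rho>)"
      unfolding sum_subtractf[symmetric]
      by (rule sum.cong) (simp_all add: d_def power2_eq_square algebra_simps)
    ultimately have "(\<Sum>\<rho>\<in>partitions n. (d \<rho>)\<^sup>2 * (real (zee \<rho>) * \<alpha> ^ length \<rho>)) = 0" by simp
    then have "\<forall>\<rho>\<in>partitions n. (d \<rho>)\<^sup>2 * (real (zee \<rho>) * \<alpha> ^ length \<rho>) = 0"
      using \<alpha> by (subst (asm) sum_nonneg_eq_0_iff) auto
    then show ?thesis using True zee_pos[of \<rho> n] \<alpha> by (auto simp: d_def)
  qed
qed

section \<open>Determinants\<close>

text \<open>Indexed by a set, because the determinants below run over red labels or boxes, for which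
  no order is chosen.\<close>

definition set_det :: "'a set \<Rightarrow> ('a \<Rightarrow> 'a \<Rightarrow> real) \<Rightarrow> real" where
  "set_det B M = (\<Sum>p\<in>{p. p permutes B}. of_int (sign p) * (\<Prod>b\<in>B. M b (p b)))"

lemma set_det_cong: "(\<And>a b. a \<in> B \<Longrightarrow> b \<in> B \<Longrightarrow> M a b = M' a b) \<Longrightarrow> set_det B M = set_det B M'"
  unfolding set_det_def by (intro sum.cong prod.cong arg_cong2[of _ _ _ _ "(*)"] refl) (auto simp: permutes_in_image)

lemma set_det_empty [simp]: "set_det {} M = 1"
  by (simp add: set_det_def)

lemma set_det_transport:
  assumes g: "bij_betw g A B" and fin: "finite A"
  shows "set_det B M = set_det A (\<lambda>a b. M (g a) (g b))"
proof -
  have gA: "g ` A = B" "inj_on g A" using g by (auto simp: bij_betw_def)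
  have eq: "(\<lambda>x. if x \<in> B then g (p (inv_into A g x)) else x) = map_permutation A g p" for p
    by (auto simp: map_permutation_def restrict_id_def gA)
  have "set_det B M = (\<Sum>p\<in>{p. p permutes A}. of_int (sign (map_permutation A g p)) * (\<Prod>b\<in>B. M b (map_permutation A g p b)))"
    unfolding set_det_def eq[symmetric]
    by (rule sum.reindex_bij_betw[OF bij_betw_permutations[OF g], symmetric])
  also have "\<dots> = set_det A (\<lambda>a b. M (g a) (g b))"
    unfolding set_det_def
  proof (rule sum.cong[OF refl])
    fix p assume "p \<in> {p. p permutes A}"
    then have p: "p permutes A" by simp
    have "(\<Prod>b\<in>B. M b (map_permutation A g p b)) = (\<Prod>a\<in>A. M (g a) (map_permutation A g p (g a)))"
      by (rule prod.reindex_bij_betw[OF g, symmetric])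
    also have "\<dots> = (\<Prod>a\<in>A. M (g a) (g (p a)))"
      by (rule prod.cong) (use map_permutation_apply[OF gA(2)] in auto)
    finally show "of_int (sign (map_permutation A g p)) * (\<Prod>b\<in>B. M b (map_permutation A g p b)) =
        of_int (sign p) * (\<Prod>b\<in>A. M (g b) (g (p b)))"
      using sign_map_permutation[OF gA(2) p fin] by simp
  qed
  finally show ?thesis .
qed

lemma permutes_split_union:
  assumes r: "r permutes (A \<union> B)" and fin: "finite A" and disj: "A \<inter> B = {}" and AA: "r ` A \<subseteq> A"
  shows "restrict_id r A permutes A" "restrict_id r B permutes B" "restrict_id r A \<circ> restrict_id r B = r"
proof -
  have inj: "inj_on r A" using permutes_inj[OF r] by (rule inj_on_subset) simp
  have A: "r ` A = A" using endo_inj_surj[OF fin AA inj] .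
  have "r ` B = r ` ((A \<union> B) - A)" using disj by (intro arg_cong[of _ _ "image r"]) auto
  also have "\<dots> = r ` (A \<union> B) - r ` A" using permutes_inj[OF r] by (rule image_set_diff)
  also have "\<dots> = B" using permutes_image[OF r] A disj by auto
  finally have B: "r ` B = B" .
  show "restrict_id r A permutes A" "restrict_id r B permutes B"
    using A B inj inj_on_subset[OF permutes_inj[OF r], of B]
    by (auto intro!: permutes_restrict_id simp: bij_betw_def)
  show "restrict_id r A \<circ> restrict_id r B = r"
  proof
    fix x show "(restrict_id r A \<circ> restrict_id r B) x = r x"
      using A B disj permutes_not_in[OF r, of x] by (auto simp: restrict_id_def)
  qed
qed

text \<open>Permutations that move an element of \<open>A\<close> into \<open>B\<close> meet a zero
  entry. The others preserve both sets and split into two independent permutations.\<close>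

lemma set_det_union:
  assumes fin: "finite A" "finite B" and disj: "A \<inter> B = {}" and z: "\<And>a b. a \<in> A \<Longrightarrow> b \<in> B \<Longrightarrow> M a b = 0"
  shows "set_det (A \<union> B) M = set_det A M * set_det B M"
proof -
  let ?f = "\<lambda>r. of_int (sign r) * (\<Prod>b\<in>A \<union> B. M b (r b))"
  let ?R = "{r. r permutes (A \<union> B) \<and> r ` A \<subseteq> A}"
  have "set_det (A \<union> B) M = (\<Sum>r\<in>?R. ?f r)" unfolding set_det_def
  proof (rule sum.mono_neutral_right)
    show "finite {r. r permutes (A \<union> B)}" using fin by (intro finite_permutations) auto
    show "\<forall>r\<in>{r. r permutes (A \<union> B)} - ?R. ?f r = 0"
    proof
      fix r assume r: "r \<in> {r. r permutes (A \<union> B)} - ?R"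
      then obtain a where a: "a \<in> A" "r a \<notin> A" by auto
      then have "r a \<in> B" using r permutes_in_image[of r "A \<union> B" a] by auto
      then have "(\<Prod>b\<in>A \<union> B. M b (r b)) = 0" using fin a(1) z by (intro prod_zero) auto
      then show "?f r = 0" by simp
    qed
  qed auto
  also have "\<dots> = (\<Sum>(p, q)\<in>{p. p permutes A} \<times> {q. q permutes B}.
      (of_int (sign p) * (\<Prod>b\<in>A. M b (p b))) * (of_int (sign q) * (\<Prod>b\<in>B. M b (q b))))"
  proof (rule sum.reindex_bij_witness[where i = "\<lambda>(p, q). p \<circ> q" and j = "\<lambda>r. (restrict_id r A, restrict_id r B)"])
    fix r assume "r \<in> ?R"
    then have r: "r permutes (A \<union> B)" "r ` A \<subseteq> A" by auto
    note s = permutes_split_union[OF r(1) fin(1) disj r(2)]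
    show "(case (restrict_id r A, restrict_id r B) of (p, q) \<Rightarrow> p \<circ> q) = r" using s(3) by simp
    show "(restrict_id r A, restrict_id r B) \<in> {p. p permutes A} \<times> {q. q permutes B}" using s by simp
    have "sign r = sign (restrict_id r A) * sign (restrict_id r B)"
      by (subst s(3)[symmetric], rule sign_compose)
        (use s fin in \<open>auto intro: permutes_imp_permutation\<close>)
    moreover have "(\<Prod>b\<in>A \<union> B. M b (r b)) = (\<Prod>b\<in>A. M b (restrict_id r A b)) * (\<Prod>b\<in>B. M b (restrict_id r B b))"
      using fin disj by (simp add: prod.union_disjoint)
    ultimately show "(case (restrict_id r A, restrict_id r B) of (p, q) \<Rightarrow>
       (of_int (sign p) * (\<Prod>b\<in>A. M b (p b))) * (of_int (sign q) * (\<Prod>b\<in>B. M b (q b)))) = ?f r"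
      by simp
  next
    fix y assume "y \<in> {p. p permutes A} \<times> {q. q permutes B}"
    then obtain p q where y: "y = (p, q)" "p permutes A" "q permutes B" by auto
    have pB: "p b = b" if "b \<in> B" for b using permutes_not_in[OF y(2)] that disj by auto
    have qA: "q a = a" if "a \<notin> B" for a using permutes_not_in[OF y(3)] that by auto
    have qB: "q b \<in> B \<longleftrightarrow> b \<in> B" for b using permutes_in_image[OF y(3)] .
    have qA': "q a = a" if "a \<in> A" for a using qA that disj by auto
    have "restrict_id (p \<circ> q) A = p"
      using qA' permutes_not_in[OF y(2)]
      by (auto simp: restrict_id_def fun_eq_iff)
    moreover have "restrict_id (p \<circ> q) B = q"
      using pB qA qB by (auto simp: restrict_id_def fun_eq_iff)
    ultimately show "(restrict_id (case y of (p, q) \<Rightarrow> p \<circ> q) A, restrict_id (case y of (p, q) \<Rightarrow> p \<circ> q) B) = y"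
      using y by simp
    have "p \<circ> q permutes (A \<union> B)"
      using permutes_compose[OF permutes_subset[OF y(3)] permutes_subset[OF y(2)], of "A \<union> B"] by auto
    moreover have "(p \<circ> q) ` A \<subseteq> A" using qA' permutes_in_image[OF y(2)] by auto
    ultimately show "(case y of (p, q) \<Rightarrow> p \<circ> q) \<in> ?R" using y by simp
  qed
  also have "\<dots> = set_det A M * set_det B M"
    unfolding set_det_def by (simp add: sum_product sum.cartesian_product)
  finally show ?thesis .
qed

lemma set_det_det: "set_det {..<h} M = det (mat h h (\<lambda>(i, j). M i j))"
  unfolding set_det_def det_def
  by (auto simp: atLeast0LessThan permutes_in_image intro!: sum.cong prod.cong)

lemma set_det_Gram: "set_det {..<h::nat} (\<lambda>i j. \<Sum>c<h. x i c * x j c) = (set_det {..<h} x)\<^sup>2"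
proof -
  let ?X = "mat h h (\<lambda>(i, j). x i j)"
  have "mat h h (\<lambda>(i, j). \<Sum>c<h. x i c * x j c) = ?X * transpose_mat ?X"
    by (rule eq_matI) (auto simp: scalar_prod_def atLeast0LessThan)
  then have "det (mat h h (\<lambda>(i, j). \<Sum>c<h. x i c * x j c)) = det ?X * det (transpose_mat ?X)"
    using det_mult[of ?X h "transpose_mat ?X"] by simp
  also have "det (transpose_mat ?X) = det ?X" by (rule det_transpose[of _ h]) simp
  finally show ?thesis unfolding set_det_det by (simp add: power2_eq_square)
qed

lemma set_det_rows_permute:
  assumes w: "w permutes {..<h::nat}"
  shows "set_det {..<h::nat} (\<lambda>i j. x (w i) j) = of_int (sign w) * set_det {..<h} x"
proof -
  let ?X = "mat h h (\<lambda>(i, j). x i j)"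
  have "mat h h (\<lambda>(i, j). x (w i) j) = mat h h (\<lambda>(i, j). ?X $$ (w i, j))"
    using permutes_in_image[OF w] by (intro eq_matI) auto
  then show ?thesis unfolding set_det_det
    using det_permute_rows[of ?X h w] w by (simp add: atLeast0LessThan)
qed

lemma set_det_rows_not_inj:
  assumes "\<not> inj_on w {..<h::nat}"
  shows "set_det {..<h::nat} (\<lambda>i j. x (w i) j) = 0"
proof -
  obtain a b where ab: "a < h" "b < h" "a \<noteq> b" "w a = w b" using assms by (auto simp: inj_on_def)
  show ?thesis unfolding set_det_det
    by (rule det_identical_rows[of _ h a b]) (use ab in \<open>auto intro!: eq_vecI\<close>)
qed

lemma set_det_cols_permute:
  assumes u: "u permutes {..<h::nat}"
  shows "(\<Sum>v\<in>{v. v permutes {..<h::nat}}. of_int (sign v) * (\<Prod>i<h. x (v i) (u i))) = of_int (sign u) * set_det {..<h} x"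
proof -
  let ?X = "\<lambda>i j. x j i"
  have "(\<Sum>v\<in>{v. v permutes {..<h}}. of_int (sign v) * (\<Prod>i<h. x (v i) (u i))) = set_det {..<h} (\<lambda>i j. ?X (u i) j)"
    by (simp add: set_det_def)
  also have "\<dots> = of_int (sign u) * set_det {..<h} ?X" by (rule set_det_rows_permute[OF u])
  also have "set_det {..<h} ?X = set_det {..<h} x"
  proof -
    have "mat h h (\<lambda>(i, j). x j i) = transpose_mat (mat h h (\<lambda>(i, j). x i j))" by (rule eq_matI) auto
    then show ?thesis unfolding set_det_det using det_transpose[of "mat h h (\<lambda>(i, j). x i j)" h] by simp
  qed
  finally show ?thesis .
qed

lemma set_det_cols_not_inj:
  assumes "\<not> inj_on u {..<h::nat}"
  shows "(\<Sum>v\<in>{v. v permutes {..<h::nat}}. of_int (sign v) * (\<Prod>i<h. x (v i) (u i))) = (0::real)"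
proof -
  have "(\<Sum>v\<in>{v. v permutes {..<h}}. of_int (sign v) * (\<Prod>i<h. x (v i) (u i))) =
      set_det {..<h} (\<lambda>i j. (\<lambda>i j. x j i) (u i) j)"
    by (simp add: set_det_def)
  then show ?thesis using set_det_rows_not_inj[OF assms] by simp
qed

text \<open>These t are the roots of the monic characteristic polynomial of -x. Adding t to the
  diagonal thus makes a matrix invertible for all but finitely many t.\<close>

lemma finite_set_det_shift_zero: "finite {t. set_det {..<h::nat} (\<lambda>i j. x i j + (if i = j then t else 0)) = 0}"
proof -
  let ?A = "mat h h (\<lambda>(i, j). - x i j)"
  have "set_det {..<h} (\<lambda>i j. x i j + (if i = j then t else 0)) = poly (char_poly ?A) t" for t
    unfolding set_det_det char_poly_matrix[OF mat_carrier]
    by (rule arg_cong[of _ _ det], rule eq_matI) (auto simp: char_matrix_def)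
  then show ?thesis
    using poly_roots_finite[of "char_poly ?A"] degree_monic_char_poly[of ?A h] by (cases "char_poly ?A = 0") auto
qed

section \<open>Gaussian moments\<close>

text \<open>The moments of a standard normal variable: (a - 1)!! for even a, and 0 for odd
  a.\<close>

definition gauss_moment :: "nat \<Rightarrow> real" where
  "gauss_moment a = (if even a then (\<Prod>i<a div 2. 1 + 2 * real i) else 0)"

lemma gauss_moment_rec: "gauss_moment (Suc (Suc a)) = (real a + 1) * gauss_moment a"
  by (auto simp: gauss_moment_def elim!: evenE)

lemma gauss_moment_0_1: "gauss_moment 0 = 1" "gauss_moment (Suc 0) = 0"
  by (simp_all add: gauss_moment_def)

text \<open>A polynomial of degree at most D is determined by its values at 0, ..., D, so by
  Lagrange interpolation its Gaussian expectation is a fixed linear combination of them. All nodes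
  are nonnegative while the first moment is 0, so for D at least 2 some weights are
  negative.\<close>

lemma quadrature_exists: "\<exists>w::nat \<Rightarrow> real. \<forall>a\<le>D. (\<Sum>t\<le>D. w t * real t ^ a) = gauss_moment a"
proof -
  define L where "L t = Polynomial.smult (1 / (\<Prod>s\<in>{..D} - {t}. real t - real s)) (\<Prod>s\<in>{..D} - {t}. [:- real s, 1:])" for t
  have L: "poly (L t) (real s) = (if s = t then 1 else 0)" if "t \<le> D" "s \<le> D" for s t
  proof (cases "s = t")
    case True
    have "(\<Prod>s\<in>{..D} - {t}. real t - real s) \<noteq> 0" by (simp add: prod_zero_iff)
    then show ?thesis using True by (simp add: L_def poly_prod)
  next
    case False
    then have "(\<Prod>r\<in>{..D} - {t}. poly [:- real r, 1:] (real s)) = 0"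
      using that by (intro prod_zero) (auto intro!: bexI[of _ s])
    then show ?thesis using False by (simp add: L_def poly_prod)
  qed
  have degL: "degree (L t) \<le> D" if "t \<le> D" for t
  proof -
    have "degree (\<Prod>s\<in>{..D} - {t}. [:- real s, 1:]) \<le> sum (degree \<circ> (\<lambda>s. [:- real s, 1:])) ({..D} - {t})"
      by (rule degree_prod_sum_le) simp
    also have "\<dots> = D" using that by simp
    finally show ?thesis unfolding L_def by (meson degree_smult_le le_trans)
  qed
  define w where "w t = (\<Sum>k\<le>D. Polynomial.coeff (L t) k * gauss_moment k)" for t
  have "(\<Sum>t\<le>D. w t * real t ^ a) = gauss_moment a" if a: "a \<le> D" for a
  proof -
    define p where "p = (\<Sum>t\<le>D. Polynomial.smult (real t ^ a) (L t)) - Polynomial.monom 1 a"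
    have "poly p (real s) = 0" if "s \<le> D" for s
    proof -
      have "(\<Sum>t\<le>D. real t ^ a * poly (L t) (real s)) = (\<Sum>t\<le>D. real t ^ a * (if s = t then 1 else 0))"
        by (rule sum.cong) (use L that in auto)
      then have "poly p (real s) = (\<Sum>t\<le>D. real t ^ a * (if s = t then 1 else 0)) - real s ^ a"
        unfolding p_def by (simp add: poly_sum poly_monom)
      also have "(\<Sum>t\<le>D. real t ^ a * (if s = t then 1 else 0)) = real s ^ a"
        using that by (simp add: if_distrib cong: if_cong)
      finally show ?thesis by simp
    qed
    then have sub: "real ` {..D} \<subseteq> {x. poly p x = 0}" by auto
    have "degree p \<le> D" unfolding p_def
      using a degL by (intro degree_diff_le degree_sum_le) (auto intro: le_trans[OF degree_smult_le] le_trans[OF degree_monom_le])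
    have "p = 0"
    proof (rule ccontr)
      assume "p \<noteq> 0"
      then have "card (real ` {..D}) \<le> degree p"
        using sub card_mono[OF poly_roots_finite[of p] sub] card_poly_roots_bound[of p] by linarith
      then show False using \<open>degree p \<le> D\<close> by (simp add: card_image)
    qed
    then have c: "(\<Sum>t\<le>D. real t ^ a * Polynomial.coeff (L t) k) = (if a = k then 1 else 0)" for k
      by (simp add: p_def poly_eq_iff coeff_sum)
    have "(\<Sum>t\<le>D. w t * real t ^ a) = (\<Sum>t\<le>D. \<Sum>k\<le>D. gauss_moment k * (real t ^ a * Polynomial.coeff (L t) k))"
      by (simp add: w_def sum_distrib_left mult_ac)
    also have "\<dots> = (\<Sum>k\<le>D. gauss_moment k * (\<Sum>t\<le>D. real t ^ a * Polynomial.coeff (L t) k))"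
      by (subst sum.swap) (simp add: sum_distrib_left)
    also have "\<dots> = gauss_moment a" unfolding c using a by (simp add: if_distrib cong: if_cong)
    finally show ?thesis .
  qed
  then show ?thesis by blast
qed

definition quad_weight :: "nat \<Rightarrow> nat \<Rightarrow> real" where
  "quad_weight D = (SOME w. \<forall>a\<le>D. (\<Sum>t\<le>D. w t * real t ^ a) = gauss_moment a)"

lemma quad_weight: "a \<le> D \<Longrightarrow> (\<Sum>t\<le>D. quad_weight D t * real t ^ a) = gauss_moment a"
  unfolding quad_weight_def using someI_ex[OF quadrature_exists[of D]] by blast

text \<open>Independent standard normal variables indexed by \<open>I\<close>, with each expectation
  replaced by the quadrature; \<open>D\<close> bounds the degree in each variable up to which the
  moments are correct.\<close>

definition expect :: "nat \<Rightarrow> 'i set \<Rightarrow> (('i \<Rightarrow> real) \<Rightarrow> real) \<Rightarrow> real" where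
  "expect D I F = (\<Sum>x\<in>I \<rightarrow>\<^sub>E {..D}. (\<Prod>i\<in>I. quad_weight D (x i)) * F (\<lambda>i. real (x i)))"

lemma expect_sum: "expect D I (\<lambda>x. \<Sum>j\<in>J. F j x) = (\<Sum>j\<in>J. expect D I (F j))"
  unfolding expect_def by (simp add: sum_distrib_left) (rule sum.swap)

lemma expect_cmult: "expect D I (\<lambda>x. c * F x) = c * expect D I F"
  unfolding expect_def by (simp add: sum_distrib_left mult_ac)

lemma expect_monomial:
  assumes I: "finite I" and V: "finite V" "card V \<le> D" and e: "e ` V \<subseteq> I"
  shows "expect D I (\<lambda>x. \<Prod>v\<in>V. x (e v)) = (\<Prod>i\<in>I. gauss_moment (card {v\<in>V. e v = i}))"
proof -
  have *: "(\<Prod>v\<in>V. y (e v)) = (\<Prod>i\<in>I. y i ^ card {v\<in>V. e v = i})" for y :: "_ \<Rightarrow> real"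
  proof -
    have "(\<Prod>v\<in>V. y (e v)) = (\<Prod>i\<in>I. \<Prod>v\<in>{v\<in>V. e v = i}. y (e v))"
      by (rule prod.group[symmetric]) (use I V e in auto)
    also have "\<dots> = (\<Prod>i\<in>I. y i ^ card {v\<in>V. e v = i})" by (intro prod.cong refl) simp
    finally show ?thesis .
  qed
  have "expect D I (\<lambda>x. \<Prod>v\<in>V. x (e v)) =
      (\<Sum>x\<in>I \<rightarrow>\<^sub>E {..D}. \<Prod>i\<in>I. quad_weight D (x i) * real (x i) ^ card {v\<in>V. e v = i})"
    unfolding expect_def by (simp add: prod.distrib *[of "\<lambda>i. real (x i)" for x])
  also have "\<dots> = (\<Prod>i\<in>I. \<Sum>t\<le>D. quad_weight D t * real t ^ card {v\<in>V. e v = i})"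
    using prod_sum_PiE[of I "\<lambda>_. {..D}" "\<lambda>i t. quad_weight D t * real t ^ card {v\<in>V. e v = i}"] I by simp
  also have "\<dots> = (\<Prod>i\<in>I. gauss_moment (card {v\<in>V. e v = i}))"
  proof (rule prod.cong[OF refl])
    fix i
    have "card {v\<in>V. e v = i} \<le> card V" by (rule card_mono) (use V in auto)
    then show "(\<Sum>t\<le>D. quad_weight D t * real t ^ card {v\<in>V. e v = i}) = gauss_moment (card {v\<in>V. e v = i})"
      using V(2) by (intro quad_weight) simp
  qed
  finally show ?thesis .
qed

lemma card_matchings_of_rec:
  assumes "finite V" "a \<in> V"
  shows "real (card (matchings_of V e)) = (\<Sum>b\<in>{b\<in>V - {a}. e b = e a}. real (card (matchings_of (V - {a, b}) e)))"
proof -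
  have "real (card (matchings_of V e)) = (\<Sum>S\<in>matchings_of V e. 1)" by simp
  also have "\<dots> = (\<Sum>b\<in>{b\<in>V - {a}. e b = e a}. real (card (matchings_of (V - {a, b}) e)))"
    unfolding sum_matchings_of[OF assms] by simp
  finally show ?thesis .
qed

text \<open>Wick's formula. Both sides obey the same recursion: E x^(a+2) = (a + 1) E x^a on one
  side, the choice of a partner for a fixed label on the other.\<close>

lemma expect_matchings:
  assumes I: "finite I" and V: "finite V" "card V \<le> D" and e: "e ` V \<subseteq> I"
  shows "expect D I (\<lambda>x. \<Prod>v\<in>V. x (e v)) = real (card (matchings_of V e))"
  using V e
proof (induction "card V" arbitrary: V rule: less_induct)
  case less
  show ?case
  proof (cases "V = {}")
    case True
    then show ?thesis using expect_monomial[OF I, of "{}" D e] by (simp add: matchings_of_def gauss_moment_0_1)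
  next
    case False
    then obtain a where a: "a \<in> V" by auto
    let ?B = "{b\<in>V - {a}. e b = e a}" and ?i = "e a"
    let ?m = "\<lambda>V i. gauss_moment (card {v\<in>V. e v = i})"
    have i: "?i \<in> I" using a less.prems(3) by auto
    have cB: "card {v\<in>V. e v = ?i} = Suc (card ?B)"
    proof -
      have "{v\<in>V. e v = ?i} = insert a ?B" using a by auto
      then show ?thesis using less.prems(1) by simp
    qed
    have step: "real (card (matchings_of (V - {a, b}) e)) = gauss_moment (card ?B - 1) * (\<Prod>j\<in>I - {?i}. ?m V j)"
      if b: "b \<in> ?B" for b
    proof -
      have c: "card V = Suc (Suc (card (V - {a, b})))"
        using card_delete_pair[of V a b] less.prems(1) a b by auto
      have "e ` (V - {a, b}) \<subseteq> I" using less.prems(3) by auto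
      then have "real (card (matchings_of (V - {a, b}) e)) = (\<Prod>j\<in>I. ?m (V - {a, b}) j)"
        using less.hyps[of "V - {a, b}"] expect_monomial[OF I, of "V - {a, b}" D e] c less.prems by auto
      also have "\<dots> = ?m (V - {a, b}) ?i * (\<Prod>j\<in>I - {?i}. ?m (V - {a, b}) j)"
        using I i by (rule prod.remove)
      also have "{v\<in>V - {a, b}. e v = ?i} = ?B - {b}" by auto
      also have "card (?B - {b}) = card ?B - 1" using b less.prems(1) by simp
      also have "(\<Prod>j\<in>I - {?i}. ?m (V - {a, b}) j) = (\<Prod>j\<in>I - {?i}. ?m V j)"
      proof (rule prod.cong[OF refl])
        fix j assume "j \<in> I - {?i}"
        then have "{v\<in>V - {a, b}. e v = j} = {v\<in>V. e v = j}" using b by auto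
        then show "?m (V - {a, b}) j = ?m V j" by simp
      qed
      finally show ?thesis .
    qed
    have "real (card (matchings_of V e)) = (\<Sum>b\<in>?B. gauss_moment (card ?B - 1) * (\<Prod>j\<in>I - {?i}. ?m V j))"
      unfolding card_matchings_of_rec[OF less.prems(1) a] using step by (rule sum.cong[OF refl])
    also have "\<dots> = (real (card ?B) * gauss_moment (card ?B - 1)) * (\<Prod>j\<in>I - {?i}. ?m V j)" by simp
    also have "real (card ?B) * gauss_moment (card ?B - 1) = gauss_moment (Suc (card ?B))"
      by (cases "card ?B") (simp_all add: gauss_moment_rec gauss_moment_0_1)
    also have "\<dots> * (\<Prod>j\<in>I - {?i}. ?m V j) = (\<Prod>j\<in>I. ?m V j)"
      unfolding cB[symmetric] using I i by (rule prod.remove[symmetric])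
    also have "\<dots> = expect D I (\<lambda>x. \<Prod>v\<in>V. x (e v))"
      by (rule expect_monomial[OF I less.prems, symmetric])
    finally show ?thesis ..
  qed
qed

text \<open>Wick's rule for a product of distinct variables times a monomial.\<close>

lemma card_matchings_of_wick:
  assumes R: "finite R" and V: "finite V" and disj: "R \<inter> V = {}" and inj: "inj_on e R"
  shows "real (card (matchings_of (R \<union> V) e)) =
    (\<Sum>j\<in>(\<Pi>\<^sub>E r\<in>R. {v\<in>V. e v = e r}). real (card (matchings_of (V - j ` R) e)))"
  using R V disj inj
proof (induction R arbitrary: V rule: finite_induct)
  case empty
  then show ?case by simp
next
  case (insert r R)
  have fin: "finite (insert r R \<union> V)" and rin: "r \<in> insert r R \<union> V" using insert by auto
  \<comment> \<open>The variables of \<open>R\<close> are distinct, so \<open>r\<close> can only be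
    paired with a factor of the monomial.\<close>
  have "{b \<in> (insert r R \<union> V) - {r}. e b = e r} = {v\<in>V. e v = e r}"
    using insert.hyps(2) insert.prems(2,3) by (auto simp: inj_on_def)
  then have "real (card (matchings_of (insert r R \<union> V) e)) =
      (\<Sum>b\<in>{v\<in>V. e v = e r}. real (card (matchings_of ((insert r R \<union> V) - {r, b}) e)))"
    using card_matchings_of_rec[OF fin rin, of e] by simp
  also have "\<dots> = (\<Sum>b\<in>{v\<in>V. e v = e r}. \<Sum>j\<in>(\<Pi>\<^sub>E r\<in>R. {v\<in>V. e v = e r}). real (card (matchings_of (V - insert b (j ` R)) e)))"
  proof (rule sum.cong[OF refl])
    fix b assume b: "b \<in> {v\<in>V. e v = e r}"
    have "(insert r R \<union> V) - {r, b} = R \<union> (V - {b})" using insert b by auto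
    moreover have "(\<Pi>\<^sub>E r\<in>R. {v\<in>V - {b}. e v = e r}) = (\<Pi>\<^sub>E r\<in>R. {v\<in>V. e v = e r})"
    proof (rule PiE_cong)
      fix s assume "s \<in> R"
      then have "e s \<noteq> e r" using insert.hyps(2) insert.prems(3) by (auto simp: inj_on_def)
      then show "{v\<in>V - {b}. e v = e s} = {v\<in>V. e v = e s}" using b by auto
    qed
    moreover have "V - {b} - X = V - insert b X" for X by auto
    ultimately show "real (card (matchings_of ((insert r R \<union> V) - {r, b}) e)) =
        (\<Sum>j\<in>(\<Pi>\<^sub>E r\<in>R. {v\<in>V. e v = e r}). real (card (matchings_of (V - insert b (j ` R)) e)))"
      using insert.IH[of "V - {b}"] insert.prems by (simp add: inj_on_def) blast
  qed
  also have "\<dots> = (\<Sum>(b, j)\<in>{v\<in>V. e v = e r} \<times> (\<Pi>\<^sub>E r\<in>R. {v\<in>V. e v = e r}). real (card (matchings_of (V - insert b (j ` R)) e)))"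
    by (rule sum.cartesian_product)
  also have "\<dots> = (\<Sum>j\<in>(\<Pi>\<^sub>E r\<in>insert r R. {v\<in>V. e v = e r}). real (card (matchings_of (V - j ` insert r R) e)))"
  proof -
    have upd: "(j(r := b)) ` R = j ` R" for j b using insert.hyps(2) by (auto intro!: image_cong)
    show ?thesis unfolding PiE_insert_eq
      by (subst sum.reindex[OF inj_combinator[OF insert.hyps(2)]]) (intro sum.cong refl, clarify, simp only: comp_def prod.case image_insert fun_upd_same upd)
  qed
  finally show ?case .
qed

section \<open>The Cayley identity\<close>

definition commuting :: "nat set \<Rightarrow> (nat \<Rightarrow> nat set) \<Rightarrow> (nat \<Rightarrow> nat) \<Rightarrow> (nat \<Rightarrow> nat) set" where
  "commuting A S v = {J \<in> Pi\<^sub>E A S. \<forall>i\<in>A. J (v i) = J i}"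

text \<open>Either \<open>a\<close> is a new fixed point and its value is free in
  \<open>S a\<close>, or it joins the cycle of \<open>b\<close> and must take the value at
  \<open>b\<close>, which \<open>S a\<close> contains because it is the largest of the sets.\<close>

lemma card_commuting_insert:
  assumes A: "finite A" and a: "a \<notin> A" and S: "\<And>i. i \<in> A \<Longrightarrow> S i \<subseteq> S a"
    and q: "q permutes A" and b: "b \<in> insert a A"
  shows "card (commuting (insert a A) S (transpose a b \<circ> q)) =
    (if b = a then card (S a) else 1) * card (commuting A S q)"
proof (cases "b = a")
  case True
  have qa: "q a = a" using permutes_not_in[OF q a] .
  have qA: "q i \<in> A" if "i \<in> A" for i using permutes_in_image[OF q] that by simp
  have "bij_betw (\<lambda>(y, J). J(a := y)) (S a \<times> commuting A S q) (commuting (insert a A) S q)"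
  proof (rule bij_betw_imageI)
    show "inj_on (\<lambda>(y, J). J(a := y)) (S a \<times> commuting A S q)"
      by (rule inj_on_subset[OF inj_combinator[OF a]]) (auto simp: commuting_def)
    have 1: "(\<forall>i\<in>insert a A. (J(a := y)) (q i) = (J(a := y)) i) \<longleftrightarrow> (\<forall>i\<in>A. J (q i) = J i)" for J :: "nat \<Rightarrow> nat" and y
      using qa qA a by (auto simp: fun_upd_def)
    show "(\<lambda>(y, J). J(a := y)) ` (S a \<times> commuting A S q) = commuting (insert a A) S q"
    proof safe
      fix y J assume "y \<in> S a" "J \<in> commuting A S q"
      then show "J(a := y) \<in> commuting (insert a A) S q"
        unfolding commuting_def using 1[of J y] by (auto simp: PiE_insert_eq)
    next
      fix J assume J: "J \<in> commuting (insert a A) S q"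
      then obtain y J' where yJ: "y \<in> S a" "J' \<in> Pi\<^sub>E A S" "J = J'(a := y)"
        unfolding commuting_def PiE_insert_eq by auto
      then have "J' \<in> commuting A S q" using J 1[of J' y] unfolding commuting_def by auto
      then show "J \<in> (\<lambda>(y, J). J(a := y)) ` (S a \<times> commuting A S q)" using yJ by auto
    qed
  qed
  from bij_betw_same_card[OF this] show ?thesis
    using True by (simp add: card_cartesian_product)
next
  case False
  then have bA: "b \<in> A" using b by auto
  let ?v = "transpose a b \<circ> q"
  have qA: "q i \<in> A" if "i \<in> A" for i using permutes_in_image[OF q] that by simp
  have va: "?v a = b" using permutes_not_in[OF q a] by simp
  have vi: "?v i = (if q i = b then a else q i)" if "i \<in> A" for i
    using qA[OF that] a by (auto simp: transpose_def)
  have iff: "(\<forall>i\<in>insert a A. J (?v i) = J i) \<longleftrightarrow> J a = J b \<and> (\<forall>i\<in>A. J (q i) = J i)" for J :: "nat \<Rightarrow> nat"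
  proof
    assume *: "\<forall>i\<in>insert a A. J (?v i) = J i"
    have ab: "J a = J b" using *[rule_format, of a] va by simp
    have "J (q i) = J i" if "i \<in> A" for i
      using *[rule_format, of i] vi[OF that] that ab by (cases "q i = b") auto
    then show "J a = J b \<and> (\<forall>i\<in>A. J (q i) = J i)" using ab by blast
  next
    assume *: "J a = J b \<and> (\<forall>i\<in>A. J (q i) = J i)"
    show "\<forall>i\<in>insert a A. J (?v i) = J i"
    proof
      fix i assume "i \<in> insert a A"
      then consider "i = a" | "i \<in> A" by auto
      then show "J (?v i) = J i"
      proof cases
        case 1 then show ?thesis using va * by simp
      next
        case 2 then show ?thesis using vi[OF 2] *  by (metis)
      qed
    qed
  qed
  have "bij_betw (\<lambda>J. J(a := J b)) (commuting A S q) (commuting (insert a A) S ?v)"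
  proof (rule bij_betw_byWitness[where f' = "\<lambda>J. J(a := undefined)"])
    show "\<forall>J\<in>commuting A S q. (J(a := J b))(a := undefined) = J"
      using a by (auto simp: commuting_def PiE_def extensional_def fun_eq_iff)
    show "\<forall>J\<in>commuting (insert a A) S ?v. (J(a := undefined))(a := (J(a := undefined)) b) = J"
    proof
      fix J assume "J \<in> commuting (insert a A) S ?v"
      then have "J a = J b" using iff[of J] by (simp add: commuting_def)
      then show "(J(a := undefined))(a := (J(a := undefined)) b) = J" using False by (auto simp: fun_eq_iff)
    qed
    show "(\<lambda>J. J(a := J b)) ` commuting A S q \<subseteq> commuting (insert a A) S ?v"
    proof (rule image_subsetI)
      fix J assume J: "J \<in> commuting A S q"
      then have "J b \<in> S a" using bA S[OF bA] by (auto simp: commuting_def)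
      moreover have "\<forall>i\<in>A. (J(a := J b)) (q i) = (J(a := J b)) i"
      proof
        fix i assume i: "i \<in> A"
        then have "q i \<noteq> a" "i \<noteq> a" using qA a by auto
        then show "(J(a := J b)) (q i) = (J(a := J b)) i" using J i by (simp add: commuting_def)
      qed
      ultimately show "J(a := J b) \<in> commuting (insert a A) S ?v"
        unfolding commuting_def mem_Collect_eq iff using J False
        by (auto simp: PiE_insert_eq commuting_def)
    qed
    show "(\<lambda>J. J(a := undefined)) ` commuting (insert a A) S ?v \<subseteq> commuting A S q"
    proof (rule image_subsetI)
      fix J assume J: "J \<in> commuting (insert a A) S ?v"
      then have "\<forall>i\<in>A. J (q i) = J i" "J \<in> Pi\<^sub>E (insert a A) S"
        using iff[of J] by (simp_all add: commuting_def)
      moreover have "\<forall>i\<in>A. (J(a := undefined)) (q i) = (J(a := undefined)) i"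
      proof
        fix i assume i: "i \<in> A"
        then have "q i \<noteq> a" "i \<noteq> a" using qA a by auto
        then show "(J(a := undefined)) (q i) = (J(a := undefined)) i" using calculation i by simp
      qed
      ultimately show "J(a := undefined) \<in> commuting A S q"
        using a by (auto simp: commuting_def PiE_def extensional_def)
    qed
  qed
  from bij_betw_same_card[OF this] show ?thesis using False by simp
qed

lemma sum_card_commuting_insert:
  assumes A: "finite A" and a: "a \<notin> A" and S: "\<And>i. i \<in> A \<Longrightarrow> S i \<subseteq> S a"
  shows "(\<Sum>v\<in>{v. v permutes insert a A}. card (commuting (insert a A) S v)) =
    (card (S a) + card A) * (\<Sum>q\<in>{q. q permutes A}. card (commuting A S q))"
proof -
  let ?C = "\<Sum>q\<in>{q. q permutes A}. card (commuting A S q)"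
  have "(\<Sum>v\<in>{v. v permutes insert a A}. card (commuting (insert a A) S v)) =
      (\<Sum>b\<in>insert a A. \<Sum>q\<in>{q. q permutes A}. card (commuting (insert a A) S (transpose a b \<circ> q)))"
    by (rule sum_over_permutations_insert[OF A a])
  also have "\<dots> = (\<Sum>b\<in>insert a A. \<Sum>q\<in>{q. q permutes A}. (if b = a then card (S a) else 1) * card (commuting A S q))"
    by (rule sum.cong[OF refl], rule sum.cong[OF refl], rule card_commuting_insert) (use A a S in auto)
  also have "\<dots> = (\<Sum>b\<in>insert a A. (if b = a then card (S a) else 1) * ?C)"
    by (simp add: sum_distrib_left)
  also have "\<dots> = card (S a) * ?C + (\<Sum>b\<in>A. (if b = a then card (S a) else 1) * ?C)"
    using A a by simp
  also have "(\<Sum>b\<in>A. (if b = a then card (S a) else 1) * ?C) = (\<Sum>b\<in>A. ?C)"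
    by (rule sum.cong) (use a in auto)
  finally show ?thesis by (simp add: add_mult_distrib)
qed

text \<open>Indices are inserted from the largest to the smallest, so each new one brings the
  largest set so far. At index i there are l - 1 - i indices already present, next to which it can
  be placed in a cycle.\<close>

lemma sum_card_commuting:
  assumes S: "\<And>i j. i \<le> j \<Longrightarrow> S j \<subseteq> S i"
  shows "(\<Sum>v\<in>{v. v permutes {..<l}}. card (commuting {..<l} S v)) = (\<Prod>i<l. card (S i) + (l - 1 - i))"
proof -
  have "n \<le> l \<Longrightarrow> (\<Sum>v\<in>{v. v permutes {l - n..<l}}. card (commuting {l - n..<l} S v)) =
      (\<Prod>i\<in>{l - n..<l}. card (S i) + (l - 1 - i))" for n
  proof (induction n)
    case 0
    have "commuting {} S q = {\<lambda>_. undefined}" for q by (auto simp: commuting_def)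
    then show ?case by simp
  next
    case (Suc n)
    let ?a = "l - Suc n"
    have ins: "{?a..<l} = insert ?a {l - n..<l}" using Suc.prems by auto
    have "(\<Sum>v\<in>{v. v permutes {?a..<l}}. card (commuting {?a..<l} S v)) =
       (card (S ?a) + card {l - n..<l}) * (\<Sum>v\<in>{v. v permutes {l - n..<l}}. card (commuting {l - n..<l} S v))"
      unfolding ins
    proof (rule sum_card_commuting_insert)
      show "S i \<subseteq> S ?a" if "i \<in> {l - n..<l}" for i by (rule S) (use that in auto)
    qed (use Suc.prems in auto)
    also have "\<dots> = (card (S ?a) + (l - 1 - ?a)) * (\<Prod>i\<in>{l - n..<l}. card (S i) + (l - 1 - i))"
      using Suc by simp
    also have "\<dots> = (\<Prod>i\<in>{?a..<l}. card (S i) + (l - 1 - i))"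
      unfolding ins by (subst prod.insert) (use Suc.prems in auto)
    finally show ?case .
  qed
  from this[of l] show ?thesis by (simp add: atLeast0LessThan)
qed

text \<open>A permutation that preserves the classes of \<open>J\<close> is the product of its
  restrictions to them, and the sign is multiplicative.\<close>

lemma sign_restrict_blocks:
  assumes v: "v permutes A" and A: "finite A" and J: "\<forall>i\<in>A. J (v i) = J i" and K: "finite K"
  shows "restrict_id v {i\<in>A. J i \<in> K} permutes {i\<in>A. J i \<in> K} \<and>
    sign (restrict_id v {i\<in>A. J i \<in> K}) = (\<Prod>k\<in>K. sign (restrict_id v {i\<in>A. J i = k}))"
  using K
proof (induction K)
  case empty
  have "restrict_id v {} = id" by (auto simp: restrict_id_def)
  then show ?case by (simp add: id_def)
next
  case (insert k K)
  let ?X = "{i\<in>A. J i = k}" and ?Y = "{i\<in>A. J i \<in> K}"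
  have vX: "v ` ?X \<subseteq> ?X" and vY: "v ` {i\<in>A. J i \<in> insert k K} \<subseteq> {i\<in>A. J i \<in> insert k K}"
    using J permutes_in_image[OF v] by auto
  have fin: "finite ?X" "finite {i\<in>A. J i \<in> insert k K}" using A by auto
  have un: "{i\<in>A. J i \<in> insert k K} = ?X \<union> ?Y" by auto
  have disj: "?X \<inter> ?Y = {}" using insert.hyps by auto
  let ?r = "restrict_id v (?X \<union> ?Y)"
  have r: "?r permutes (?X \<union> ?Y)"
    unfolding un[symmetric]
    by (rule permutes_restrict_id)
      (use endo_inj_surj[OF fin(2) vY] inj_on_subset[OF permutes_inj[OF v]] in \<open>auto simp: bij_betw_def\<close>)
  have rX: "?r ` ?X \<subseteq> ?X" using vX by (auto simp: restrict_id_def)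
  have eqs: "restrict_id ?r ?X = restrict_id v ?X" "restrict_id ?r ?Y = restrict_id v ?Y"
    by (auto simp: restrict_id_def)
  note s = permutes_split_union[OF r fin(1) disj rX, unfolded eqs]
  have "sign ?r = sign (restrict_id v ?X) * sign (restrict_id v ?Y)"
    by (subst s(3)[symmetric], rule sign_compose)
      (use s A in \<open>auto intro: permutes_imp_permutation[of ?X] permutes_imp_permutation[of ?Y]\<close>)
  then show ?case using insert r unfolding un by simp
qed

lemma sign_blocks:
  assumes v: "v permutes A" and A: "finite A" and J: "\<forall>i\<in>A. J (v i) = J i" and K: "finite K" "J ` A \<subseteq> K"
  shows "(\<Prod>k\<in>K. sign (restrict_id v {i\<in>A. J i = k})) = sign v"
proof -
  have "{i\<in>A. J i \<in> K} = A" using K(2) by auto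
  moreover have "restrict_id v A = v" using permutes_not_in[OF v] by (auto simp: restrict_id_def)
  ultimately show ?thesis using sign_restrict_blocks[OF v A J K(1)] by simp
qed

section \<open>Products of leading minors with replaced rows\<close>

text \<open>\<open>K\<close> indexes minors, not columns of a diagram: a column occurs twice because
  its minor is squared. \<open>H k\<close> is the size of the minor \<open>k\<close>, and
  \<open>l\<close> the size of the determinant by which the product is multiplied.\<close>

locale half_columns =
  fixes K :: "nat set" and H :: "nat \<Rightarrow> nat" and l :: nat
  assumes finK: "finite K" and Hl: "\<And>k. k \<in> K \<Longrightarrow> H k \<le> l"
begin

definition rowset :: "nat \<Rightarrow> nat set" where
  "rowset i = {k\<in>K. i < H k}"

definition perms :: "(nat \<Rightarrow> nat \<Rightarrow> nat) set" where
  "perms = (\<Pi>\<^sub>E k\<in>K. {p. p permutes {..<H k}})"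

definition sgns :: "(nat \<Rightarrow> nat \<Rightarrow> nat) \<Rightarrow> real" where
  "sgns P = (\<Prod>k\<in>K. of_int (sign (P k)))"

definition cells :: "(nat \<times> nat) set" where
  "cells = Sigma K (\<lambda>k. {..<H k})"

text \<open>The i-th row of the minor \<open>J i\<close> is replaced by the i-th row of
  \<open>z\<close>. With unit vectors as rows this is one term of the product rule when the minors
  are differentiated by the variables x(i, u i).\<close>

definition mixed_det :: "(nat \<Rightarrow> nat) \<Rightarrow> (nat \<Rightarrow> nat \<Rightarrow> real) \<Rightarrow> (nat \<Rightarrow> nat \<Rightarrow> real) \<Rightarrow> real" where
  "mixed_det J x z = (\<Prod>k\<in>K. set_det {..<H k} (\<lambda>i c. if J i = k then z i c else x i c))"

lemma finite_cells [simp]: "finite cells"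
  using finK by (simp add: cells_def)

lemma finite_perms [simp]: "finite perms"
  unfolding perms_def using finK by (auto intro!: finite_PiE finite_permutations)

lemma perms_less: "P \<in> perms \<Longrightarrow> k \<in> K \<Longrightarrow> i < H k \<Longrightarrow> P k i < H k"
  unfolding perms_def using permutes_in_image[of "P k" "{..<H k}" i] by auto

lemma prod_set_det_expand:
  "(\<Prod>k\<in>K. set_det {..<H k} (M k)) = (\<Sum>P\<in>perms. sgns P * (\<Prod>(k, i)\<in>cells. M k i (P k i)))"
proof -
  have "(\<Prod>k\<in>K. set_det {..<H k} (M k)) =
      (\<Sum>P\<in>perms. \<Prod>k\<in>K. of_int (sign (P k)) * (\<Prod>i<H k. M k i (P k i)))"
    unfolding set_det_def perms_def using finK
    by (subst prod_sum_PiE) (auto intro: finite_permutations)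
  also have "\<dots> = (\<Sum>P\<in>perms. sgns P * (\<Prod>k\<in>K. \<Prod>i<H k. M k i (P k i)))"
    by (simp add: prod.distrib sgns_def)
  also have "\<dots> = (\<Sum>P\<in>perms. sgns P * (\<Prod>(k, i)\<in>cells. M k i (P k i)))"
    unfolding cells_def using finK by (subst prod.Sigma) auto
  finally show ?thesis .
qed

lemma mixed_det_expand:
  assumes J: "J \<in> Pi\<^sub>E {..<l} rowset"
  shows "mixed_det J x z = (\<Sum>P\<in>perms. sgns P * ((\<Prod>i<l. z i (P (J i) i)) *
    (\<Prod>(k, i)\<in>cells - (\<lambda>i. (J i, i)) ` {..<l}. x i (P k i))))"
proof -
  let ?D = "(\<lambda>i. (J i, i)) ` {..<l}"
  have D: "?D \<subseteq> cells" using J by (auto simp: cells_def rowset_def PiE_def Pi_def)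
  have "mixed_det J x z = (\<Sum>P\<in>perms. sgns P * (\<Prod>(k, i)\<in>cells. if J i = k then z i (P k i) else x i (P k i)))"
    unfolding mixed_det_def by (rule prod_set_det_expand)
  also have "\<dots> = (\<Sum>P\<in>perms. sgns P * ((\<Prod>i<l. z i (P (J i) i)) *
    (\<Prod>(k, i)\<in>cells - ?D. x i (P k i))))"
  proof (rule sum.cong[OF refl], rule arg_cong2[of _ _ _ _ "(*)"], rule refl)
    fix P assume "P \<in> perms"
    let ?f = "\<lambda>(k, i). if J i = k then z i (P k i) else x i (P k i)"
    have "prod ?f cells = prod ?f (cells - ?D) * prod ?f ?D"
      by (rule prod.subset_diff[OF D]) simp
    also have "prod ?f (cells - ?D) = (\<Prod>(k, i)\<in>cells - ?D. x i (P k i))"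
    proof (rule prod.cong[OF refl], clarify)
      fix k i assume "(k, i) \<in> cells" "(k, i) \<notin> ?D"
      then have "i < l" using Hl[of k] by (auto simp: cells_def)
      then have "J i \<noteq> k" using \<open>(k, i) \<notin> ?D\<close> by auto
      then show "(if J i = k then z i (P k i) else x i (P k i)) = x i (P k i)" by simp
    qed
    also have "prod ?f ?D = (\<Prod>i<l. z i (P (J i) i))"
      by (subst prod.reindex) (auto simp: inj_on_def)
    finally show "prod ?f cells = (\<Prod>i<l. z i (P (J i) i)) * (\<Prod>(k, i)\<in>cells - ?D. x i (P k i))"
      by (simp add: mult.commute)
  qed
  finally show ?thesis .
qed

definition unit_rows :: "(nat \<Rightarrow> nat) \<Rightarrow> nat \<Rightarrow> nat \<Rightarrow> real" where
  "unit_rows u i c = (if c = u i then 1 else 0)"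

text \<open>Each replaced row enters linearly and can be expanded in unit vectors.\<close>

lemma mixed_det_multilinear:
  assumes J: "J \<in> Pi\<^sub>E {..<l} rowset"
  shows "(\<Sum>u\<in>{..<l} \<rightarrow>\<^sub>E {..<l}. (\<Prod>i<l. z i (u i)) * mixed_det J x (unit_rows u)) = mixed_det J x z"
proof -
  let ?R = "\<lambda>P. \<Prod>(k, i)\<in>cells - (\<lambda>i. (J i, i)) ` {..<l}. x i (P k i)"
  have key: "(\<Sum>u\<in>{..<l} \<rightarrow>\<^sub>E {..<l}. (\<Prod>i<l. z i (u i)) * (\<Prod>i<l. unit_rows u i (P (J i) i))) = (\<Prod>i<l. z i (P (J i) i))"
    if P: "P \<in> perms" for P
  proof -
    have "(\<Sum>u\<in>{..<l} \<rightarrow>\<^sub>E {..<l}. (\<Prod>i<l. z i (u i)) * (\<Prod>i<l. unit_rows u i (P (J i) i))) =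
        (\<Sum>u\<in>{..<l} \<rightarrow>\<^sub>E {..<l}. \<Prod>i<l. z i (u i) * (if P (J i) i = u i then 1 else 0))"
      by (simp add: prod.distrib unit_rows_def)
    also have "\<dots> = (\<Prod>i<l. \<Sum>c<l. z i c * (if P (J i) i = c then 1 else 0))"
      by (rule prod_sum_PiE[symmetric]) auto
    also have "\<dots> = (\<Prod>i<l. z i (P (J i) i))"
    proof (rule prod.cong[OF refl])
      fix i assume i: "i \<in> {..<l}"
      then have "J i \<in> K" "i < H (J i)" using J by (auto simp: rowset_def PiE_def Pi_def)
      then have "P (J i) i < l" using perms_less[OF P, of "J i" i] Hl[of "J i"] by simp
      then show "(\<Sum>c<l. z i c * (if P (J i) i = c then 1 else 0)) = z i (P (J i) i)"
        by (simp add: if_distrib cong: if_cong)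
    qed
    finally show ?thesis .
  qed
  have "(\<Sum>u\<in>{..<l} \<rightarrow>\<^sub>E {..<l}. (\<Prod>i<l. z i (u i)) * mixed_det J x (unit_rows u)) =
    (\<Sum>u\<in>{..<l} \<rightarrow>\<^sub>E {..<l}. \<Sum>P\<in>perms. sgns P * ?R P * ((\<Prod>i<l. z i (u i)) * (\<Prod>i<l. unit_rows u i (P (J i) i))))"
    unfolding mixed_det_expand[OF J] by (simp add: sum_distrib_left mult_ac)
  also have "\<dots> = (\<Sum>P\<in>perms. sgns P * ?R P *
      (\<Sum>u\<in>{..<l} \<rightarrow>\<^sub>E {..<l}. (\<Prod>i<l. z i (u i)) * (\<Prod>i<l. unit_rows u i (P (J i) i))))"
    by (subst sum.swap) (simp add: sum_distrib_left)
  also have "\<dots> = mixed_det J x z" unfolding mixed_det_expand[OF J] using key by (simp add: mult_ac)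
  finally show ?thesis .
qed

lemma mixed_det_cong: "(\<And>i c. i < l \<Longrightarrow> z i c = z' i c) \<Longrightarrow> mixed_det J x z = mixed_det J x z'"
  unfolding mixed_det_def by (intro prod.cong refl set_det_cong) (auto dest: Hl)

text \<open>The determinant times the sign of u is a signed sum over v of products of x(v i, u i),
  and this sum vanishes when u is not injective. So u may run over all functions, and multilinearity
  puts row v i of x in place of the i-th replaced row.\<close>

lemma det_times_mixed_det:
  assumes J: "J \<in> Pi\<^sub>E {..<l} rowset"
  shows "set_det {..<l} x * (\<Sum>u\<in>{u. u permutes {..<l}}. of_int (sign u) * mixed_det J x (unit_rows u)) =
    (\<Sum>v\<in>{v. v permutes {..<l}}. of_int (sign v) * mixed_det J x (\<lambda>i c. x (v i) c))"
proof -
  let ?Q = "{v. v permutes {..<l}}" and ?U = "{..<l} \<rightarrow>\<^sub>E {..<l}"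
  let ?f = "\<lambda>u. (\<Sum>v\<in>?Q. of_int (sign v) * (\<Prod>i<l. x (v i) (u i))) * mixed_det J x (unit_rows u)"
  have "set_det {..<l} x * (\<Sum>u\<in>?Q. of_int (sign u) * mixed_det J x (unit_rows u)) = (\<Sum>u\<in>?Q. ?f u)"
    by (simp add: set_det_cols_permute sum_distrib_left mult_ac)
  also have "\<dots> = (\<Sum>u\<in>{u\<in>?U. inj_on u {..<l}}. ?f u)"
  proof (rule sum.reindex_bij_witness[where i = "\<lambda>u i. if i < l then u i else i" and j = "\<lambda>u. restrict u {..<l}"])
    fix u assume "u \<in> ?Q"
    then have u: "u permutes {..<l}" by simp
    show "(\<lambda>i. if i < l then restrict u {..<l} i else i) = u" using permutes_not_in[OF u] by auto
    show "restrict u {..<l} \<in> {u\<in>?U. inj_on u {..<l}}"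
      using permutes_in_image[OF u] injD[OF permutes_inj[OF u]] by (auto intro!: inj_onI)
    have "mixed_det J x (unit_rows (restrict u {..<l})) = mixed_det J x (unit_rows u)" by (rule mixed_det_cong) (simp add: unit_rows_def)
    then show "?f (restrict u {..<l}) = ?f u" by simp
  next
    fix u assume u: "u \<in> {u\<in>?U. inj_on u {..<l}}"
    then show "restrict (\<lambda>i. if i < l then u i else i) {..<l} = u"
      by (auto simp: fun_eq_iff PiE_def extensional_def)
    have im: "u ` {..<l} = {..<l}" by (rule endo_inj_surj) (use u in auto)
    have "bij_betw (\<lambda>i. if i < l then u i else i) {..<l} {..<l}"
      using u im by (subst bij_betw_cong[of _ _ u]) (auto simp: bij_betw_def)
    then have "(\<lambda>i. if i < l then u i else i) permutes {..<l}" by (rule bij_imp_permutes) simp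
    then show "(\<lambda>i. if i < l then u i else i) \<in> ?Q" by simp
  qed
  also have "\<dots> = (\<Sum>u\<in>?U. ?f u)"
    by (rule sum.mono_neutral_left) (auto simp: set_det_cols_not_inj intro: finite_PiE)
  also have "\<dots> = (\<Sum>u\<in>?U. \<Sum>v\<in>?Q. of_int (sign v) * ((\<Prod>i<l. x (v i) (u i)) * mixed_det J x (unit_rows u)))"
    by (simp add: sum_distrib_left mult_ac)
  also have "\<dots> = (\<Sum>v\<in>?Q. of_int (sign v) * (\<Sum>u\<in>?U. (\<Prod>i<l. x (v i) (u i)) * mixed_det J x (unit_rows u)))"
    by (subst sum.swap) (simp add: sum_distrib_left)
  also have "\<dots> = (\<Sum>v\<in>?Q. of_int (sign v) * mixed_det J x (\<lambda>i c. x (v i) c))"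
    by (simp only: mixed_det_multilinear[OF J, of "\<lambda>i c. x (v i) c" for v])
  finally show ?thesis .
qed

text \<open>A column stays non-degenerate only if each row permuted inside it stays in its block or drops
  below the column; the second alternative strictly increases the height of the block.\<close>

lemma mixed_det_permuted_rows:
  assumes J: "J \<in> Pi\<^sub>E {..<l} rowset" and v: "v permutes {..<l}"
  shows "mixed_det J x (\<lambda>i c. x (v i) c) =
    (if \<forall>i\<in>{..<l}. J (v i) = J i then of_int (sign v) * (\<Prod>k\<in>K. set_det {..<H k} x) else 0)"
proof -
  have JK: "J i \<in> K" "i < H (J i)" if "i < l" for i using J that by (auto simp: rowset_def PiE_def Pi_def)
  define w where "w k = restrict_id v {i\<in>{..<l}. J i = k}" for k
  have mixed_det_w: "mixed_det J x (\<lambda>i c. x (v i) c) = (\<Prod>k\<in>K. set_det {..<H k} (\<lambda>i c. x (w k i) c))"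
    unfolding mixed_det_def by (intro prod.cong refl set_det_cong) (use Hl in \<open>force simp: w_def restrict_id_def\<close>)
  show ?thesis
  proof (cases "\<forall>i\<in>{..<l}. J (v i) = J i")
    case True
    have "w k permutes {..<H k}" if "k \<in> K" for k
    proof -
      have "{i\<in>{..<l}. J i \<in> {k}} = {i\<in>{..<l}. J i = k}" by auto
      then have "w k permutes {i\<in>{..<l}. J i = k}"
        using sign_restrict_blocks[OF v _ True, of "{k}"] by (simp add: w_def)
      moreover have "{i\<in>{..<l}. J i = k} \<subseteq> {..<H k}" using JK by auto
      ultimately show ?thesis by (rule permutes_subset)
    qed
    then have "mixed_det J x (\<lambda>i c. x (v i) c) = (\<Prod>k\<in>K. of_int (sign (w k)) * set_det {..<H k} x)"
      unfolding mixed_det_w by (intro prod.cong refl set_det_rows_permute) auto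
    also have "\<dots> = of_int (\<Prod>k\<in>K. sign (w k)) * (\<Prod>k\<in>K. set_det {..<H k} x)" by (simp add: prod.distrib)
    also have "(\<Prod>k\<in>K. sign (w k)) = sign v"
      unfolding w_def by (rule sign_blocks[OF v _ True finK]) (use JK in auto)
    finally show ?thesis using True by simp
  next
    case False
    have "\<exists>k\<in>K. \<not> inj_on (w k) {..<H k}"
    proof (rule ccontr)
      assume "\<not> ?thesis"
      then have inj: "inj_on (w k) {..<H k}" if "k \<in> K" for k using that by auto
      have vl: "v i < l" if "i < l" for i using permutes_in_image[OF v, of i] that by simp
      \<comment> \<open>If row v i belongs to the minor \<open>J i\<close> without being replaced
        there, it occurs twice: in its own position and in place of row i.\<close>
      have dich: "J (v i) = J i \<or> H (J i) \<le> v i" if i: "i < l" for i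
      proof (rule ccontr)
        assume *: "\<not> ?thesis"
        let ?k = "J i"
        have "w ?k i = v i" using i by (simp add: w_def restrict_id_def)
        moreover have "w ?k (v i) = v i" using * by (simp add: w_def restrict_id_def)
        ultimately have "i = v i" using inj_onD[OF inj[OF JK(1)[OF i]], of i "v i"] JK(2)[OF i] * by simp
        then show False using * by simp
      qed
      have mono: "H (J i) \<le> H (J (v i))" if "i < l" for i
        using dich[OF that] JK(2)[OF vl[OF that]] by (cases "J (v i) = J i") auto
      have strict: "J (v i) = J i" if "i < l" "H (J i) = H (J (v i))" for i
        using dich[OF that(1)] JK(2)[OF vl[OF that(1)]] that(2) by linarith
      \<comment> \<open>\<open>v\<close> merely reorders the heights, so none of them can strictly
        increase.\<close>
      have eq: "(\<Sum>i<l. H (J (v i))) = (\<Sum>i<l. H (J i))"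
        using sum.permute[OF v, of "\<lambda>i. H (J i)"] by (simp add: comp_def)
      have "H (J i) = H (J (v i))" if "i < l" for i
        by (rule sum_mono_inv[OF eq[symmetric]]) (use mono that in simp_all)
      then show False using strict False by blast
    qed
    then have "mixed_det J x (\<lambda>i c. x (v i) c) = 0"
      unfolding mixed_det_w using finK set_det_rows_not_inj by (intro prod_zero) auto
    then show ?thesis unfolding if_not_P[OF False] .
  qed
qed

text \<open>The sign of v occurs twice and cancels, so every v that keeps the classes of
  \<open>J\<close> contributes the same product of minors.\<close>

lemma det_times_mixed_det_eq:
  assumes J: "J \<in> Pi\<^sub>E {..<l} rowset"
  shows "set_det {..<l} x * (\<Sum>u\<in>{u. u permutes {..<l}}. of_int (sign u) * mixed_det J x (unit_rows u)) =
    real (card {v. v permutes {..<l} \<and> (\<forall>i\<in>{..<l}. J (v i) = J i)}) * (\<Prod>k\<in>K. set_det {..<H k} x)"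
proof -
  let ?V = "{v. v permutes {..<l} \<and> (\<forall>i\<in>{..<l}. J (v i) = J i)}"
  have "(\<Sum>v\<in>{v. v permutes {..<l}}. of_int (sign v) * mixed_det J x (\<lambda>i c. x (v i) c)) =
      (\<Sum>v\<in>{v. v permutes {..<l}}. if \<forall>i\<in>{..<l}. J (v i) = J i then (\<Prod>k\<in>K. set_det {..<H k} x) else 0)"
    by (intro sum.cong refl)
      (simp add: mixed_det_permuted_rows[OF J] flip: mult.assoc of_int_mult)
  also have "\<dots> = (\<Sum>v\<in>?V. (\<Prod>k\<in>K. set_det {..<H k} x))"
    by (rule sum.mono_neutral_cong_right) (auto intro: finite_permutations)
  finally show ?thesis unfolding det_times_mixed_det[OF J] by simp
qed

end

lemma isCont_set_det:
  fixes M :: "real \<Rightarrow> 'a \<Rightarrow> 'a \<Rightarrow> real"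
  assumes "\<And>i j. isCont (\<lambda>t. M t i j) a"
  shows "isCont (\<lambda>t. set_det B (M t)) a"
  unfolding set_det_def by (intro continuous_intros assms)

lemma eq_at_of_cofinitely_eq:
  fixes f g :: "real \<Rightarrow> real"
  assumes "isCont f a" "isCont g a" "finite Z" "\<And>t. t \<notin> Z \<Longrightarrow> f t = g t"
  shows "f a = g a"
proof -
  have "\<forall>\<^sub>F t in at a. t \<notin> Z"
    unfolding eventually_at_topological
  proof (intro exI conjI)
    show "open (- (Z - {a}))" using finite_imp_closed[of "Z - {a}"] assms(3) by (simp only: finite_Diff open_Compl)
  qed auto
  then have "\<forall>\<^sub>F t in at a. f t = g t" by eventually_elim (rule assms(4))
  then have "(f \<longlongrightarrow> g a) (at a)" using assms(2) by (simp add: isCont_def tendsto_cong)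
  then show ?thesis using assms(1) LIM_unique by (auto simp: isCont_def)
qed

context half_columns
begin

lemma isCont_mixed_det:
  fixes M :: "real \<Rightarrow> nat \<Rightarrow> nat \<Rightarrow> real"
  assumes "\<And>i c. isCont (\<lambda>t. M t i c) a"
  shows "isCont (\<lambda>t. mixed_det J (M t) z) a"
proof -
  have "isCont (\<lambda>t. if J i = k then z i c else M t i c) a" for i k c
    by (cases "J i = k") (simp_all add: assms)
  then have "isCont (\<lambda>t. set_det {..<H k} (\<lambda>i c. if J i = k then z i c else M t i c)) a" for k
    by (rule isCont_set_det[where M = "\<lambda>t i c. if J i = k then z i c else M t i c"])
  then show ?thesis unfolding mixed_det_def by (intro continuous_intros)
qed

text \<open>The two sides agree after multiplication by the minor of \<open>k1\<close>, which may
  vanish at x. Adding t to the diagonal makes it nonzero for all but finitely many t, and continuity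
  gives t = 0.\<close>

lemma sum_mixed_det_eq:
  assumes J: "J \<in> Pi\<^sub>E {..<l} rowset" and k1: "k1 \<in> K" "H k1 = l"
  shows "(\<Sum>u\<in>{u. u permutes {..<l}}. of_int (sign u) * mixed_det J x (unit_rows u)) =
    real (card {v. v permutes {..<l} \<and> (\<forall>i\<in>{..<l}. J (v i) = J i)}) * (\<Prod>k\<in>K - {k1}. set_det {..<H k} x)"
proof -
  define y where "y t i j = x i j + (if i = j then t else 0)" for t i j
  let ?L = "\<lambda>t. \<Sum>u\<in>{u. u permutes {..<l}}. of_int (sign u) * mixed_det J (y t) (unit_rows u)"
  let ?R = "\<lambda>t. real (card {v. v permutes {..<l} \<and> (\<forall>i\<in>{..<l}. J (v i) = J i)}) * (\<Prod>k\<in>K - {k1}. set_det {..<H k} (y t))"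
  have cy: "isCont (\<lambda>t. y t i j) 0" for i j
    unfolding y_def by (cases "i = j") simp_all
  have "?L 0 = ?R 0"
  proof (rule eq_at_of_cofinitely_eq[where f = ?L and g = ?R and Z = "{t. set_det {..<l} (y t) = 0}"])
    show "isCont ?L 0" by (intro continuous_intros isCont_mixed_det cy)
    show "isCont ?R 0" by (intro continuous_intros isCont_set_det cy)
    show "finite {t. set_det {..<l} (y t) = 0}" unfolding y_def[abs_def] by (rule finite_set_det_shift_zero)
    fix t assume "t \<notin> {t. set_det {..<l} (y t) = 0}"
    then have nz: "set_det {..<l} (y t) \<noteq> 0" by simp
    have "(\<Prod>k\<in>K. set_det {..<H k} (y t)) = set_det {..<l} (y t) * (\<Prod>k\<in>K - {k1}. set_det {..<H k} (y t))"
      using prod.remove[OF finK k1(1), of "\<lambda>k. set_det {..<H k} (y t)"] k1(2) by simp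
    then have "set_det {..<l} (y t) * ?L t = set_det {..<l} (y t) * ?R t"
      using det_times_mixed_det_eq[OF J, of "y t"] by simp
    then show "?L t = ?R t" using nz by simp
  qed
  moreover have "y 0 = x" by (auto simp: y_def fun_eq_iff)
  ultimately show ?thesis by simp
qed

text \<open>Pairs of a choice \<open>J\<close> and a permutation preserving it are counted with the
  permutation in front, where the cycle count applies.\<close>

lemma sum_card_stabilisers:
  "(\<Sum>J\<in>Pi\<^sub>E {..<l} rowset. card {v. v permutes {..<l} \<and> (\<forall>i\<in>{..<l}. J (v i) = J i)}) =
    (\<Prod>i<l. card (rowset i) + (l - 1 - i))"
proof -
  let ?Q = "{v. v permutes {..<l}}" and ?P = "Pi\<^sub>E {..<l} rowset"
  have finR: "finite (rowset i)" for i using finK by (simp add: rowset_def)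
  have finP: "finite ?P" using finR by (intro finite_PiE) auto
  have finQ: "finite ?Q" by (intro finite_permutations) simp
  have 1: "card {v. v permutes {..<l} \<and> (\<forall>i\<in>{..<l}. J (v i) = J i)} =
      (\<Sum>v\<in>?Q. if \<forall>i\<in>{..<l}. J (v i) = J i then 1 else 0)" for J :: "nat \<Rightarrow> nat"
    using sum.inter_filter[OF finQ, of "\<lambda>_. 1::nat" "\<lambda>v. \<forall>i\<in>{..<l}. J (v i) = J i"] by simp
  have 2: "card (commuting {..<l} rowset v) = (\<Sum>J\<in>?P. if \<forall>i\<in>{..<l}. J (v i) = J i then 1 else 0)" for v
    using sum.inter_filter[OF finP, of "\<lambda>_. 1::nat" "\<lambda>J. \<forall>i\<in>{..<l}. J (v i) = J i"]
    by (simp add: commuting_def)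
  have "(\<Sum>J\<in>?P. card {v. v permutes {..<l} \<and> (\<forall>i\<in>{..<l}. J (v i) = J i)}) =
      (\<Sum>v\<in>?Q. card (commuting {..<l} rowset v))"
    unfolding 1 2 by (rule sum.swap)
  also have "\<dots> = (\<Prod>i<l. card (rowset i) + (l - 1 - i))"
    by (rule sum_card_commuting) (auto simp: rowset_def)
  finally show ?thesis .
qed

text \<open>Wick's rule pairs each extra factor x(i, u i) with a cell (J i, i) carrying the same
  variable; the product of \<open>unit_rows\<close> records the condition P (J i) i = u i.\<close>

lemma expect_wick_cells:
  assumes P: "P \<in> perms" and u: "u permutes {..<l}" and D: "l + card cells \<le> D" and lm: "l \<le> m"
  shows "expect D ({..<m} \<times> {..<m}) (\<lambda>x. (\<Prod>i<l. x (i, u i)) * (\<Prod>(k, i)\<in>cells. x (i, P k i))) =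
    (\<Sum>J\<in>Pi\<^sub>E {..<l} rowset. (\<Prod>i<l. unit_rows u i (P (J i) i)) *
      expect D ({..<m} \<times> {..<m}) (\<lambda>x. \<Prod>(k, i)\<in>cells - (\<lambda>i. (J i, i)) ` {..<l}. x (i, P k i)))"
proof -
  let ?I = "{..<m} \<times> {..<m}"
  \<comment> \<open>The extra factors become labels in a column with a fresh index, so that they and
    the cells form one label set.\<close>
  obtain k0 where k0: "k0 \<notin> K" using ex_new_if_finite[OF infinite_UNIV_nat finK] by auto
  define e where "e = (\<lambda>(k, i). (i, if k = k0 then u i else P k i))"
  define R where "R = {k0} \<times> {..<l}"
  have RV: "finite R" "R \<inter> cells = {}" "inj_on e R" "card R = l"
    using k0 by (auto simp: R_def cells_def e_def inj_on_def)
  have e_cells: "e (k, i) = (i, P k i)" if "(k, i) \<in> cells" for k i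
    using that k0 by (auto simp: e_def cells_def)
  have eI: "e ` (R \<union> cells) \<subseteq> ?I"
  proof safe
    fix a b k i assume "(a, b) = e (k, i)" "(k, i) \<in> R"
    then show "a < m" "b < m" using permutes_in_image[OF u, of i] lm by (auto simp: R_def e_def)
  next
    fix a b k i assume *: "(a, b) = e (k, i)" "(k, i) \<in> cells"
    then have "i < H k" "k \<in> K" by (auto simp: cells_def)
    then show "a < m" "b < m" using * e_cells[OF *(2)] perms_less[OF P, of k i] Hl[of k] lm by auto
  qed
  have prodR: "(\<Prod>i<l. x (i, u i)) = (\<Prod>v\<in>R. x (e v))" for x :: "nat \<times> nat \<Rightarrow> real"
  proof -
    have "R = Pair k0 ` {..<l}" by (auto simp: R_def)
    then show ?thesis by (simp add: prod.reindex inj_on_def e_def)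
  qed
  have prodC: "(\<Prod>(k, i)\<in>C. x (i, P k i)) = (\<Prod>v\<in>C. x (e v))" if "C \<subseteq> cells" for x :: "nat \<times> nat \<Rightarrow> real" and C
    by (rule prod.cong) (use that e_cells in auto)
  have card_sub: "expect D ?I (\<lambda>x. \<Prod>v\<in>C. x (e v)) = real (card (matchings_of C e))" if "C \<subseteq> R \<union> cells" for C
  proof (rule expect_matchings)
    show "card C \<le> D"
      using card_mono[OF _ that] RV D card_Un_disjoint[OF RV(1) finite_cells RV(2)] by simp
  qed (use that eI RV finite_subset[OF that] in auto)
  have "expect D ?I (\<lambda>x. (\<Prod>i<l. x (i, u i)) * (\<Prod>(k, i)\<in>cells. x (i, P k i))) = expect D ?I (\<lambda>x. \<Prod>v\<in>R \<union> cells. x (e v))"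
    unfolding prodR prodC[OF subset_refl] using RV by (simp add: prod.union_disjoint)
  also have "\<dots> = real (card (matchings_of (R \<union> cells) e))" by (rule card_sub) simp
  also have "\<dots> = (\<Sum>j\<in>(\<Pi>\<^sub>E r\<in>R. {v\<in>cells. e v = e r}). real (card (matchings_of (cells - j ` R) e)))"
    by (rule card_matchings_of_wick) (use RV in auto)
  also have "\<dots> = (\<Sum>J\<in>{J\<in>Pi\<^sub>E {..<l} rowset. \<forall>i<l. P (J i) i = u i}.
      real (card (matchings_of (cells - (\<lambda>i. (J i, i)) ` {..<l}) e)))"
  proof (rule sum.reindex_bij_witness[where i = "\<lambda>J. restrict (\<lambda>(k, i). (J i, i)) R"
        and j = "\<lambda>j. restrict (\<lambda>i. fst (j (k0, i))) {..<l}"])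
    fix j assume j: "j \<in> (\<Pi>\<^sub>E r\<in>R. {v\<in>cells. e v = e r})"
    have jv: "j (k0, i) = (fst (j (k0, i)), i) \<and> fst (j (k0, i)) \<in> rowset i \<and> P (fst (j (k0, i))) i = u i"
      if "i < l" for i
    proof -
      have "(k0, i) \<in> R" using that by (simp add: R_def)
      then have "j (k0, i) \<in> cells" "e (j (k0, i)) = e (k0, i)" using j by auto
      then show ?thesis using e_cells[of "fst (j (k0, i))" "snd (j (k0, i))"]
        by (auto simp: cells_def rowset_def e_def split_beta prod_eq_iff split: if_splits)
    qed
    show "restrict (\<lambda>(k, i). (restrict (\<lambda>i. fst (j (k0, i))) {..<l} i, i)) R = j"
    proof
      fix v show "restrict (\<lambda>(k, i). (restrict (\<lambda>i. fst (j (k0, i))) {..<l} i, i)) R v = j v"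
      proof (cases "v \<in> R")
        case True
        then obtain i where "v = (k0, i)" "i < l" by (auto simp: R_def)
        then show ?thesis using jv[of i] True by simp
      next
        case False
        then show ?thesis using j by (cases v) (auto simp: PiE_def extensional_def)
      qed
    qed
    show "restrict (\<lambda>i. fst (j (k0, i))) {..<l} \<in> {J\<in>Pi\<^sub>E {..<l} rowset. \<forall>i<l. P (J i) i = u i}"
      using jv by auto
    have "j ` R = (\<lambda>i. (restrict (\<lambda>i. fst (j (k0, i))) {..<l} i, i)) ` {..<l}"
    proof -
      have "j ` R = (\<lambda>i. j (k0, i)) ` {..<l}" by (auto simp: R_def)
      also have "\<dots> = (\<lambda>i. (restrict (\<lambda>i. fst (j (k0, i))) {..<l} i, i)) ` {..<l}"
        by (rule image_cong) (use jv in auto)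
      finally show ?thesis .
    qed
    then show "real (card (matchings_of (cells - (\<lambda>i. (restrict (\<lambda>i. fst (j (k0, i))) {..<l} i, i)) ` {..<l}) e)) =
        real (card (matchings_of (cells - j ` R) e))" by simp
  next
    fix J assume J: "J \<in> {J\<in>Pi\<^sub>E {..<l} rowset. \<forall>i<l. P (J i) i = u i}"
    then show "restrict (\<lambda>i. fst (restrict (\<lambda>(k, i). (J i, i)) R (k0, i))) {..<l} = J"
      by (auto simp: R_def fun_eq_iff PiE_def extensional_def)
    show "restrict (\<lambda>(k, i). (J i, i)) R \<in> (\<Pi>\<^sub>E r\<in>R. {v\<in>cells. e v = e r})"
    proof (rule restrict_PiE_iff[THEN iffD2], safe)
      fix k i assume "(k, i) \<in> R"
      then have ki: "k = k0" "i < l" by (auto simp: R_def)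
      then show cell: "(J i, i) \<in> cells" using J by (auto simp: cells_def rowset_def PiE_def Pi_def)
      show "e (J i, i) = e (k, i)" using e_cells[OF cell] J ki by (simp add: e_def)
    qed
  qed
  also have "\<dots> = (\<Sum>J\<in>{J\<in>Pi\<^sub>E {..<l} rowset. \<forall>i<l. P (J i) i = u i}.
      expect D ?I (\<lambda>x. \<Prod>(k, i)\<in>cells - (\<lambda>i. (J i, i)) ` {..<l}. x (i, P k i)))"
    by (intro sum.cong refl, subst prodC, blast, subst card_sub) auto
  also have "\<dots> = (\<Sum>J\<in>Pi\<^sub>E {..<l} rowset. (\<Prod>i<l. unit_rows u i (P (J i) i)) *
      expect D ?I (\<lambda>x. \<Prod>(k, i)\<in>cells - (\<lambda>i. (J i, i)) ` {..<l}. x (i, P k i)))"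
  proof (rule sum.mono_neutral_cong_left)
    show "finite (Pi\<^sub>E {..<l} rowset)" using finK by (intro finite_PiE) (auto simp: rowset_def)
    show "\<forall>J\<in>Pi\<^sub>E {..<l} rowset - {J\<in>Pi\<^sub>E {..<l} rowset. \<forall>i<l. P (J i) i = u i}.
      (\<Prod>i<l. unit_rows u i (P (J i) i)) *
      expect D ?I (\<lambda>x. \<Prod>(k, i)\<in>cells - (\<lambda>i. (J i, i)) ` {..<l}. x (i, P k i)) = 0"
    proof
      fix J assume "J \<in> Pi\<^sub>E {..<l} rowset - {J\<in>Pi\<^sub>E {..<l} rowset. \<forall>i<l. P (J i) i = u i}"
      then obtain i where "i < l" "P (J i) i \<noteq> u i" by auto
      then have "(\<Prod>i<l. unit_rows u i (P (J i) i)) = 0" by (intro prod_zero) (auto simp: unit_rows_def)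
      then show "(\<Prod>i<l. unit_rows u i (P (J i) i)) *
        expect D ?I (\<lambda>x. \<Prod>(k, i)\<in>cells - (\<lambda>i. (J i, i)) ` {..<l}. x (i, P k i)) = 0" by simp
    qed
    fix J assume "J \<in> {J\<in>Pi\<^sub>E {..<l} rowset. \<forall>i<l. P (J i) i = u i}"
    then have "(\<Prod>i<l. unit_rows u i (P (J i) i)) = 1" by (simp add: unit_rows_def)
    then show "expect D ?I (\<lambda>x. \<Prod>(k, i)\<in>cells - (\<lambda>i. (J i, i)) ` {..<l}. x (i, P k i)) =
      (\<Prod>i<l. unit_rows u i (P (J i) i)) * expect D ?I (\<lambda>x. \<Prod>(k, i)\<in>cells - (\<lambda>i. (J i, i)) ` {..<l}. x (i, P k i))"
      by simp
  qed auto
  finally show ?thesis .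
qed

text \<open>The Cayley identity for determinants, applied to the Gaussian moments.\<close>

lemma expect_remove_two_columns:
  assumes k1: "k1 \<in> K" "H k1 = l" and D: "l + card cells \<le> D" and lm: "l \<le> m"
  shows "expect D ({..<m} \<times> {..<m}) (\<lambda>x. set_det {..<l} (curry x) * (\<Prod>k\<in>K. set_det {..<H k} (curry x))) =
    real (\<Prod>i<l. card (rowset i) + (l - 1 - i)) *
      expect D ({..<m} \<times> {..<m}) (\<lambda>x. \<Prod>k\<in>K - {k1}. set_det {..<H k} (curry x))"
proof -
  let ?I = "{..<m} \<times> {..<m}" and ?Q = "{u. u permutes {..<l}}" and ?J = "Pi\<^sub>E {..<l} rowset"
  let ?E = "\<lambda>J x P. \<Prod>(k, i)\<in>cells - (\<lambda>i. (J i, i)) ` {..<l}. x (i, P k i)"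
  have "expect D ?I (\<lambda>x. set_det {..<l} (curry x) * (\<Prod>k\<in>K. set_det {..<H k} (curry x))) =
      expect D ?I (\<lambda>x. \<Sum>u\<in>?Q. \<Sum>P\<in>perms. (of_int (sign u) * sgns P) *
        ((\<Prod>i<l. x (i, u i)) * (\<Prod>(k, i)\<in>cells. x (i, P k i))))"
    unfolding prod_set_det_expand unfolding set_det_def by (simp add: sum_product mult_ac)
  also have "\<dots> = (\<Sum>u\<in>?Q. \<Sum>P\<in>perms. (of_int (sign u) * sgns P) *
      expect D ?I (\<lambda>x. (\<Prod>i<l. x (i, u i)) * (\<Prod>(k, i)\<in>cells. x (i, P k i))))"
    by (simp add: expect_sum expect_cmult)
  also have "\<dots> = (\<Sum>u\<in>?Q. \<Sum>P\<in>perms. \<Sum>J\<in>?J. (of_int (sign u) * sgns P * (\<Prod>i<l. unit_rows u i (P (J i) i))) *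
      expect D ?I (\<lambda>x. ?E J x P))"
    by (intro sum.cong refl) (simp add: expect_wick_cells[OF _ _ D lm] sum_distrib_left mult_ac)
  also have "\<dots> = (\<Sum>u\<in>?Q. \<Sum>J\<in>?J. \<Sum>P\<in>perms. (of_int (sign u) * sgns P * (\<Prod>i<l. unit_rows u i (P (J i) i))) *
      expect D ?I (\<lambda>x. ?E J x P))"
    by (intro sum.cong refl sum.swap)
  also have "\<dots> = (\<Sum>J\<in>?J. \<Sum>u\<in>?Q. \<Sum>P\<in>perms. (of_int (sign u) * sgns P * (\<Prod>i<l. unit_rows u i (P (J i) i))) *
      expect D ?I (\<lambda>x. ?E J x P))"
    by (rule sum.swap)
  \<comment> \<open>For fixed \<open>J\<close> the sum over \<open>P\<close> is the expansion of a
    mixed determinant: integration by parts has turned multiplication by the determinant into the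
    corresponding differential operator.\<close>
  also have "\<dots> = (\<Sum>J\<in>?J. expect D ?I (\<lambda>x. \<Sum>u\<in>?Q. of_int (sign u) * mixed_det J (curry x) (unit_rows u)))"
  proof (rule sum.cong[OF refl])
    fix J assume J: "J \<in> ?J"
    have "expect D ?I (\<lambda>x. \<Sum>u\<in>?Q. of_int (sign u) * mixed_det J (curry x) (unit_rows u)) =
        expect D ?I (\<lambda>x. \<Sum>u\<in>?Q. \<Sum>P\<in>perms. (of_int (sign u) * sgns P * (\<Prod>i<l. unit_rows u i (P (J i) i))) * ?E J x P)"
      unfolding mixed_det_expand[OF J] by (simp add: sum_distrib_left mult_ac)
    also have "\<dots> = (\<Sum>u\<in>?Q. \<Sum>P\<in>perms. (of_int (sign u) * sgns P * (\<Prod>i<l. unit_rows u i (P (J i) i))) *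
      expect D ?I (\<lambda>x. ?E J x P))"
      by (simp add: expect_sum expect_cmult)
    finally show "(\<Sum>u\<in>?Q. \<Sum>P\<in>perms. (of_int (sign u) * sgns P * (\<Prod>i<l. unit_rows u i (P (J i) i))) *
      expect D ?I (\<lambda>x. ?E J x P)) = expect D ?I (\<lambda>x. \<Sum>u\<in>?Q. of_int (sign u) * mixed_det J (curry x) (unit_rows u))" ..
  qed
  \<comment> \<open>The Cayley identity removes the minor \<open>k1\<close> and leaves only a number
    that depends on \<open>J\<close>.\<close>
  also have "\<dots> = (\<Sum>J\<in>?J. real (card {v. v permutes {..<l} \<and> (\<forall>i\<in>{..<l}. J (v i) = J i)}) *
      expect D ?I (\<lambda>x. \<Prod>k\<in>K - {k1}. set_det {..<H k} (curry x)))"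
    by (intro sum.cong refl) (simp add: sum_mixed_det_eq[OF _ k1] expect_cmult)
  also have "\<dots> = real (\<Prod>i<l. card (rowset i) + (l - 1 - i)) *
      expect D ?I (\<lambda>x. \<Prod>k\<in>K - {k1}. set_det {..<H k} (curry x))"
    unfolding sum_card_stabilisers[symmetric] by (simp add: sum_distrib_right)
  finally show ?thesis .
qed

end

section \<open>The leading coefficient\<close>

definition two_to_one :: "'a set \<Rightarrow> 'b set \<Rightarrow> ('a \<Rightarrow> 'b) set" where
  "two_to_one V B = {f \<in> V \<rightarrow>\<^sub>E B. \<forall>y\<in>B. card {v\<in>V. f v = y} = 2}"

lemma standard_two_to_one: "standard V la = two_to_one V (boxes la)"
  by (simp add: standard_def two_to_one_def)

lemma finite_two_to_one [simp]: "finite V \<Longrightarrow> finite B \<Longrightarrow> finite (two_to_one V B)"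
  by (rule finite_subset[of _ "V \<rightarrow>\<^sub>E B"]) (auto simp: two_to_one_def intro: finite_PiE)

lemma two_to_one_fibre:
  assumes V: "finite V" and f: "f \<in> two_to_one V B" and ab: "a \<in> V" "b \<in> V" "a \<noteq> b" "f a = f b"
  shows "{v\<in>V. f v = f a} = {a, b}"
proof -
  have "card {v\<in>V. f v = f a} = 2" using f ab by (auto simp: two_to_one_def)
  then show ?thesis using ab V by (intro card_subset_eq[symmetric]) auto
qed

lemma card_two_to_one_pair:
  assumes V: "finite V" and ab: "a \<in> V" "b \<in> V" "a \<noteq> b" and y: "y \<in> B"
  shows "card {f \<in> two_to_one V B. f a = y \<and> f b = y} = card (two_to_one (V - {a, b}) (B - {y}))"
proof (rule bij_betw_same_card)
  let ?V' = "V - {a, b}" and ?B' = "B - {y}"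
  show "bij_betw (\<lambda>f. f(a := undefined, b := undefined)) {f \<in> two_to_one V B. f a = y \<and> f b = y}
      (two_to_one ?V' ?B')"
  proof (rule bij_betw_byWitness[where f' = "\<lambda>g. g(a := y, b := y)"])
    show "\<forall>f\<in>{f \<in> two_to_one V B. f a = y \<and> f b = y}. (f(a := undefined, b := undefined))(a := y, b := y) = f"
      by (auto simp: fun_eq_iff)
    show "\<forall>g\<in>two_to_one ?V' ?B'. (g(a := y, b := y))(a := undefined, b := undefined) = g"
      by (auto simp: fun_eq_iff two_to_one_def PiE_def extensional_def)
    show "(\<lambda>f. f(a := undefined, b := undefined)) ` {f \<in> two_to_one V B. f a = y \<and> f b = y} \<subseteq> two_to_one ?V' ?B'"
    proof (rule image_subsetI)
      fix f assume "f \<in> {f \<in> two_to_one V B. f a = y \<and> f b = y}"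
      then have f: "f \<in> two_to_one V B" "f a = y" "f b = y" by auto
      have fib: "{v\<in>V. f v = y} = {a, b}" using two_to_one_fibre[OF V f(1) ab] f by simp
      let ?g = "f(a := undefined, b := undefined)"
      have "?g \<in> ?V' \<rightarrow>\<^sub>E ?B'" using f(1) fib by (auto simp: two_to_one_def PiE_def Pi_def extensional_def)
      moreover have "card {v\<in>?V'. ?g v = z} = 2" if z: "z \<in> ?B'" for z
      proof -
        have "{v\<in>?V'. ?g v = z} = {v\<in>V. f v = z}" using f z by auto
        then show ?thesis using f(1) z by (simp add: two_to_one_def)
      qed
      ultimately show "?g \<in> two_to_one ?V' ?B'" by (simp add: two_to_one_def)
    qed
    show "(\<lambda>g. g(a := y, b := y)) ` two_to_one ?V' ?B' \<subseteq> {f \<in> two_to_one V B. f a = y \<and> f b = y}"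
    proof (rule image_subsetI)
      fix g assume g: "g \<in> two_to_one ?V' ?B'"
      let ?f = "g(a := y, b := y)"
      have "?f \<in> V \<rightarrow>\<^sub>E B" using g ab y by (auto simp: two_to_one_def PiE_def Pi_def extensional_def)
      moreover have "card {v\<in>V. ?f v = z} = 2" if z: "z \<in> B" for z
      proof (cases "z = y")
        case True
        have "{v\<in>V. ?f v = y} = {a, b}" using g ab by (auto simp: two_to_one_def)
        then show ?thesis using True ab by simp
      next
        case False
        then have "{v\<in>V. ?f v = z} = {v\<in>?V'. g v = z}" by auto
        then show ?thesis using g z False by (simp add: two_to_one_def)
      qed
      ultimately show "?f \<in> {f \<in> two_to_one V B. f a = y \<and> f b = y}" by (simp add: two_to_one_def)
    qed
  qed
qed

text \<open>The multinomial count (2m)!/2^m, obtained by choosing the box and the partner of one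
  label.\<close>

lemma card_two_to_one:
  assumes "finite V" "finite B" "card V = 2 * card B"
  shows "card (two_to_one V B) * 2 ^ card B = fact (card V)"
  using assms
proof (induction "card B" arbitrary: V B)
  case 0
  then have "V = {}" "B = {}" by auto
  then have "two_to_one V B = {\<lambda>_. undefined}" by (auto simp: two_to_one_def)
  then show ?case using \<open>V = {}\<close> \<open>B = {}\<close> by simp
next
  case (Suc m)
  then obtain a where a: "a \<in> V" by fastforce
  let ?T = "two_to_one V B" and ?P = "B \<times> (V - {a})"
  have part: "?T = (\<Union>(y, b)\<in>?P. {f \<in> ?T. f a = y \<and> f b = y})"
  proof -
    have "\<exists>b\<in>V - {a}. f b = f a" if "f \<in> ?T" for f
    proof (rule ccontr)
      assume *: "\<not> ?thesis"
      then have "{v\<in>V. f v = f a} = {a}" using a by auto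
      moreover have "card {v\<in>V. f v = f a} = 2" using that a by (auto simp: two_to_one_def)
      ultimately show False by simp
    qed
    moreover have "f a \<in> B" if "f \<in> ?T" for f using that a by (auto simp: two_to_one_def)
    ultimately show ?thesis by fastforce
  qed
  have "card ?T = (\<Sum>p\<in>?P. card {f \<in> ?T. f a = fst p \<and> f (snd p) = fst p})"
  proof -
    have "card (\<Union>p\<in>?P. {f \<in> ?T. f a = fst p \<and> f (snd p) = fst p}) =
        (\<Sum>p\<in>?P. card {f \<in> ?T. f a = fst p \<and> f (snd p) = fst p})"
    proof (rule card_UN_disjoint)
      show "\<forall>p\<in>?P. \<forall>q\<in>?P. p \<noteq> q \<longrightarrow> {f \<in> ?T. f a = fst p \<and> f (snd p) = fst p} \<inter>
          {f \<in> ?T. f a = fst q \<and> f (snd q) = fst q} = {}"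
      proof (intro ballI impI, rule ccontr)
        fix p q assume p: "p \<in> ?P" and q: "q \<in> ?P" and ne: "p \<noteq> q"
          and "{f \<in> ?T. f a = fst p \<and> f (snd p) = fst p} \<inter> {f \<in> ?T. f a = fst q \<and> f (snd q) = fst q} \<noteq> {}"
        then obtain f where "f \<in> {f \<in> ?T. f a = fst p \<and> f (snd p) = fst p} \<inter> {f \<in> ?T. f a = fst q \<and> f (snd q) = fst q}"
          by blast
        then have f: "f \<in> ?T" "f a = fst p" "f (snd p) = fst p" "f a = fst q" "f (snd q) = fst q" by blast+
        have "snd p \<in> V" "a \<noteq> snd p" "snd q \<in> V" "a \<noteq> snd q" "f a = f (snd p)" "f a = f (snd q)"
          using p q f by auto
        then have "{v\<in>V. f v = f a} = {a, snd p}" "{v\<in>V. f v = f a} = {a, snd q}"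
          using two_to_one_fibre[OF Suc.prems(1) f(1) a] by blast+
        then have "snd p = snd q" by (metis doubleton_eq_iff)
        then show False using ne f by (simp add: prod_eq_iff)
      qed
    qed (use Suc.prems in auto)
    then show ?thesis by (subst part) (simp add: split_beta)
  qed
  then have "card ?T * 2 ^ card B = (\<Sum>p\<in>?P. card {f \<in> ?T. f a = fst p \<and> f (snd p) = fst p} * 2 ^ card B)"
    by (simp add: sum_distrib_right)
  also have "\<dots> = (\<Sum>p\<in>?P. 2 * fact (2 * m))"
  proof (rule sum.cong[OF refl])
    fix p assume p: "p \<in> ?P"
    have c: "card {f \<in> ?T. f a = fst p \<and> f (snd p) = fst p} = card (two_to_one (V - {a, snd p}) (B - {fst p}))"
      by (rule card_two_to_one_pair[OF Suc.prems(1) a]) (use p in auto)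
    have V': "card V = Suc (Suc (card (V - {a, snd p})))"
      by (rule card_delete_pair[OF Suc.prems(1) a]) (use p in auto)
    have B': "card (B - {fst p}) = m" using p Suc.hyps(2) Suc.prems(2) by auto
    have "card (two_to_one (V - {a, snd p}) (B - {fst p})) * 2 ^ card (B - {fst p}) = fact (card (V - {a, snd p}))"
      by (rule Suc.hyps(1)) (use B' V' Suc in auto)
    moreover have "card (V - {a, snd p}) = 2 * m" using V' Suc by simp
    ultimately show "card {f \<in> ?T. f a = fst p \<and> f (snd p) = fst p} * 2 ^ card B = 2 * fact (2 * m)"
      unfolding c B' Suc.hyps(2)[symmetric] by simp
  qed
  also have "\<dots> = card B * (card V - 1) * (2 * fact (2 * m))"
    using a Suc.prems by (simp add: card_cartesian_product)
  also have "\<dots> = fact (card V)"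
  proof -
    have "card V = Suc (Suc (2 * m))" using Suc by simp
    then show ?thesis using Suc.hyps(2)[symmetric] by (simp add: algebra_simps)
  qed
  finally show ?case .
qed

text \<open>Counted as a Gaussian expectation: every variable occurs squared, and its second moment
  is 1.\<close>

lemma matchings_of_two_to_one:
  assumes V: "finite V" and f: "f \<in> two_to_one V B"
  shows "card (matchings_of V f) = 1"
proof -
  have finf: "finite (f ` V)" using V by simp
  have "gauss_moment (card {v\<in>V. f v = i}) = 1" if i: "i \<in> f ` V" for i
  proof -
    have "card {v\<in>V. f v = i} = 2" using f i by (auto simp: two_to_one_def)
    then show ?thesis by (simp add: gauss_moment_def)
  qed
  then have "expect (card V) (f ` V) (\<lambda>x. \<Prod>v\<in>V. x (f v)) = 1"
    using expect_monomial[OF finf V, of "card V" f] by simp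
  then show ?thesis using expect_matchings[OF finf V, of "card V" f] by simp
qed

lemma card_tableaux:
  assumes la: "la \<in> partitions n"
  shows "real (card (tableaux (labels n) la)) * 2 ^ n = fact (2 * n)"
proof -
  have "card (tableaux (labels n) la) = (\<Sum>f\<in>standard (labels n) la. card (matchings_of (labels n) f))"
    unfolding tableaux_def by (rule card_SigmaI) auto
  also have "\<dots> = card (two_to_one (labels n) (boxes la))"
    by (simp add: standard_two_to_one matchings_of_two_to_one)
  finally have "card (tableaux (labels n) la) * 2 ^ n = fact (2 * n)"
    using card_two_to_one[of "labels n" "boxes la"] partitionsD(3)[OF la] by (simp add: card_boxes)
  then have "real (card (tableaux (labels n) la) * 2 ^ n) = real (fact (2 * n))" by (simp only:)
  then show ?thesis by simp
qed

section \<open>Column heights and the hook product\<close>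

lemma boxes_iff_conj_len:
  assumes la: "la \<in> partitions n"
  shows "(i, j) \<in> boxes la \<longleftrightarrow> i < conj_len la j"
proof -
  let ?X = "{i. i < length la \<and> j < la ! i}"
  have mem: "i \<in> ?X \<longleftrightarrow> (i, j) \<in> boxes la" for i by (simp add: boxes_def)
  have down: "i' \<in> ?X" if "i \<in> ?X" "i' \<le> i" for i i'
    using boxes_down[OF la, of i j i'] that mem by blast
  have "?X = {..<card ?X}"
  proof (cases "?X = {}")
    case False
    have fin: "finite ?X" by simp
    define M where "M = Max ?X"
    have M: "M \<in> ?X" unfolding M_def by (rule Max_in[OF fin False])
    have "i \<le> M" if "i \<in> ?X" for i unfolding M_def by (rule Max_ge[OF fin that])
    then have X: "?X = {..M}" using down[OF M] by blast
    show ?thesis unfolding X by (simp add: lessThan_Suc_atMost)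
  next
    case True
    then show ?thesis by (simp only: card.empty lessThan_0)
  qed
  then have "i \<in> ?X \<longleftrightarrow> i < card ?X" by blast
  then show ?thesis unfolding mem conj_len_def .
qed

lemma conj_len_le: "conj_len la j \<le> length la"
proof -
  have "conj_len la j \<le> card {..<length la}" unfolding conj_len_def by (rule card_mono) auto
  then show ?thesis by simp
qed

lemma part_le: "la \<in> partitions n \<Longrightarrow> i < length la \<Longrightarrow> la ! i \<le> n"
  using member_le_sum_list[of "la ! i" la] partitionsD(3)[of la n] by auto

lemma conj_len_antimono: "la \<in> partitions n \<Longrightarrow> j \<le> j' \<Longrightarrow> conj_len la j' \<le> conj_len la j"
  unfolding conj_len_def by (rule card_mono) auto

lemma prod_boxes:
  assumes la: "la \<in> partitions n"
  shows "(\<Prod>(i, j)\<in>boxes la. g i j) = (\<Prod>j<n. \<Prod>i<conj_len la j. g i j)"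
proof -
  have "(\<Prod>j<n. \<Prod>i<conj_len la j. g i j) = (\<Prod>(j, i)\<in>Sigma {..<n} (\<lambda>j. {..<conj_len la j}). g i j)"
    by (subst prod.Sigma) auto
  also have "\<dots> = (\<Prod>(i, j)\<in>boxes la. g i j)"
  proof (rule prod.reindex_bij_witness[where i = "\<lambda>(i, j). (j, i)" and j = "\<lambda>(j, i). (i, j)"])
    fix p assume "p \<in> boxes la"
    then show "(case p of (i, j) \<Rightarrow> (j, i)) \<in> Sigma {..<n} (\<lambda>j. {..<conj_len la j})"
      using boxes_iff_conj_len[OF la] part_le[OF la] by (auto simp: boxes_def) (metis less_le_trans)
  qed (use boxes_iff_conj_len[OF la] in auto)
  finally show ?thesis ..
qed

text \<open>A squared minor is two of the 2n factors, and \<open>k div 2\<close> is the column of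
  factor k; indices beyond the diagram have height 0 and determinant 1. Removing the columns from
  left to right leaves one number for each box.\<close>

lemma expect_hook:
  assumes la: "la \<in> partitions n" and m: "length la \<le> m" and D: "(2 * n + 1) * m \<le> D"
  shows "expect D ({..<m} \<times> {..<m}) (\<lambda>x. \<Prod>j<n. (set_det {..<conj_len la j} (curry x))\<^sup>2) = hook_c 2 la"
proof -
  let ?I = "{..<m} \<times> {..<m}"
  define H where "H k = conj_len la (k div 2)" for k
  define E where "E s = expect D ?I (\<lambda>x. \<Prod>k\<in>{2 * s..<2 * n}. set_det {..<H k} (curry x))" for s
  have step: "E s = (\<Prod>i<conj_len la s. 2 * real (la ! i - s - 1) + real (conj_len la s - i - 1) + 1) * E (Suc s)"
    if s: "s < n" for s
  proof -
    define l where "l = conj_len la s"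
    interpret half_columns "{2 * s + 1..<2 * n}" H l
      by unfold_locales (auto simp: H_def l_def intro!: conj_len_antimono[OF la])
    have lm: "l \<le> m" using conj_len_le[of la s] m by (simp add: l_def)
    have "i < m" if "k \<in> {2 * s + 1..<2 * n}" "i < H k" for k i using Hl[OF that(1)] that(2) lm by linarith
    then have "cells \<subseteq> {..<2 * n} \<times> {..<m}" unfolding cells_def by (auto simp del: atLeastLessThan_iff) auto
    then have "card cells \<le> card ({..<2 * n} \<times> {..<m})" by (rule card_mono[rotated]) simp
    \<comment> \<open>The cells belong to at most 2n minors with at most m rows each, and the extra
      determinant adds at most m factors; hence the bound (2n + 1) m.\<close>
    then have Dc: "l + card cells \<le> D" using lm D by (simp add: card_cartesian_product)
    have s2: "{2 * s..<2 * n} = insert (2 * s) {2 * s + 1..<2 * n}"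
      "{2 * s + 1..<2 * n} - {2 * s + 1} = {2 * Suc s..<2 * n}" using s by auto
    have "E s = expect D ?I (\<lambda>x. set_det {..<l} (curry x) * (\<Prod>k\<in>{2 * s + 1..<2 * n}. set_det {..<H k} (curry x)))"
      unfolding E_def s2(1) by (simp add: H_def l_def)
    also have "\<dots> = real (\<Prod>i<l. card (rowset i) + (l - 1 - i)) * E (Suc s)"
      unfolding E_def s2(2)[symmetric]
      by (rule expect_remove_two_columns[OF _ _ Dc lm]) (use s in \<open>auto simp: H_def l_def\<close>)
    also have "real (\<Prod>i<l. card (rowset i) + (l - 1 - i)) =
        (\<Prod>i<l. 2 * real (la ! i - s - 1) + real (l - i - 1) + 1)"
      unfolding of_nat_prod
    proof (rule prod.cong[OF refl])
      fix i assume "i \<in> {..<l}"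
      then have "(i, s) \<in> boxes la" using boxes_iff_conj_len[OF la] by (simp add: l_def)
      then have i: "i < length la" "s < la ! i" by (auto simp: boxes_def)
      have iff: "i < H k \<longleftrightarrow> k < 2 * la ! i" for k
        using boxes_iff_conj_len[OF la, of i "k div 2"] i(1) by (auto simp: boxes_def H_def)
      \<comment> \<open>Of the 2 (arm + 1) factors that meet row i from column s on, one is the
        extra determinant itself. The 2 arm + 1 others and the leg of the box give its hook
        factor.\<close>
      have "rowset i = {2 * s + 1..<2 * la ! i}"
        unfolding rowset_def iff using part_le[OF la i(1)] by auto
      then show "real (card (rowset i) + (l - 1 - i)) = 2 * real (la ! i - s - 1) + real (l - i - 1) + 1"
        using i(2) by (simp add: of_nat_diff)
    qed
    finally show ?thesis by (simp add: l_def)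
  qed
  have tele: "t \<le> n \<Longrightarrow> E 0 = (\<Prod>j<t. \<Prod>i<conj_len la j. 2 * real (la ! i - j - 1) + real (conj_len la j - i - 1) + 1) * E t" for t
    by (induction t) (simp_all add: step mult.assoc)
  have "E n = 1"
    using expect_monomial[of ?I "{}" D "\<lambda>_. (0, 0)"] by (simp add: E_def gauss_moment_0_1)
  then have hook: "E 0 = hook_c 2 la"
    unfolding hook_c_def prod_boxes[OF la] using tele[of n] by simp
  have sq: "(\<Prod>k\<in>{2 * 0..<2 * n}. g (k div 2)) = (\<Prod>j<n. (g j)\<^sup>2)" for g :: "nat \<Rightarrow> real"
    by (induction n) (simp_all add: power2_eq_square mult_ac)
  show ?thesis using hook unfolding E_def H_def sq[of "\<lambda>j. set_det {..<conj_len la j} (curry x)" for x] .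
qed

lemma num_loops_self: "finite V \<Longrightarrow> fixfree V A \<Longrightarrow> 2 * num_loops V A A = card V"
proof (induction "card V" arbitrary: V rule: less_induct)
  case less
  show ?case
  proof (cases "V = {}")
    case False
    then obtain a where a: "a \<in> V" by auto
    have Aa: "A a \<in> V" "a \<noteq> A a" using less.prems a by (auto simp: fixfree_def)
    have c: "card V = Suc (Suc (card (V - {a, A a})))"
      using card_delete_pair[OF less.prems(1) a Aa] .
    show ?thesis
      using less.hyps[of "V - {a, A a}"] c less.prems(1) fixfree_delete[OF less.prems(2) a]
        num_loops_delete[OF less.prems(1,2,2) a refl] by simp
  qed simp
qed

lemma standard_col_card:
  assumes la: "la \<in> partitions n" and V: "finite V" and f: "f \<in> standard V la"
  shows "card {v\<in>V. snd (f v) = j \<and> fst (f v) = r} = (if r < conj_len la j then 2 else 0)"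
proof -
  have eq: "{v\<in>V. snd (f v) = j \<and> fst (f v) = r} = {v\<in>V. f v = (r, j)}" by auto
  show ?thesis
  proof (cases "r < conj_len la j")
    case True
    then show ?thesis using f boxes_iff_conj_len[OF la] by (simp add: eq standard_def)
  next
    case False
    then have "(r, j) \<notin> boxes la" using boxes_iff_conj_len[OF la] by simp
    moreover have "f v \<in> boxes la" if "v \<in> V" for v using f that by (auto simp: standard_def)
    ultimately have "{v\<in>V. f v = (r, j)} = {}" by force
    then show ?thesis using False by (simp only: eq card.empty if_False)
  qed
qed

lemma standard_fst_less:
  assumes la: "la \<in> partitions n" and f: "f \<in> standard V la" and v: "v \<in> V"
  shows "fst (f v) < conj_len la (snd (f v))"
  using f v boxes_iff_conj_len[OF la, of "fst (f v)" "snd (f v)"] by (auto simp: standard_def)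

lemma card_standard_col:
  assumes la: "la \<in> partitions n" and V: "finite V" and f: "f \<in> standard V la"
  shows "card {v\<in>V. snd (f v) = j} = 2 * conj_len la j"
proof -
  have "{v\<in>V. snd (f v) = j} = {v\<in>V. snd (f v) = j \<and> fst (f v) < conj_len la j}"
    using standard_fst_less[OF la f] by auto
  then show ?thesis
    by (simp only:) (simp add: card_less_fibres[OF V] standard_col_card[OF la V f])
qed

text \<open>With content \<open>la\<close> the dominance inequalities are equalities, hence tight in
  each column, and a column of height h has only colours below h. Conversely, h colours with at most
  two labels each must exhaust the 2h labels. The global condition on \<open>c\<close> becomes one
  for each label, as needed to sum over \<open>c\<close>.\<close>

lemma col_sum_content_iff:
  assumes la: "la \<in> partitions n" and V: "finite V" and f: "f \<in> standard V la" and A: "A \<in> matchings V"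
    and ne: "col_sum V (f, A) c \<noteq> 0"
  shows "content V c la \<longleftrightarrow> (\<forall>v\<in>V. c v < conj_len la (snd (f v)))"
proof
  assume c: "content V c la"
  show "\<forall>v\<in>V. c v < conj_len la (snd (f v))"
  proof
    fix v assume v: "v \<in> V"
    define j where "j = snd (f v)"
    define i where "i = conj_len la j"
    have jB: "j \<in> snd ` boxes la" using f v by (auto simp: standard_def j_def)
    have "(\<Sum>j\<in>snd ` boxes la. card {v\<in>V. snd (f v) = j \<and> c v < i}) =
        (\<Sum>j\<in>snd ` boxes la. card {v\<in>V. snd (f v) = j \<and> fst (f v) < i})"
      using content_less[OF V c, of i] content_less[OF V standard_content[OF V f], of i]
      unfolding card_partition_snd[OF V f, of "\<lambda>v. c v < i", symmetric]
        card_partition_snd[OF V f, of "\<lambda>v. fst (f v) < i", symmetric] by simp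
    then have "card {v\<in>V. snd (f v) = j \<and> c v < i} = card {v\<in>V. snd (f v) = j \<and> fst (f v) < i}"
      by (rule sum_mono_inv) (use col_count_le[OF la V f A ne] jB in auto)
    also have "{v\<in>V. snd (f v) = j \<and> fst (f v) < i} = {v\<in>V. snd (f v) = j}"
      using standard_fst_less[OF la f] by (auto simp: i_def)
    finally have "{v\<in>V. snd (f v) = j \<and> c v < i} = {v\<in>V. snd (f v) = j}"
      using V by (intro card_subset_eq) auto
    then show "c v < conj_len la (snd (f v))" using v by (auto simp: i_def j_def)
  qed
next
  assume c: "\<forall>v\<in>V. c v < conj_len la (snd (f v))"
  have two: "card {v\<in>V. snd (f v) = j \<and> c v = i} = (if i < conj_len la j then 2 else 0)" for i j
  proof (cases "i < conj_len la j")
    case True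
    have "{v\<in>V. snd (f v) = j} = {v\<in>V. snd (f v) = j \<and> c v < conj_len la j}" using c by auto
    then have "(\<Sum>i<conj_len la j. card {v\<in>V. snd (f v) = j \<and> c v = i}) = (\<Sum>i<conj_len la j. 2)"
      using card_standard_col[OF la V f, of j] card_less_fibres[OF V, of "\<lambda>v. snd (f v) = j" c "conj_len la j"]
      by simp
    then have "card {v\<in>V. snd (f v) = j \<and> c v = i} = 2"
      by (rule sum_mono_inv) (use col_sum_fibre[OF V A ne] True in auto)
    then show ?thesis using True by simp
  next
    case False
    then have "{v\<in>V. snd (f v) = j \<and> c v = i} = {}" using c by auto
    then show ?thesis using False by (simp only: card.empty if_False)
  qed
  have "card {v\<in>V. c v = i} = 2 * la ! i" if i: "i < length la" for i
  proof -
    have "card {v\<in>V. c v = i} = (\<Sum>j\<in>snd ` boxes la. if i < conj_len la j then 2 else 0)"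
      unfolding card_partition_snd[OF V f, of "\<lambda>v. c v = i"] two ..
    also have "\<dots> = (\<Sum>j\<in>{j\<in>snd ` boxes la. i < conj_len la j}. 2)"
      by (rule sum.inter_filter[symmetric]) simp
    also have "{j\<in>snd ` boxes la. i < conj_len la j} = {..<la ! i}"
      using i by (force simp: boxes_iff_conj_len[OF la, symmetric] boxes_def)
    finally show ?thesis by simp
  qed
  moreover have "c ` V \<subseteq> {..<length la}" using c conj_len_le by (auto intro: less_le_trans)
  ultimately show "content V c la" by (simp add: content_def)
qed

lemma alternating_sub:
  assumes "\<phi> \<in> alternating V A S" shows "\<phi> \<in> alternating V A A"
  using assms by (auto simp: alternating_def)

section \<open>From signed matchings to determinants\<close>

text \<open>(-1)^n (-2)^loops is the sum of the equal signs belonging to the 2^loops alternating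
  colourings. Powers of -2 are traded for signs of permutations.\<close>

lemma weight_sign_sum:
  assumes V: "finite V" "card V = 2 * n" and A: "A \<in> matchings V" and S: "S \<in> matchings V"
  shows "(-1) ^ n * weight V A S = (\<Sum>\<phi>\<in>alternating V A S. of_int (sign (red_perm V A S \<phi>)))"
proof -
  note ff = matchings_fixfree[OF A] matchings_fixfree[OF S]
  have "(\<Sum>\<phi>\<in>alternating V A S. of_int (sign (red_perm V A S \<phi>))) = (\<Sum>\<phi>\<in>alternating V A S. (-1::real) ^ (n + num_loops V A S))"
    by (rule sum.cong[OF refl]) (use sign_red_perm[OF V(1) ff] V(2) in \<open>auto simp: alternating_def\<close>)
  also have "\<dots> = (-1) ^ n * ((-1) ^ num_loops V A S * 2 ^ num_loops V A S)"
    using card_alternating[OF V(1) ff] by (simp add: power_add)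
  also have "\<dots> = (-1) ^ n * weight V A S"
    by (simp add: weight_def power_mult_distrib[symmetric])
  finally show ?thesis ..
qed

text \<open>For a fixed colouring \<open>\<phi>\<close> the matchings alternating with \<open>A\<close> are the permutations of the red
  labels, and the weighted sum over them is a determinant.\<close>

lemma matchings_determinant:
  fixes f :: "'a \<Rightarrow> nat \<times> nat" and h :: "nat \<Rightarrow> nat" and x :: "nat \<Rightarrow> nat \<Rightarrow> real"
  assumes V: "finite V" and A: "A \<in> matchings_of V f" and \<phi>: "\<phi> \<in> alternating V A A"
  defines "R \<equiv> {v\<in>V. \<phi> v}"
  shows "(\<Sum>S\<in>{S\<in>matchings_of V (snd \<circ> f). \<phi> \<in> alternating V A S}. of_int (sign (red_perm V A S \<phi>)) *
      (\<Sum>c\<in>{c\<in>(\<Pi>\<^sub>E v\<in>V. {..<h (snd (f v))}). S \<in> matchings_of V c}. \<Prod>v\<in>V. x (fst (f v)) (c v))) =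
    set_det R (\<lambda>v w. if snd (f v) = snd (f w)
      then \<Sum>i<h (snd (f v)). x (fst (f v)) i * x (fst (f w)) i else (0::real))"
proof -
  let ?M = "\<lambda>v w. if snd (f v) = snd (f w)
      then \<Sum>i<h (snd (f v)). x (fst (f v)) i * x (fst (f w)) i else (0::real)"
  let ?SS = "{S\<in>matchings_of V (snd \<circ> f). \<phi> \<in> alternating V A S}"
  have fA: "fixfree V A" and Aout: "\<And>v. v \<notin> V \<Longrightarrow> A v = v" and ffA: "\<And>v. v \<in> V \<Longrightarrow> f (A v) = f v"
    using A by (auto simp: matchings_of_def matchings_def)
  have finR: "finite R" using V by (simp add: R_def)
  have RV: "v \<in> V" if "v \<in> R" for v using that by (simp add: R_def)
  have AR: "A v \<in> V - R" if "v \<in> R" for v using that \<phi> fA by (auto simp: R_def alternating_def fixfree_def)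
  have AG: "A v \<in> R" if "v \<in> V - R" for v using that \<phi> fA by (auto simp: R_def alternating_def fixfree_def)
  have C: "(\<Sum>c\<in>{c\<in>(\<Pi>\<^sub>E v\<in>V. {..<h (snd (f v))}). S \<in> matchings_of V c}. \<Prod>v\<in>V. x (fst (f v)) (c v)) =
      (\<Prod>v\<in>R. ?M v (red_perm V A S \<phi> v))" if S: "S \<in> ?SS" for S
  proof -
    have fS: "fixfree V S" and Sp: "S \<in> matchings V" and sS: "\<And>v. v \<in> V \<Longrightarrow> snd (f (S v)) = snd (f v)"
      and al: "\<And>v. v \<in> V \<Longrightarrow> \<phi> (S v) \<noteq> \<phi> v"
      using S by (auto simp: matchings_of_def matchings_def alternating_def)
    have SR: "S v \<in> V - R" if "v \<in> R" for v using that al fS by (auto simp: R_def fixfree_def)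
    have SG: "S v \<in> R" if "v \<in> V - R" for v using that al fS by (auto simp: R_def fixfree_def)
    \<comment> \<open>A colouring respected by \<open>S\<close> is determined by its values on the
      red labels, since \<open>S\<close> sends every green label to a red one.\<close>
    have "(\<Sum>c\<in>{c\<in>(\<Pi>\<^sub>E v\<in>V. {..<h (snd (f v))}). S \<in> matchings_of V c}. \<Prod>v\<in>V. x (fst (f v)) (c v)) =
        (\<Sum>d\<in>(\<Pi>\<^sub>E v\<in>R. {..<h (snd (f v))}). \<Prod>v\<in>R. x (fst (f v)) (d v) * x (fst (f (S v))) (d v))"
    proof (rule sum.reindex_bij_witness[where i = "\<lambda>d. restrict (\<lambda>v. if v \<in> R then d v else d (S v)) V"
          and j = "\<lambda>c. restrict c R"])
      fix c assume "c \<in> {c\<in>(\<Pi>\<^sub>E v\<in>V. {..<h (snd (f v))}). S \<in> matchings_of V c}"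
      then have c: "c \<in> (\<Pi>\<^sub>E v\<in>V. {..<h (snd (f v))})" "\<And>v. v \<in> V \<Longrightarrow> c (S v) = c v" by (auto simp: matchings_of_def)
      show "restrict (\<lambda>v. if v \<in> R then restrict c R v else restrict c R (S v)) V = c"
      proof
        fix v show "restrict (\<lambda>v. if v \<in> R then restrict c R v else restrict c R (S v)) V v = c v"
          using c SG by (cases "v \<in> V") (auto simp: PiE_def extensional_def)
      qed
      show "restrict c R \<in> (\<Pi>\<^sub>E v\<in>R. {..<h (snd (f v))})" using c(1) RV by auto
      have VR: "V = R \<union> S ` R" 
      proof -
        have "v \<in> S ` R" if "v \<in> V - R" for v
          using SG[OF that] fpfD(3)[OF fS, of v] that by (metis DiffD1 imageI)
        then show ?thesis using RV SR by auto
      qed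
      have "(\<Prod>v\<in>V. x (fst (f v)) (c v)) = (\<Prod>v\<in>R. x (fst (f v)) (c v)) * (\<Prod>v\<in>S ` R. x (fst (f v)) (c v))"
        by (subst VR, rule prod.union_disjoint) (use finR SR in auto)
      also have "(\<Prod>v\<in>S ` R. x (fst (f v)) (c v)) = (\<Prod>v\<in>R. x (fst (f (S v))) (c v))"
        by (subst prod.reindex) (use c(2) RV fixfree_inj[OF fS] in \<open>auto simp: inj_on_def\<close>)
      finally show "(\<Prod>v\<in>R. x (fst (f v)) (restrict c R v) * x (fst (f (S v))) (restrict c R v)) =
          (\<Prod>v\<in>V. x (fst (f v)) (c v))" by (simp add: prod.distrib)
    next
      fix d assume d: "d \<in> (\<Pi>\<^sub>E v\<in>R. {..<h (snd (f v))})"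
      show "restrict (restrict (\<lambda>v. if v \<in> R then d v else d (S v)) V) R = d"
      proof
        fix v show "restrict (restrict (\<lambda>v. if v \<in> R then d v else d (S v)) V) R v = d v"
          using d RV by (cases "v \<in> R") (auto simp: PiE_def extensional_def)
      qed
      let ?c = "restrict (\<lambda>v. if v \<in> R then d v else d (S v)) V"
      have c: "?c v \<in> {..<h (snd (f v))}" if v: "v \<in> V" for v
      proof (cases "v \<in> R")
        case True then show ?thesis using d v by auto
      next
        case False
        then have "S v \<in> R" using SG v by auto
        then have "d (S v) \<in> {..<h (snd (f (S v)))}" using d by auto
        then show ?thesis using False v sS by simp
      qed
      have "?c \<in> (\<Pi>\<^sub>E v\<in>V. {..<h (snd (f v))})" by (rule PiE_I, rule c, assumption, simp)
      moreover have "?c (S v) = ?c v" if v: "v \<in> V" for v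
      proof (cases "v \<in> R")
        case True then show ?thesis using SR[OF True] v fpfD(3)[OF fS v] by auto
      next
        case False then show ?thesis using SG[of v] v RV by auto
      qed
      ultimately show "?c \<in> {c\<in>(\<Pi>\<^sub>E v\<in>V. {..<h (snd (f v))}). S \<in> matchings_of V c}"
        using Sp by (simp add: matchings_of_def)
    qed
    also have "\<dots> = (\<Prod>v\<in>R. \<Sum>i<h (snd (f v)). x (fst (f v)) i * x (fst (f (S v))) i)"
      by (rule prod_sum_PiE[symmetric]) (use finR in auto)
    also have "\<dots> = (\<Prod>v\<in>R. ?M v (red_perm V A S \<phi> v))"
    proof (rule prod.cong[OF refl])
      fix v assume v: "v \<in> R"
      have Sv: "S v \<in> V" using SR[OF v] by auto
      have "red_perm V A S \<phi> v = A (S v)" using v by (simp add: red_perm_def R_def)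
      then show "(\<Sum>i<h (snd (f v)). x (fst (f v)) i * x (fst (f (S v))) i) = ?M v (red_perm V A S \<phi> v)"
        using ffA[OF Sv] sS[OF RV[OF v]] by simp
    qed
    finally show ?thesis .
  qed
  have "(\<Sum>S\<in>?SS. of_int (sign (red_perm V A S \<phi>)) *
      (\<Sum>c\<in>{c\<in>(\<Pi>\<^sub>E v\<in>V. {..<h (snd (f v))}). S \<in> matchings_of V c}. \<Prod>v\<in>V. x (fst (f v)) (c v))) =
    (\<Sum>S\<in>?SS. of_int (sign (red_perm V A S \<phi>)) * (\<Prod>v\<in>R. ?M v (red_perm V A S \<phi> v)))"
    by (rule sum.cong[OF refl]) (simp only: C)
  \<comment> \<open>\<open>S\<close> is recovered from p: it is \<open>A\<close> after p on red
    labels, and the inverse of p after \<open>A\<close> on green ones.\<close>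
  also have "\<dots> = (\<Sum>p\<in>{p. p permutes R \<and> (\<forall>v\<in>R. snd (f (p v)) = snd (f v))}. of_int (sign p) * (\<Prod>v\<in>R. ?M v (p v)))"
  proof (rule sum.reindex_bij_witness[where j = "\<lambda>S. red_perm V A S \<phi>"
        and i = "\<lambda>p v. if v \<in> R then A (p v) else if v \<in> V then inv_into UNIV p (A v) else v"])
    fix S assume S: "S \<in> ?SS"
    then have fS: "fixfree V S" and sS: "\<And>v. v \<in> V \<Longrightarrow> snd (f (S v)) = snd (f v)"
      and al: "\<And>v. v \<in> V \<Longrightarrow> \<phi> (S v) \<noteq> \<phi> v" and out: "\<And>v. v \<notin> V \<Longrightarrow> S v = v"
      and alt: "\<forall>x\<in>V. \<phi> (A x) \<noteq> \<phi> x \<and> \<phi> (S x) \<noteq> \<phi> x"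
      by (auto simp: matchings_of_def matchings_def alternating_def)
    let ?p = "red_perm V A S \<phi>"
    have p: "?p permutes R" using red_perm_permutes[OF fA fS alt] by (simp add: R_def)
    have pR: "?p v = A (S v)" if "v \<in> R" for v using that by (simp add: red_perm_def R_def)
    show "(\<lambda>v. if v \<in> R then A (?p v) else if v \<in> V then inv_into UNIV ?p (A v) else v) = S"
    proof
      fix v
      consider "v \<in> R" | "v \<in> V - R" | "v \<notin> V" using RV by auto
      then show "(if v \<in> R then A (?p v) else if v \<in> V then inv_into UNIV ?p (A v) else v) = S v"
      proof cases
        case 1
        then show ?thesis using pR fpfD[OF fA] fpfD(1)[OF fS] RV by simp
      next
        case 2
        then have "S v \<in> R" using al fS by (auto simp: R_def fixfree_def)
        then have "?p (S v) = A v" using pR 2 fpfD(3)[OF fS] by simp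
        then have "inv_into UNIV ?p (A v) = S v" using permutes_inv_eq[OF p] by simp
        then show ?thesis using 2 by simp
      next
        case 3
        then show ?thesis using out RV by auto
      qed
    qed
    have "snd (f (?p v)) = snd (f v)" if "v \<in> R" for v
      using pR[OF that] ffA[of "S v"] sS[of v] RV[OF that] fpfD(1)[OF fS] by simp
    then show "?p \<in> {p. p permutes R \<and> (\<forall>v\<in>R. snd (f (p v)) = snd (f v))}" using p by simp
  next
    fix p assume "p \<in> {p. p permutes R \<and> (\<forall>v\<in>R. snd (f (p v)) = snd (f v))}"
    then have p: "p permutes R" and sp: "\<And>v. v \<in> R \<Longrightarrow> snd (f (p v)) = snd (f v)" by auto
    let ?q = "inv_into UNIV p"
    let ?S = "\<lambda>v. if v \<in> R then A (p v) else if v \<in> V then ?q (A v) else v"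
    have pin: "p v \<in> R" "?q v \<in> R" if "v \<in> R" for v
      using that permutes_in_image[OF p] permutes_in_image[OF permutes_inv[OF p]] by auto
    have pq: "p (?q v) = v" "?q (p v) = v" for v using permutes_inverses[OF p] by auto
    have SR: "?S v \<in> V - R" if "v \<in> R" for v using that AR[OF pin(1)[OF that]] by simp
    have SG: "?S v \<in> R" if "v \<in> V - R" for v using that pin(2)[OF AG[OF that]] by simp
    have SS: "?S (?S v) = v" if "v \<in> V" for v
    proof (cases "v \<in> R")
      case True
      then show ?thesis using SR[OF True] pq fpfD(3)[OF fA RV[OF pin(1)[OF True]]] by auto
    next
      case False
      then have v: "v \<in> V - R" using that by simp
      show ?thesis using SG[OF v] v pq fpfD(3)[OF fA that] by auto
    qed
    have Spp: "?S \<in> matchings V"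
    proof -
      have "?S v \<in> V \<and> ?S v \<noteq> v" if "v \<in> V" for v
      proof (cases "v \<in> R")
        case True then show ?thesis using SR[OF True] by auto
      next
        case False then show ?thesis using SG[of v] that RV by auto
      qed
      then show ?thesis using SS RV unfolding matchings_def fixfree_def by auto
    qed
    have "snd (f (?S v)) = snd (f v)" if v: "v \<in> V" for v
    proof (cases "v \<in> R")
      case True
      then show ?thesis using ffA[OF RV[OF pin(1)[OF True]]] sp by simp
    next
      case False
      then have "A v \<in> R" using AG v by auto
      then show ?thesis using sp[of "?q (A v)"] pin pq ffA[OF v] False v by simp
    qed
    then have Sf: "?S \<in> matchings_of V (snd \<circ> f)" using Spp by (simp add: matchings_of_def)
    have "\<phi> (?S v) \<noteq> \<phi> v" if v: "v \<in> V" for v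
    proof (cases "v \<in> R")
      case True
      then have "\<not> \<phi> (?S v)" using SR[OF True] by (auto simp: R_def)
      then show ?thesis using True by (simp add: R_def)
    next
      case False
      then have "\<phi> (?S v)" using SG[of v] v by (auto simp: R_def)
      then show ?thesis using False v by (simp add: R_def)
    qed
    then have "\<phi> \<in> alternating V A ?S" using \<phi> by (simp add: alternating_def)
    then show "?S \<in> ?SS" using Sf by simp
    show "red_perm V A ?S \<phi> = p"
    proof
      fix v show "red_perm V A ?S \<phi> v = p v"
      proof (cases "v \<in> R")
        case True
        then have "red_perm V A ?S \<phi> v = A (A (p v))" by (simp add: red_perm_def R_def)
        then show ?thesis using fpfD(3)[OF fA RV[OF pin(1)[OF True]]] by simp
      next
        case False
        then show ?thesis using permutes_not_in[OF p False] by (auto simp: red_perm_def R_def)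
      qed
    qed
  qed auto
  \<comment> \<open>Permutations that do not preserve the columns meet a zero entry and may be
    added.\<close>
  also have "\<dots> = set_det R ?M" unfolding set_det_def
  proof (rule sum.mono_neutral_left)
    show "\<forall>p\<in>{p. p permutes R} - {p. p permutes R \<and> (\<forall>v\<in>R. snd (f (p v)) = snd (f v))}.
        of_int (sign p) * (\<Prod>v\<in>R. ?M v (p v)) = 0"
    proof
      fix p assume "p \<in> {p. p permutes R} - {p. p permutes R \<and> (\<forall>v\<in>R. snd (f (p v)) = snd (f v))}"
      then obtain v where "v \<in> R" "snd (f v) \<noteq> snd (f (p v))" by auto
      then have "(\<Prod>v\<in>R. ?M v (p v)) = 0" using finR by (intro prod_zero) auto
      then show "of_int (sign p) * (\<Prod>v\<in>R. ?M v (p v)) = 0" by simp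
    qed
  qed (use finR in \<open>auto intro: finite_permutations\<close>)
  finally show ?thesis .
qed

text \<open>Boxes in different columns do not interact, so the determinant splits. The block of a
  column of height h is the Gram matrix of the first h rows of \<open>y\<close>, cut off after h
  entries.\<close>

lemma set_det_boxes:
  assumes la: "la \<in> partitions n"
  shows "set_det (boxes la) (\<lambda>a b. if snd a = snd b
      then \<Sum>i<conj_len la (snd a). y (fst a) i * y (fst b) i else 0) =
    (\<Prod>j<n. (set_det {..<conj_len la j} y)\<^sup>2)"
proof -
  define M where "M a b = (if snd a = snd b
      then \<Sum>i<conj_len la (snd a). y (fst a) i * y (fst b) i else 0)" for a b :: "nat \<times> nat"
  define B where "B t = {b\<in>boxes la. snd b < t}" for t
  have finB: "finite (B t)" for t by (simp add: B_def)
  have "set_det (B t) M = (\<Prod>j<t. (set_det {..<conj_len la j} y)\<^sup>2)" for t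
  proof (induction t)
    case 0
    then show ?case by (simp add: B_def)
  next
    case (Suc t)
    let ?C = "(\<lambda>i. (i, t)) ` {..<conj_len la t}"
    have "B (Suc t) = B t \<union> ?C"
      using boxes_iff_conj_len[OF la] by (auto simp: B_def less_Suc_eq)
    moreover have "set_det (B t \<union> ?C) M = set_det (B t) M * set_det ?C M"
      by (rule set_det_union) (use finB in \<open>auto simp: B_def M_def\<close>)
    moreover have "set_det ?C M = set_det {..<conj_len la t} (\<lambda>i i'. M (i, t) (i', t))"
      by (rule set_det_transport) (auto simp: bij_betw_def inj_on_def)
    moreover have "\<dots> = (set_det {..<conj_len la t} y)\<^sup>2"
      unfolding M_def by (simp add: set_det_Gram)
    ultimately show ?case using Suc by simp
  qed
  moreover have "B n = boxes la"
    using part_le[OF la] by (fastforce simp: B_def boxes_def)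
  ultimately have "set_det (boxes la) M = (\<Prod>j<n. (set_det {..<conj_len la j} y)\<^sup>2)" by metis
  then show ?thesis unfolding M_def[abs_def] .
qed

text \<open>Each box holds two labels matched by \<open>A\<close>, one red and one green.\<close>

lemma red_bij:
  assumes V: "finite V" and f: "f \<in> standard V la" and A: "A \<in> matchings_of V f" and \<phi>: "\<phi> \<in> alternating V A A"
  shows "bij_betw f {v\<in>V. \<phi> v} (boxes la)"
proof -
  have fA: "fixfree V A" and fA': "\<And>v. v \<in> V \<Longrightarrow> f (A v) = f v" and al: "\<And>v. v \<in> V \<Longrightarrow> \<phi> (A v) \<noteq> \<phi> v"
    using A \<phi> by (auto simp: matchings_of_def matchings_def alternating_def)
  have fib: "{w\<in>V. f w = f v} = {v, A v}" if "v \<in> V" for v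
    by (rule two_to_one_fibre[OF V f[unfolded standard_two_to_one] that])
      (use fpfD[OF fA that] fA'[OF that] in auto)
  show ?thesis unfolding bij_betw_def
  proof
    show "inj_on f {v\<in>V. \<phi> v}"
    proof (rule inj_onI)
      fix v w assume vw: "v \<in> {v\<in>V. \<phi> v}" "w \<in> {v\<in>V. \<phi> v}" "f v = f w"
      then have "w \<in> {v, A v}" using fib[of v] by auto
      then show "v = w" using vw al[of v] by auto
    qed
    show "f ` {v\<in>V. \<phi> v} = boxes la"
    proof
      show "f ` {v\<in>V. \<phi> v} \<subseteq> boxes la" using f by (auto simp: standard_def)
      show "boxes la \<subseteq> f ` {v\<in>V. \<phi> v}"
      proof
        fix b assume "b \<in> boxes la"
        then have "card {v\<in>V. f v = b} = 2" using f by (auto simp: standard_def)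
        then have "{v\<in>V. f v = b} \<noteq> {}" by (intro notI) (simp only: card.empty)
        then obtain v where v: "v \<in> V" "f v = b" by auto
        show "b \<in> f ` {v\<in>V. \<phi> v}"
        proof (cases "\<phi> v")
          case True then show ?thesis using v by auto
        next
          case False
          then have "A v \<in> {v\<in>V. \<phi> v}" "f (A v) = b" using v al[of v] fA' fpfD(1)[OF fA] by auto
          then show ?thesis by (metis imageI)
        qed
      qed
    qed
  qed
qed

text \<open>Once the weights are spread over colourings, each of the 2^n colourings alternating
  along \<open>A\<close> gives the same determinant.\<close>

lemma weighted_matchings_determinant:
  assumes la: "la \<in> partitions n" and V: "finite V" "card V = 2 * n"
    and f: "f \<in> standard V la" and A: "A \<in> matchings_of V f"
  shows "(-1) ^ n * (\<Sum>S\<in>matchings_of V (snd \<circ> f). weight V A S *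
      (\<Sum>c\<in>{c\<in>(\<Pi>\<^sub>E v\<in>V. {..<conj_len la (snd (f v))}). S \<in> matchings_of V c}. \<Prod>v\<in>V. y (fst (f v)) (c v))) =
    2 ^ n * (\<Prod>j<n. (set_det {..<conj_len la j} y)\<^sup>2)"
proof -
  let ?C = "\<lambda>S. \<Sum>c\<in>{c\<in>(\<Pi>\<^sub>E v\<in>V. {..<conj_len la (snd (f v))}). S \<in> matchings_of V c}. \<Prod>v\<in>V. y (fst (f v)) (c v)"
  let ?AA = "alternating V A A"
  have Ap: "A \<in> matchings V" by (rule matchings_of_matchings[OF A])
  have cAA: "card ?AA = 2 ^ n"
    using card_alternating[OF V(1) matchings_fixfree[OF Ap] matchings_fixfree[OF Ap]] num_loops_self[OF V(1) matchings_fixfree[OF Ap]] V(2) by simp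
  have finAA: "finite ?AA" by (rule card_ge_0_finite) (simp add: cAA)
  have "(-1) ^ n * (\<Sum>S\<in>matchings_of V (snd \<circ> f). weight V A S * ?C S) =
      (\<Sum>S\<in>matchings_of V (snd \<circ> f). ((-1) ^ n * weight V A S) * ?C S)"
    by (simp add: sum_distrib_left mult.assoc)
  also have "\<dots> = (\<Sum>S\<in>matchings_of V (snd \<circ> f). \<Sum>\<phi>\<in>alternating V A S. of_int (sign (red_perm V A S \<phi>)) * ?C S)"
    by (intro sum.cong refl) (simp add: weight_sign_sum[OF V Ap matchings_of_matchings] sum_distrib_right)
  also have "\<dots> = (\<Sum>S\<in>matchings_of V (snd \<circ> f). \<Sum>\<phi>\<in>?AA. if \<phi> \<in> alternating V A S
      then of_int (sign (red_perm V A S \<phi>)) * ?C S else 0)"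
    by (intro sum.cong refl sum.mono_neutral_cong_left) (use finAA alternating_sub in auto)
  also have "\<dots> = (\<Sum>\<phi>\<in>?AA. \<Sum>S\<in>matchings_of V (snd \<circ> f). if \<phi> \<in> alternating V A S
      then of_int (sign (red_perm V A S \<phi>)) * ?C S else 0)"
    by (rule sum.swap)
  also have "\<dots> = (\<Sum>\<phi>\<in>?AA. \<Sum>S\<in>{S\<in>matchings_of V (snd \<circ> f). \<phi> \<in> alternating V A S}.
      of_int (sign (red_perm V A S \<phi>)) * ?C S)"
    by (intro sum.cong refl sum.inter_filter[symmetric]) (use V in simp)
  also have "\<dots> = (\<Sum>\<phi>\<in>?AA. \<Prod>j<n. (set_det {..<conj_len la j} y)\<^sup>2)"
  proof (rule sum.cong[OF refl])
    fix \<phi> assume \<phi>: "\<phi> \<in> ?AA"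
    have "(\<Sum>S\<in>{S\<in>matchings_of V (snd \<circ> f). \<phi> \<in> alternating V A S}. of_int (sign (red_perm V A S \<phi>)) * ?C S) =
        set_det {v\<in>V. \<phi> v} (\<lambda>v w. if snd (f v) = snd (f w)
          then \<Sum>i<conj_len la (snd (f v)). y (fst (f v)) i * y (fst (f w)) i else 0)"
      by (rule matchings_determinant[OF V(1) A \<phi>])
    also have "\<dots> = set_det (boxes la) (\<lambda>a b. if snd a = snd b
      then \<Sum>i<conj_len la (snd a). y (fst a) i * y (fst b) i else 0)"
      by (rule set_det_transport[OF red_bij[OF V(1) f A \<phi>], symmetric]) (use V in simp)
    also have "\<dots> = (\<Prod>j<n. (set_det {..<conj_len la j} y)\<^sup>2)" by (rule set_det_boxes[OF la])
    finally show "(\<Sum>S\<in>{S\<in>matchings_of V (snd \<circ> f). \<phi> \<in> alternating V A S}. of_int (sign (red_perm V A S \<phi>)) * ?C S) =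
        (\<Prod>j<n. (set_det {..<conj_len la j} y)\<^sup>2)" .
  qed
  also have "\<dots> = 2 ^ n * (\<Prod>j<n. (set_det {..<conj_len la j} y)\<^sup>2)" by (simp add: cAA)
  finally show ?thesis .
qed

text \<open>\<open>row_sum\<close> counts matchings that respect row and colour, which by Wick's
  formula is a moment in variables indexed by (row, colour). The signed sum over the columns is then
  carried out inside the expectation, where it produces squared minors.\<close>

lemma sum_contents_hook:
  assumes la: "la \<in> partitions n" and p: "p \<in> tableaux (labels n) la"
  shows "(-1) ^ n * (\<Sum>c\<in>contents n la. col_sum (labels n) p c * row_sum (labels n) p c) = 2 ^ n * hook_c 2 la"
proof -
  let ?N = "labels n"
  obtain f A where p': "p = (f, A)" by fastforce
  have f: "f \<in> standard ?N la" and A: "A \<in> matchings_of ?N f" using p by (auto simp: tableaux_def p')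
  have Ap: "A \<in> matchings ?N" by (rule matchings_of_matchings[OF A])
  let ?h = "\<lambda>v. conj_len la (snd (f v))"
  let ?P = "\<Pi>\<^sub>E v\<in>?N. {..<?h v}"
  define m where "m = length la"
  \<comment> \<open>Room for one factor per label in Wick's formula, and for the degrees met while
    columns are removed.\<close>
  define D where "D = (2 * n + 1) * m + 2 * n"
  let ?I = "{..<m} \<times> {..<m}"
  have finP: "finite ?P" by (intro finite_PiE) auto
  have hm: "?h v \<le> m" for v using conj_len_le by (simp add: m_def)
  have mem: "c \<in> contents n la \<longleftrightarrow> c \<in> ?P" if "col_sum ?N (f, A) c \<noteq> 0" for c
  proof -
    have "content ?N c la \<longleftrightarrow> (\<forall>v\<in>?N. c v < ?h v)"
      by (rule col_sum_content_iff[OF la finite_labels f Ap that])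
    moreover have "\<forall>v\<in>?N. c v < length la" if "\<forall>v\<in>?N. c v < ?h v"
      using that conj_len_le by (meson less_le_trans)
    ultimately show ?thesis by (auto simp: contents_def PiE_iff)
  qed
  have row: "row_sum ?N (f, A) c = expect D ?I (\<lambda>x. \<Prod>v\<in>?N. x (fst (f v), c v))" if c: "c \<in> ?P" for c
  proof -
    have "expect D ?I (\<lambda>x. \<Prod>v\<in>?N. x ((\<lambda>v. (fst (f v), c v)) v)) = real (card (matchings_of ?N (\<lambda>v. (fst (f v), c v))))"
    proof (rule expect_matchings)
      show "(\<lambda>v. (fst (f v), c v)) ` ?N \<subseteq> ?I"
      proof safe
        fix v assume v: "v \<in> ?N"
        show "fst (f v) < m" using standard_fst_less[OF la f v] hm[of v] by simp
        have "c v < ?h v" using c v by auto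
        then show "c v < m" using hm[of v] by simp
      qed
    qed (auto simp: D_def)
    then show ?thesis by (simp add: row_sum_eq)
  qed
  have "(\<Sum>c\<in>contents n la. col_sum ?N (f, A) c * row_sum ?N (f, A) c) =
      (\<Sum>c\<in>{c\<in>contents n la. col_sum ?N (f, A) c \<noteq> 0}. col_sum ?N (f, A) c * row_sum ?N (f, A) c)"
    by (rule sum.mono_neutral_right) auto
  \<comment> \<open>The two index sets for \<open>c\<close> agree wherever the column sum is
    nonzero, so one may be exchanged for the other.\<close>
  also have "{c\<in>contents n la. col_sum ?N (f, A) c \<noteq> 0} = {c\<in>?P. col_sum ?N (f, A) c \<noteq> 0}"
    using mem by blast
  also have "(\<Sum>c\<in>{c\<in>?P. col_sum ?N (f, A) c \<noteq> 0}. col_sum ?N (f, A) c * row_sum ?N (f, A) c) =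
      (\<Sum>c\<in>?P. col_sum ?N (f, A) c * row_sum ?N (f, A) c)"
    by (rule sum.mono_neutral_left) (use finP in auto)
  also have "\<dots> = (\<Sum>c\<in>?P. \<Sum>S\<in>matchings_of ?N (snd \<circ> f). if S \<in> matchings_of ?N c
      then weight ?N A S * expect D ?I (\<lambda>x. \<Prod>v\<in>?N. x (fst (f v), c v)) else 0)"
  proof (rule sum.cong[OF refl])
    fix c assume c: "c \<in> ?P"
    have "{S\<in>matchings_of ?N (snd \<circ> f). S \<in> matchings_of ?N c} = matchings_of ?N (\<lambda>v. (snd (f v), c v))" by (auto simp: matchings_of_def)
    then have "col_sum ?N (f, A) c = (\<Sum>S\<in>matchings_of ?N (snd \<circ> f). if S \<in> matchings_of ?N c then weight ?N A S else 0)"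
      unfolding col_sum_eq[OF finite_labels] by (simp add: sum.inter_filter[symmetric])
    then show "col_sum ?N (f, A) c * row_sum ?N (f, A) c =
        (\<Sum>S\<in>matchings_of ?N (snd \<circ> f). if S \<in> matchings_of ?N c
          then weight ?N A S * expect D ?I (\<lambda>x. \<Prod>v\<in>?N. x (fst (f v), c v)) else 0)"
      by (simp add: row[OF c] sum_distrib_right if_distrib[of "\<lambda>y. y * _"] cong: if_cong)
  qed
  also have "\<dots> = (\<Sum>S\<in>matchings_of ?N (snd \<circ> f). \<Sum>c\<in>?P. if S \<in> matchings_of ?N c
      then weight ?N A S * expect D ?I (\<lambda>x. \<Prod>v\<in>?N. x (fst (f v), c v)) else 0)"
    by (rule sum.swap)
  also have "\<dots> = (\<Sum>S\<in>matchings_of ?N (snd \<circ> f). \<Sum>c\<in>{c\<in>?P. S \<in> matchings_of ?N c}.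
      weight ?N A S * expect D ?I (\<lambda>x. \<Prod>v\<in>?N. x (fst (f v), c v)))"
    by (intro sum.cong refl sum.inter_filter[symmetric] finP)
  also have "\<dots> = expect D ?I (\<lambda>x. \<Sum>S\<in>matchings_of ?N (snd \<circ> f). weight ?N A S *
      (\<Sum>c\<in>{c\<in>?P. S \<in> matchings_of ?N c}. \<Prod>v\<in>?N. x (fst (f v), c v)))"
    by (simp add: expect_sum expect_cmult sum_distrib_left)
  finally have "(-1) ^ n * (\<Sum>c\<in>contents n la. col_sum ?N (f, A) c * row_sum ?N (f, A) c) =
      expect D ?I (\<lambda>x. (-1) ^ n * (\<Sum>S\<in>matchings_of ?N (snd \<circ> f). weight ?N A S *
        (\<Sum>c\<in>{c\<in>?P. S \<in> matchings_of ?N c}. \<Prod>v\<in>?N. curry x (fst (f v)) (c v))))"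
    by (simp add: expect_cmult)
  also have "\<dots> = expect D ?I (\<lambda>x. 2 ^ n * (\<Prod>j<n. (set_det {..<conj_len la j} (curry x))\<^sup>2))"
    by (simp only: weighted_matchings_determinant[OF la finite_labels card_labels f A])
  also have "\<dots> = 2 ^ n * hook_c 2 la"
  proof -
    have "expect D ?I (\<lambda>x. \<Prod>j<n. (set_det {..<conj_len la j} (curry x))\<^sup>2) = hook_c 2 la"
      by (rule expect_hook[OF la]) (simp_all add: m_def D_def)
    then show ?thesis by (simp add: expect_cmult)
  qed
  finally show ?thesis by (simp add: p')
qed

text \<open>There are (2n)!/2^n tableaux, and each contributes 2^n times the hook product; the
  prefactor of \<open>zonal\<close> cancels (2n)!.\<close>

lemma m_coeff_zonal_diag:
  assumes la: "la \<in> partitions n"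
  shows "m_coeff n (\<lambda>\<rho>. zonal n \<rho> la) la = hook_c 2 la"
proof -
  have "m_coeff n (\<lambda>\<rho>. zonal n \<rho> la) la = 1 / fact (2 * n) *
    (\<Sum>p\<in>tableaux (labels n) la. (-1) ^ n * (\<Sum>c\<in>contents n la. col_sum (labels n) p c * row_sum (labels n) p c))"
    unfolding m_coeff_zonal[OF la] by (simp add: sum_distrib_left)
  also have "\<dots> = 1 / fact (2 * n) * (\<Sum>p\<in>tableaux (labels n) la. 2 ^ n * hook_c 2 la)"
    by (simp only: sum_contents_hook[OF la] cong: sum.cong)
  also have "\<dots> = 1 / fact (2 * n) * (real (card (tableaux (labels n) la)) * 2 ^ n) * hook_c 2 la"
    by simp
  also have "\<dots> = hook_c 2 la" unfolding card_tableaux[OF la] by simp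
  finally show ?thesis .
qed

lemma jack_family_zonal: "jack_family 2 n (zonal n)"
  unfolding jack_family_def
  using zonal_orthogonal[of _ n] m_coeff_zonal_triangular[of _ n] m_coeff_zonal_diag[of _ n]
  by (auto simp: zonal_def)

lemma zonal_theta_eq:
  assumes "is_partition la"
  shows "zonal_theta \<rho> la = zonal (sum_list la) \<rho> la"
proof -
  have "(THE \<theta>. jack_family 2 (sum_list la) \<theta>) = zonal (sum_list la)"
  proof (rule the_equality)
    show "jack_family 2 (sum_list la) (zonal (sum_list la))" by (rule jack_family_zonal)
    show "\<theta> = zonal (sum_list la)" if "jack_family 2 (sum_list la) \<theta>" for \<theta>
      by (rule jack_family_unique[OF that jack_family_zonal]) simp
  qed
  then show ?thesis by (simp add: jack_theta_def)
qed

section \<open>Adding common pairs\<close>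

text \<open>The fillings that survive the cancellation. \<open>S\<close> and \<open>T\<close> enter
  only through their values on \<open>V\<close>, and the boxes form an arbitrary set, so pairs can
  be removed one at a time.\<close>

definition good :: "nat set \<Rightarrow> (nat \<Rightarrow> nat) \<Rightarrow> (nat \<Rightarrow> nat) \<Rightarrow> (nat \<times> nat) set \<Rightarrow> (nat \<Rightarrow> nat \<times> nat) set" where
  "good V S T B = {f \<in> V \<rightarrow>\<^sub>E B. (\<forall>v\<in>V. snd (f (S v)) = snd (f v) \<and> fst (f (T v)) = fst (f v)) \<and>
     (\<forall>y. card {v\<in>V. f v = y} \<le> 2)}"

definition box_filling_sum :: "nat set \<Rightarrow> (nat \<Rightarrow> nat) \<Rightarrow> (nat \<Rightarrow> nat) \<Rightarrow> (nat \<times> nat) set \<Rightarrow> real" where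
  "box_filling_sum V S T B = (\<Sum>f\<in>good V S T B. \<Sum>A\<in>matchings_of V f. weight V A S)"

lemma finite_good [simp]: "finite V \<Longrightarrow> finite B \<Longrightarrow> finite (good V S T B)"
  by (rule finite_subset[of _ "V \<rightarrow>\<^sub>E B"]) (auto simp: good_def intro: finite_PiE)

lemma matchings_of_cong:
  assumes "\<And>v. v \<in> V \<Longrightarrow> f v = g v"
  shows "matchings_of V f = matchings_of V g"
proof -
  have "f (S v) = f v \<longleftrightarrow> g (S v) = g v" if "S \<in> matchings V" "v \<in> V" for S v
    using assms[OF that(2)] assms[OF fpfD(1)[OF matchings_fixfree[OF that(1)] that(2)]] by simp
  then show ?thesis by (auto simp: matchings_of_def)
qed

lemma good_fibre: "f \<in> good V S T B \<Longrightarrow> card {v\<in>V. f v = y} \<le> 2"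
  unfolding good_def by blast

lemma weight_cong: "(\<And>v. v \<in> V \<Longrightarrow> S v = S' v) \<Longrightarrow> weight V A S = weight V A S'"
  unfolding weight_def using orbs_cong[of V A A S S'] by simp

lemma box_filling_sum_cong:
  assumes "fixfree V S" "fixfree V T" "\<And>v. v \<in> V \<Longrightarrow> S v = S' v" "\<And>v. v \<in> V \<Longrightarrow> T v = T' v"
  shows "box_filling_sum V S T B = box_filling_sum V S' T' B"
proof -
  have "good V S T B = good V S' T' B" unfolding good_def using assms(3,4) by simp
  then show ?thesis unfolding box_filling_sum_def using weight_cong[of V S S'] assms(3) by simp
qed

lemma filling_sum_eq_box_filling_sum:
  assumes V: "finite V" and S: "S \<in> matchings V" and T: "T \<in> matchings V"
  shows "filling_sum V S T la = box_filling_sum V S T (boxes la)"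
proof -
  have "filling_sum V S T la = (\<Sum>f\<in>{f\<in>fillings V S T la. \<forall>y. card {v\<in>V. f v = y} \<le> 2}. \<Sum>A\<in>matchings_of V f. weight V A S)"
    unfolding filling_sum_def
  proof (rule sum.mono_neutral_right)
    show "\<forall>f\<in>fillings V S T la - {f\<in>fillings V S T la. \<forall>y. card {v\<in>V. f v = y} \<le> 2}.
        (\<Sum>A\<in>matchings_of V f. weight V A S) = 0"
    proof
      fix f assume "f \<in> fillings V S T la - {f\<in>fillings V S T la. \<forall>y. card {v\<in>V. f v = y} \<le> 2}"
      then obtain y where "card {v\<in>V. f v = y} > 2" by (auto simp: not_le)
      then show "(\<Sum>A\<in>matchings_of V f. weight V A S) = 0"
        unfolding weight_def by (rule sum_matchings_of_neg2_power_eq_0[OF V matchings_fixfree[OF S]])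
    qed
  qed (use V in auto)
  also have "{f\<in>fillings V S T la. \<forall>y. card {v\<in>V. f v = y} \<le> 2} = good V S T (boxes la)"
    using S T by (auto simp: fillings_def good_def matchings_of_def)
  finally show ?thesis by (simp add: box_filling_sum_def)
qed

text \<open>A compatible matching provides a partner in every occupied box, so each occupied box
  holds exactly two labels.\<close>

lemma good_card_image:
  assumes V: "finite V" and f: "f \<in> good V S T B" and ne: "matchings_of V f \<noteq> {}"
  shows "card V = 2 * card (f ` V)"
proof -
  obtain A where A: "A \<in> matchings_of V f" using ne by auto
  have two: "card {v\<in>V. f v = y} = 2" if y: "y \<in> f ` V" for y
  proof -
    obtain v where v: "v \<in> V" "y = f v" using y by auto
    have "A v \<in> V" "A v \<noteq> v" "f (A v) = f v" using A v by (auto simp: matchings_of_def matchings_def fixfree_def)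
    then have "card {v, A v} \<le> card {w\<in>V. f w = y}" using v V by (intro card_mono) auto
    moreover have "card {w\<in>V. f w = y} \<le> 2" by (rule good_fibre[OF f])
    ultimately show ?thesis using \<open>A v \<noteq> v\<close> by simp
  qed
  have "V = (\<Union>y\<in>f ` V. {v\<in>V. f v = y})" by auto
  then have "card V = (\<Sum>y\<in>f ` V. card {v\<in>V. f v = y})"
    using V by (subst card_UN_disjoint[symmetric]) auto
  then show ?thesis using two by simp
qed

text \<open>There are too few boxes for two labels each; this is the range in which
  \<open>Sigma2\<close> is 0 by definition.\<close>

lemma filling_sum_too_many:
  assumes V: "finite V" "card V > 2 * sum_list la" and S: "S \<in> matchings V" and T: "T \<in> matchings V"
  shows "filling_sum V S T la = 0"
proof -
  have "matchings_of V f = {}" if f: "f \<in> good V S T (boxes la)" for f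
  proof (rule ccontr)
    assume "matchings_of V f \<noteq> {}"
    then have "card V = 2 * card (f ` V)" by (rule good_card_image[OF V(1) f])
    moreover have "card (f ` V) \<le> card (boxes la)"
      using f by (intro card_mono) (auto simp: good_def)
    ultimately show False using V(2) by (simp add: card_boxes)
  qed
  then show ?thesis unfolding filling_sum_eq_box_filling_sum[OF V(1) S T] box_filling_sum_def by simp
qed

text \<open>A common pair of \<open>S\<close> and \<open>T\<close> must be filled by one box, which no other pair can use.\<close>

lemma box_filling_sum_common_pair:
  assumes V: "finite V" and B: "finite B" and S: "fixfree V S" and T: "fixfree V T"
    and ab: "a \<in> V" "S a = b" "T a = b"
  shows "box_filling_sum V S T B = -2 * (real (card B) - real (card (V - {a, b}) div 2)) * box_filling_sum (V - {a, b}) S T B"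
proof -
  let ?V' = "V - {a, b}"
  let ?u = "\<lambda>f. f(a := undefined, b := undefined)"
  have b: "b \<in> V" "b \<noteq> a" "S b = a" "T b = a" using S T ab by (auto simp: fixfree_def)
  have S': "S v \<in> ?V'" "T v \<in> ?V'" if "v \<in> ?V'" for v
    using fixfree_delete[OF S ab(1)] fixfree_delete[OF T ab(1)] that ab by (auto simp: fixfree_def)
  \<comment> \<open>\<open>b\<close> is the only possible partner of \<open>a\<close>, and the pair
    is shared with \<open>S\<close>, so it closes a loop and gives the factor -2.\<close>
  have inner: "(\<Sum>A\<in>matchings_of V f. weight V A S) = -2 * (\<Sum>A\<in>matchings_of ?V' f. weight ?V' A S)"
    if f: "f a = f b" "{v\<in>V. f v = f a} = {a, b}" for f :: "nat \<Rightarrow> nat \<times> nat"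
  proof -
    have "{w\<in>V - {a}. f w = f a} = {b}" using f b by auto
    then have "(\<Sum>A\<in>matchings_of V f. weight V A S) = (\<Sum>A\<in>matchings_of ?V' f. weight V (A(a := b, b := a)) S)"
      unfolding sum_matchings_of[OF V ab(1)] by simp
    also have "\<dots> = (\<Sum>A\<in>matchings_of ?V' f. -2 * weight ?V' A S)"
    proof (rule sum.cong[OF refl])
      fix A assume "A \<in> matchings_of ?V' f"
      then have "num_loops V (A(a := b, b := a)) S = Suc (num_loops ?V' A S)"
        using num_loops_upd[OF V ab(1) b(1,2) matchings_of_matchings S] ab(2) by metis
      then show "weight V (A(a := b, b := a)) S = -2 * weight ?V' A S"
        unfolding weight_def by (simp only: power_Suc)
    qed
    finally show ?thesis by (simp add: sum_distrib_left)
  qed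
  have fib: "f a = f b \<and> {v\<in>V. f v = f a} = {a, b}" if f: "f \<in> good V S T B" for f
  proof -
    have eq: "f a = f b" using f ab by (auto simp: good_def prod_eq_iff)
    have "{a, b} = {v\<in>V. f v = f a}"
      using eq ab(1) b V good_fibre[OF f, of "f a"] by (intro card_seteq) auto
    then show ?thesis using eq by simp
  qed
  have matchings_of_u: "matchings_of ?V' (?u f) = matchings_of ?V' f" for f :: "nat \<Rightarrow> nat \<times> nat"
    by (rule matchings_of_cong) simp
  have "box_filling_sum V S T B = (\<Sum>f\<in>good V S T B. -2 * (\<Sum>A\<in>matchings_of ?V' f. weight ?V' A S))"
    unfolding box_filling_sum_def by (rule sum.cong[OF refl], rule inner) (use fib in blast)+
  \<comment> \<open>The common pair may use any box that the other labels leave free.\<close>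
  also have "\<dots> = (\<Sum>(g, y)\<in>Sigma (good ?V' S T B) (\<lambda>g. B - g ` ?V'). -2 * (\<Sum>A\<in>matchings_of ?V' g. weight ?V' A S))"
  proof (rule sum.reindex_bij_witness[where j = "\<lambda>f. (?u f, f a)" and i = "\<lambda>(g, y). g(a := y, b := y)"])
    fix f assume f: "f \<in> good V S T B"
    show "(case (?u f, f a) of (g, y) \<Rightarrow> g(a := y, b := y)) = f" using fib[OF f] by auto
    have u: "?u f v = f v" if "v \<in> ?V'" for v using that by simp
    have "?u f \<in> ?V' \<rightarrow>\<^sub>E B" using f by (auto simp: good_def PiE_def extensional_def)
    moreover have "\<forall>v\<in>?V'. snd (?u f (S v)) = snd (?u f v) \<and> fst (?u f (T v)) = fst (?u f v)"
      using f u S' by (auto simp: good_def)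
    moreover have "card {v\<in>?V'. ?u f v = y} \<le> 2" for y
    proof -
      have "card {v\<in>?V'. ?u f v = y} \<le> card {v\<in>V. f v = y}" using V by (intro card_mono) auto
      also have "\<dots> \<le> 2" by (rule good_fibre[OF f])
      finally show ?thesis .
    qed
    moreover have "f a \<in> B - ?u f ` ?V'"
    proof -
      have neq: "f v \<noteq> f a" if "v \<in> ?V'" for v
      proof
        assume "f v = f a"
        then have "v \<in> {w\<in>V. f w = f a}" using that by simp
        then have "v \<in> {a, b}" unfolding conjunct2[OF fib[OF f]] .
        then show False using that by simp
      qed
      have "f a \<notin> ?u f ` ?V'"
      proof
        assume "f a \<in> ?u f ` ?V'"
        then obtain v where "f a = ?u f v" "v \<in> ?V'" by (rule imageE)
        then show False using u[of v] neq[of v] by simp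
      qed
      moreover have "f a \<in> B" using f ab(1) by (auto simp: good_def)
      ultimately show ?thesis by simp
    qed
    ultimately show "(?u f, f a) \<in> Sigma (good ?V' S T B) (\<lambda>g. B - g ` ?V')" by (simp add: good_def)
    show "(case (?u f, f a) of (g, y) \<Rightarrow> -2 * (\<Sum>A\<in>matchings_of ?V' g. weight ?V' A S)) =
        -2 * (\<Sum>A\<in>matchings_of ?V' f. weight ?V' A S)" by (simp add: matchings_of_u)
  next
    fix p assume "p \<in> Sigma (good ?V' S T B) (\<lambda>g. B - g ` ?V')"
    then obtain g y where p: "p = (g, y)" "g \<in> good ?V' S T B" "y \<in> B" "y \<notin> g ` ?V'" by auto
    let ?f = "g(a := y, b := y)"
    have und: "g a = undefined" "g b = undefined" using p(2) by (auto simp: good_def PiE_def extensional_def)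
    show "(?u (case p of (g, y) \<Rightarrow> g(a := y, b := y)), (case p of (g, y) \<Rightarrow> g(a := y, b := y)) a) = p"
      using p(1) und by (auto simp: fun_eq_iff)
    have u: "?f v = g v" if "v \<in> ?V'" for v using that by simp
    have "?f \<in> V \<rightarrow>\<^sub>E B" using p ab(1) b by (auto simp: good_def PiE_def extensional_def)
    moreover have "snd (?f (S v)) = snd (?f v) \<and> fst (?f (T v)) = fst (?f v)" if v: "v \<in> V" for v
    proof (cases "v \<in> ?V'")
      case True
      then show ?thesis using p(2) S'[OF True] u by (auto simp: good_def)
    next
      case False
      then show ?thesis using v ab b by auto
    qed
    moreover have "card {v\<in>V. ?f v = z} \<le> 2" for z
    proof (cases "z = y")
      case True
      then have "{v\<in>V. ?f v = z} = {a, b}" using p(4) ab(1) b by auto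
      then show ?thesis using b by simp
    next
      case False
      then have "{v\<in>V. ?f v = z} = {v\<in>?V'. g v = z}" by auto
      then show ?thesis using good_fibre[OF p(2)] by simp
    qed
    ultimately show "(case p of (g, y) \<Rightarrow> g(a := y, b := y)) \<in> good V S T B" using p(1) by (simp add: good_def)
  qed
  also have "\<dots> = (\<Sum>g\<in>good ?V' S T B. real (card (B - g ` ?V')) * (-2 * (\<Sum>A\<in>matchings_of ?V' g. weight ?V' A S)))"
    using V B by (subst sum.Sigma[symmetric]) auto
  also have "\<dots> = (\<Sum>g\<in>good ?V' S T B. -2 * (real (card B) - real (card ?V' div 2)) * (\<Sum>A\<in>matchings_of ?V' g. weight ?V' A S))"
  proof (rule sum.cong[OF refl])
    fix g assume g: "g \<in> good ?V' S T B"
    \<comment> \<open>Without a compatible matching both sides are 0; otherwise the other labels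
      occupy half as many boxes as there are labels.\<close>
    show "real (card (B - g ` ?V')) * (-2 * (\<Sum>A\<in>matchings_of ?V' g. weight ?V' A S)) =
        -2 * (real (card B) - real (card ?V' div 2)) * (\<Sum>A\<in>matchings_of ?V' g. weight ?V' A S)"
    proof (cases "matchings_of ?V' g = {}")
      case False
      have sub: "g ` ?V' \<subseteq> B" using g by (auto simp: good_def)
      have d: "card ?V' div 2 = card (g ` ?V')" using good_card_image[OF _ g False] V by simp
      have e: "real (card (B - g ` ?V')) = real (card B) - real (card (g ` ?V'))"
        using card_Diff_subset[OF finite_subset[OF sub B] sub] card_mono[OF B sub] by (simp add: of_nat_diff)
      show ?thesis unfolding d e by (simp only: mult_ac)
    qed simp
  qed
  also have "\<dots> = -2 * (real (card B) - real (card ?V' div 2)) * box_filling_sum ?V' S T B"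
    unfolding box_filling_sum_def by (simp add: sum_distrib_left)
  finally show ?thesis .
qed

text \<open>Beyond \<open>labels k\<close> the pairs are {2m + 1, 2m + 2}, the same for every
  extended matching. Labels start at 1, so 0 is left fixed.\<close>

definition extend :: "nat \<Rightarrow> (nat \<Rightarrow> nat) \<Rightarrow> nat \<Rightarrow> nat" where
  "extend k S v = (if v \<in> labels k then S v else if v = 0 then 0 else if odd v then v + 1 else v - 1)"

lemma labels_Suc: "labels (Suc m) - {2 * m + 1, 2 * m + 2} = labels m"
  "2 * m + 1 \<in> labels (Suc m)" "2 * m + 1 \<notin> labels m" "2 * m + 2 \<notin> labels m"
  by (auto simp: labels_def)

lemma fixfree_extend:
  assumes "fixfree (labels k) S" "k \<le> m"
  shows "fixfree (labels m) (extend k S)"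
  using assms(2)
proof (induction m rule: dec_induct)
  case base
  show ?case using assms(1) by (auto simp: fixfree_def extend_def)
next
  case (step m)
  have "labels (Suc m) = labels m \<union> {2 * m + 1, 2 * m + 2}" by (auto simp: labels_def)
  moreover have "2 * m + 1 \<notin> labels k" "2 * m + 2 \<notin> labels k" using step.hyps by (auto simp: labels_def)
  ultimately show ?case using step.IH by (auto simp: fixfree_def extend_def[of k S "2 * m + 1"]
      extend_def[of k S "2 * m + 2"] extend_def[of k S "Suc (2 * m)"] extend_def[of k S "Suc (Suc (2 * m))"])
qed

lemma extend_pair:
  assumes "k \<le> m"
  shows "extend k S (2 * m + 1) = 2 * m + 2" "extend k S (2 * m + 2) = 2 * m + 1"
  using assms by (auto simp: extend_def labels_def)

text \<open>When the pair {2m + 1, 2m + 2} is added, m boxes are taken, which leaves card B - m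
  choices and a factor -2 for the new loop.\<close>

lemma box_filling_sum_extend:
  assumes S: "fixfree (labels k) S" and T: "fixfree (labels k) T" and B: "finite B" and km: "k \<le> m"
  shows "box_filling_sum (labels m) (extend k S) (extend k T) B =
    (-2) ^ (m - k) * (\<Prod>i\<in>{k..<m}. real (card B) - real i) * box_filling_sum (labels k) S T B"
  using km
proof (induction m rule: dec_induct)
  case base
  have "box_filling_sum (labels k) S T B = box_filling_sum (labels k) (extend k S) (extend k T) B"
    by (rule box_filling_sum_cong[OF S T]) (auto simp: extend_def)
  then show ?case by simp
next
  case (step m)
  have "box_filling_sum (labels (Suc m)) (extend k S) (extend k T) B =
     -2 * (real (card B) - real (card (labels (Suc m) - {2 * m + 1, 2 * m + 2}) div 2)) *
     box_filling_sum (labels (Suc m) - {2 * m + 1, 2 * m + 2}) (extend k S) (extend k T) B"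
    by (rule box_filling_sum_common_pair) (use B fixfree_extend[OF S] fixfree_extend[OF T] step.hyps extend_pair[of k m] labels_Suc in auto)
  then show ?case unfolding labels_Suc(1) step.IH using step.hyps by (simp add: Suc_diff_le algebra_simps)
qed

lemma loop_mset_extend:
  assumes S: "fixfree (labels k) S" and T: "fixfree (labels k) T" and km: "k \<le> m"
  shows "loop_mset (labels m) (extend k S) (extend k T) = loop_mset (labels k) S T + replicate_mset (m - k) 1"
  using km
proof (induction m rule: dec_induct)
  case base
  have "orbs (labels k) (extend k S) (extend k T) = orbs (labels k) S T"
    by (rule orbs_cong) (auto simp: extend_def)
  then show ?case by (simp add: loop_mset_def)
next
  case (step m)
  let ?V = "labels (Suc m)" and ?a = "2 * m + 1" and ?b = "2 * m + 2"
  note f = fixfree_extend[OF S, of "Suc m"] fixfree_extend[OF T, of "Suc m"]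
  note e = extend_pair[of k m S] extend_pair[of k m T]
  have "orb ?V (extend k S) (extend k T) ?a = {?a, ?b}"
  proof
    show "orb ?V (extend k S) (extend k T) ?a \<subseteq> {?a, ?b}"
      by (rule orb_least) (use e step.hyps in auto)
    show "{?a, ?b} \<subseteq> orb ?V (extend k S) (extend k T) ?a"
      using orb_step(1)[of ?a ?V "extend k S" "extend k T" ?a] labels_Suc(2) e step.hyps by auto
  qed
  then have "{?a, ?b} \<in> orbs ?V (extend k S) (extend k T)"
    unfolding orbs_def using labels_Suc(2) by (metis imageI)
  then have "loop_mset ?V (extend k S) (extend k T) =
      add_mset (card {?a, ?b} div 2) (loop_mset (?V - {?a, ?b}) (extend k S) (extend k T))"
    by (intro loop_mset_minus_orb) (use f step.hyps in auto)
  then show ?case unfolding labels_Suc(1) step.IH using step.hyps by (simp add: Suc_diff_le)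
qed

lemma zee_double_add_ones:
  "zee_double (M + replicate_mset d 1) * fact (count M 1) = 2 ^ d * fact (count M 1 + d) * zee_double M"
proof (induction d)
  case (Suc d)
  have "zee_double (M + replicate_mset (Suc d) 1) = 2 * Suc (count M 1 + d) * zee_double (M + replicate_mset d 1)"
    by (simp add: zee_double_add)
  then have "zee_double (M + replicate_mset (Suc d) 1) * fact (count M 1) =
      2 * Suc (count M 1 + d) * (zee_double (M + replicate_mset d 1) * fact (count M 1))"
    by (simp only: mult.assoc)
  then show ?case unfolding Suc.IH by (simp add: algebra_simps)
qed simp

text \<open>Padding by d common pairs multiplies the filling sum by (-2)^d d!, and the automorphism
  count by 2^d d! times the binomial coefficient of \<open>Sigma2\<close>. The normalisation of
  \<open>Sigma2\<close> absorbs both, up to the sign that turns (-1)^n into (-1)^k.\<close>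

lemma Sigma2_eq_filling_sum:
  assumes \<mu>: "\<mu> \<in> partitions k" and S: "S \<in> matchings (labels k)" and T: "T \<in> matchings (labels k)"
    and type: "loop_mset (labels k) S T = mset \<mu>" and la: "is_partition la"
  shows "Sigma2 \<mu> la * 2 ^ length \<mu> = (-1) ^ k * filling_sum (labels k) S T la"
proof -
  define n where "n = sum_list la"
  have la': "la \<in> partitions n" using la by (simp add: is_partition_def n_def)
  have muk: "sum_list \<mu> = k" using partitionsD(3)[OF \<mu>] .
  show ?thesis
  proof (cases "k \<le> n")
    case False
    then show ?thesis
      using filling_sum_too_many[of "labels k" la S T] S T by (simp add: Sigma2_def muk n_def)
  next
    case True
    define d where "d = n - k"
    define \<rho> where "\<rho> = \<mu> @ replicate d 1"
    have n: "n = k + d" using True by (simp add: d_def)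
    have ge1: "x \<ge> 1" if "x \<in> set \<mu>" for x using partitionsD(2)[OF \<mu>] that by (cases x) auto
    have "sorted_wrt (\<ge>) (replicate d (1::nat))" by (induction d) auto
    then have \<rho>: "\<rho> \<in> partitions n"
      using partitionsD[OF \<mu>] ge1 n unfolding \<rho>_def partitions_def
      by (auto simp: sorted_wrt_append sum_list_replicate)
    let ?X = "\<lambda>S v. if v \<in> labels n then extend k S v else v"
    have X: "?X S \<in> matchings (labels n)" if "S \<in> matchings (labels k)" for S
      using fixfree_extend[OF matchings_fixfree[OF that] True] by (auto simp: matchings_def fixfree_def)
    note fX = fixfree_extend[OF matchings_fixfree[OF S] True] fixfree_extend[OF matchings_fixfree[OF T] True]
    have "orbs (labels n) (?X S) (?X T) = orbs (labels n) (extend k S) (extend k T)"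
      by (rule orbs_cong) auto
    then have tX: "loop_mset (labels n) (?X S) (?X T) = mset \<rho>"
      using loop_mset_extend[OF matchings_fixfree[OF S] matchings_fixfree[OF T] True]
      by (simp add: loop_mset_def \<rho>_def d_def type[unfolded loop_mset_def])
    have "filling_sum (labels n) (?X S) (?X T) la = box_filling_sum (labels n) (?X S) (?X T) (boxes la)"
      by (rule filling_sum_eq_box_filling_sum) (use X S T in auto)
    also have "\<dots> = box_filling_sum (labels n) (extend k S) (extend k T) (boxes la)"
      by (rule box_filling_sum_cong[OF fX, symmetric]) auto
    also have "\<dots> = (-2) ^ d * (\<Prod>i\<in>{k..<n}. real n - real i) * box_filling_sum (labels k) S T (boxes la)"
      using box_filling_sum_extend[OF matchings_fixfree[OF S] matchings_fixfree[OF T] finite_boxes True, of la] by (simp add: card_boxes n_def d_def)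
    also have "(\<Prod>i\<in>{k..<n}. real n - real i) = fact d"
    proof -
      have "(\<Prod>i\<in>{k..<n}. real n - real i) = (\<Prod>i\<in>{1..d}. real i)"
        by (rule prod.reindex_bij_witness[where i = "\<lambda>i. n - i" and j = "\<lambda>i. n - i"]) (auto simp: n of_nat_diff)
      then show ?thesis by (simp add: fact_prod)
    qed
    also have "box_filling_sum (labels k) S T (boxes la) = filling_sum (labels k) S T la"
      by (rule filling_sum_eq_box_filling_sum[OF _ S T, symmetric]) simp
    finally have XXn: "filling_sum (labels n) (?X S) (?X T) la = (-2) ^ d * fact d * filling_sum (labels k) S T la" .
    have z: "zonal n \<rho> la * (real (zee \<rho>) * 2 ^ length \<rho>) = (-1) ^ n * filling_sum (labels n) (?X S) (?X T) la"
      by (rule zonal_eq_filling_sum[OF la' X[OF S] X[OF T] \<rho> tX])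
    define m1 where "m1 = count (mset \<mu>) 1"
    define C where "C = (d + m1) choose m1"
    have "zee_double (mset \<rho>) * fact m1 = 2 ^ d * fact (m1 + d) * zee_double (mset \<mu>)"
      using zee_double_add_ones[of "mset \<mu>" d] by (simp add: \<rho>_def m1_def)
    also have "fact (m1 + d) = C * fact d * fact m1"
      using binomial_fact_lemma[of m1 "d + m1"] by (simp add: C_def add.commute mult_ac)
    finally have "zee_double (mset \<rho>) = 2 ^ d * C * fact d * zee_double (mset \<mu>)" by (simp add: mult_ac)
    then have "zee \<rho> * 2 ^ length \<rho> = 2 ^ d * C * fact d * (zee \<mu> * 2 ^ length \<mu>)" by (simp add: zee_double_zee)
    then have "real (zee \<rho> * 2 ^ length \<rho>) = real (2 ^ d * C * fact d * (zee \<mu> * 2 ^ length \<mu>))" by (simp only:)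
    then have zee: "real (zee \<rho>) * 2 ^ length \<rho> = 2 ^ d * real C * fact d * (real (zee \<mu>) * 2 ^ length \<mu>)" by simp
    have "Sigma2 \<mu> la = real C * real (zee \<mu>) * zonal n \<rho> la"
      using True zonal_theta_eq[OF la, of \<rho>]
      by (simp add: Sigma2_def muk n_def[symmetric] C_def m1_def mult_def \<rho>_def d_def)
    then have "(2 ^ d * fact d) * (Sigma2 \<mu> la * 2 ^ length \<mu>) = zonal n \<rho> la * (real (zee \<rho>) * 2 ^ length \<rho>)"
      unfolding zee by (simp add: mult_ac)
    also have "\<dots> = (-1) ^ n * ((-2) ^ d * fact d * filling_sum (labels k) S T la)" unfolding z XXn ..
    also have "\<dots> = (2 ^ d * fact d) * ((-1) ^ k * filling_sum (labels k) S T la)"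
      by (simp add: n power_add power_mult_distrib[symmetric] mult_ac flip: power_mult_distrib)
    finally show ?thesis by simp
  qed
qed

section \<open>Orbits of oriented matchings\<close>

lemma loops_orbs:
  "loop_of k A B = orb (labels k) A B" "loops k A B = orbs (labels k) A B"
  "loop_type k A B = loop_mset (labels k) A B"
  by (auto simp: loops_def orbs_def loop_of_def orb_def loop_step_def step_def labels_def loop_type_def loop_mset_def fun_eq_iff)

lemma pair_partition_matchings: "pair_partition k S \<longleftrightarrow> S \<in> matchings (labels k)"
  by (auto simp: pair_partition_def matchings_def fixfree_def labels_def)

text \<open>Makes the exponent in \<open>loop_sign\<close> a genuine difference, not a truncated
  one.\<close>

lemma num_loops_le_half:
  fixes V :: "nat set"
  assumes "finite V" "fixfree V A" "fixfree V B"
  shows "2 * num_loops V A B \<le> card V"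
proof -
  have "size M \<le> sum_mset M" if "0 \<notin># M" for M :: "nat multiset"
    using that by (induction M) (auto simp: Suc_le_eq)
  then show ?thesis
    using sum_loop_mset[OF assms] size_loop_mset[OF assms(1), of A B] loop_mset_pos[OF assms] by (metis mult_le_mono2)
qed

text \<open>The last term of the sequence is \<open>A c\<close>. Since the period is even, walking
  backward from there applies \<open>B\<close> and \<open>A\<close> in the same order as walking
  forward from \<open>c\<close>.\<close>

lemma jseq_reverse:
  assumes V: "finite V" "fixfree V A" "fixfree V B" and c: "c \<in> V" and t: "t < card (orb V A B c)"
  shows "jseq A B c (card (orb V A B c) - 1 - t) = jseq A B (A c) t"
  using t
proof (induction t)
  case 0
  show ?case using jseq_nbrs(1)[OF V c, of 0] by simp
next
  case (Suc t)
  let ?p = "card (orb V A B c)" and ?s = "card (orb V A B c) - 1 - t"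
  have p: "even ?p" by (rule orb_jseq(1)[OF V c])
  have s: "?s = Suc (?p - 1 - Suc t)" using Suc.prems by simp
  have IH: "jseq A B c ?s = jseq A B (A c) t" using Suc by simp
  have in_V: "jseq A B c u \<in> V" for u by (rule jseq_in[OF V(2,3) c])
  have par: "even (?p - 1 - Suc t) \<longleftrightarrow> even t" using p Suc.prems by (auto simp: even_diff_nat)
  have "jseq A B c ?s = (if even t then B else A) (jseq A B c (?p - 1 - Suc t))"
    unfolding s using par by simp
  then have "(if even t then B else A) (jseq A B c ?s) = jseq A B c (?p - 1 - Suc t)"
    using fpfD(3)[OF V(2) in_V] fpfD(3)[OF V(3) in_V] by simp
  then show ?case unfolding IH by (cases "even t") simp_all
qed

section \<open>The group generated by the reflections\<close>

locale loop_reflections =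
  fixes k :: nat and S1 S2 :: "nat \<Rightarrow> nat" and b :: "nat set \<Rightarrow> nat"
  assumes S1: "S1 \<in> matchings (labels k)" and S2: "S2 \<in> matchings (labels k)"
    and b: "\<And>L. L \<in> orbs (labels k) S1 S2 \<Longrightarrow> b L \<in> L"
begin

abbreviation "V \<equiv> labels k"
abbreviation "Os \<equiv> orbs V S1 S2"
abbreviation "ob \<equiv> orb V S1 S2"

lemmas ff = matchings_fixfree[OF S1] matchings_fixfree[OF S2]
lemmas fin = finite_labels[of k]

lemma bV: "L \<in> Os \<Longrightarrow> b L \<in> V"
  using b orbs_subset[OF ff] by blast

lemma ob_b: "L \<in> Os \<Longrightarrow> ob (b L) = L"
  using orbs_eq_orb[OF ff _ b] by metis

text \<open>The reflection sends the t-th label of the walk from \<open>b L\<close> to the t-th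
  label of the walk from \<open>S1 (b L)\<close>. It is thus an automorphism of the loop and
  commutes with both matchings; its square fixes \<open>b L\<close> and is the identity by
  rigidity.\<close>

lemma reflection_properties:
  assumes L: "L \<in> Os"
  defines "r \<equiv> reflection S1 S2 L (b L)"
  shows "v \<in> L \<Longrightarrow> r v \<in> L" "v \<in> L \<Longrightarrow> r (S1 v) = S1 (r v)" "v \<in> L \<Longrightarrow> r (S2 v) = S2 (r v)"
    "r (b L) = S1 (b L)" "v \<in> L \<Longrightarrow> r (r v) = v"
proof -
  define c where "c = b L"
  have c: "c \<in> V" "ob c = L" "c \<in> L" using bV[OF L] ob_b[OF L] b[OF L] by (simp_all add: c_def)
  have c': "S1 c \<in> V" "S1 c \<in> L" using fpfD(1)[OF ff(1) c(1)] orb_step(1)[of c V S1 S2 c] c by auto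
  have oc': "ob (S1 c) = L" using orb_eq[OF ff c(1), of "S1 c"] c c' by simp
  obtain \<tau> where t: "bij_betw \<tau> (ob c) (ob (S1 c))" "\<tau> c = S1 c"
    "\<And>v. v \<in> ob c \<Longrightarrow> \<tau> (S1 v) = S1 (\<tau> v) \<and> \<tau> (S2 v) = S2 (\<tau> v)"
    using orb_isoms[OF fin ff c(1) fin ff c'(1)] c(2) oc' by metis
  note t = t[unfolded c(2) oc']
  note P = orb_jseq[OF fin ff c(1), unfolded c(2)]
  have tj: "\<tau> (jseq S1 S2 c s) = jseq S1 S2 (S1 c) s" for s
  proof (induction s)
    case (Suc s)
    have "jseq S1 S2 c s \<in> L" using P(5) by auto
    then show ?case using t(3) Suc by simp
  qed (use t(2) in simp)
  have rt: "r v = \<tau> v" if v: "v \<in> L" for v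
  proof -
    obtain s where s: "s < card L" "v = jseq S1 S2 c s"
      using P(4) v by (auto simp: bij_betw_def)
    have "(THE t. t < card L \<and> jseq S1 S2 c t = v) = s"
      using P(4) s by (intro the_equality) (auto simp: bij_betw_def inj_on_def)
    then have "r v = jseq S1 S2 c (card L - 1 - s)"
      using v by (simp add: r_def reflection_def c_def[symmetric])
    also have "\<dots> = jseq S1 S2 (S1 c) s"
      using jseq_reverse[OF fin ff c(1), of s] s(1) by (simp add: c(2))
    finally show ?thesis using tj s(2) by simp
  qed
  have L_closed: "S1 v \<in> L" "S2 v \<in> L" if "v \<in> L" for v
    using orb_step[of v V S1 S2 c] that c(2) orbs_subset[OF ff L] by auto
  show rL: "r v \<in> L" if "v \<in> L" for v using rt[OF that] t(1) that by (auto simp: bij_betw_def)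
  show r1: "r (S1 v) = S1 (r v)" and r2: "r (S2 v) = S2 (r v)" if "v \<in> L" for v
    using rt[OF that] rt[OF L_closed(1)[OF that]] rt[OF L_closed(2)[OF that]] t(3)[OF that] by simp_all
  show rc: "r (b L) = S1 (b L)" using rt[OF c(3)] t(2) by (simp add: c_def)
  show "r (r v) = v" if v: "v \<in> L"
  proof (rule intertwiner_eq_on_orb[OF ff c(1), of "\<lambda>v. r (r v)" "\<lambda>v. v" S1 S2])
    show "r (r c) = c" using rc r1[OF c(3)] fpfD(3)[OF ff(1) c(1)] by (simp add: c_def)
    show "v \<in> ob c" using v c(2) by simp
  qed (use c(2) r1 r2 rL in auto)
qed

text \<open>The product of the reflections of the loops in \<open>T\<close>. Reflections of
  different loops act on disjoint sets and each is an involution, so composition is symmetric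
  difference of sets of loops.\<close>

definition flip :: "nat set set \<Rightarrow> nat \<Rightarrow> nat" where
  "flip T v = (if v \<in> V \<and> ob v \<in> T then reflection S1 S2 (ob v) (b (ob v)) v else v)"

lemma ob_Os: "v \<in> V \<Longrightarrow> ob v \<in> Os"
  by (simp add: orbs_def)

lemma ob_eq: "v \<in> V \<Longrightarrow> w \<in> ob v \<Longrightarrow> ob w = ob v"
  by (rule orb_eq[OF ff])

lemma flip_in_ob: "v \<in> V \<Longrightarrow> flip T v \<in> ob v"
  using reflection_properties(1)[OF ob_Os] by (simp add: flip_def)

lemma flip_V: "v \<in> V \<Longrightarrow> flip T v \<in> V"
  using flip_in_ob orb_subset[OF ff] by blast

lemma ob_flip: "v \<in> V \<Longrightarrow> ob (flip T v) = ob v"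
  using ob_eq flip_in_ob by blast

lemma flip_out: "v \<notin> V \<Longrightarrow> flip T v = v"
  by (simp add: flip_def)

lemma flip_comp: "flip T (flip U v) = flip ((T - U) \<union> (U - T)) v"
proof (cases "v \<in> V")
  case True
  then show ?thesis
    using ob_flip[OF True, of U] flip_V[OF True, of U] reflection_properties(5)[OF ob_Os[OF True], of v]
    by (auto simp: flip_def)
qed (simp add: flip_out)

lemma flip_invol: "flip T (flip T v) = v"
  unfolding flip_comp by (simp add: flip_def)

lemma flip_permutes: "flip T permutes V"
  unfolding permutes_def by (metis flip_invol flip_out)

lemma inv_flip: "inv_into UNIV (flip T) = flip T"
  using permutes_inv_eq[OF flip_permutes] flip_invol by (auto simp: fun_eq_iff)

lemma flip_S: "flip T (S1 v) = S1 (flip T v)" "flip T (S2 v) = S2 (flip T v)"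
proof -
  have *: "flip T (S1 v) = S1 (flip T v) \<and> flip T (S2 v) = S2 (flip T v)"
  proof (cases "v \<in> V")
    case True
    have "S1 v \<in> V" "S2 v \<in> V" using fpfD(1)[OF ff(1) True] fpfD(1)[OF ff(2) True] .
    moreover have "ob (S1 v) = ob v" "ob (S2 v) = ob v"
      by (rule ob_eq[OF True], rule orb_step[OF orb_self True])+
    ultimately show ?thesis
      using True reflection_properties(2,3)[OF ob_Os[OF True], of v] by (auto simp: flip_def)
  next
    case False
    then show ?thesis using matchings_outside[OF S1 False] matchings_outside[OF S2 False] by (simp add: flip_out)
  qed
  then show "flip T (S1 v) = S1 (flip T v)" "flip T (S2 v) = S2 (flip T v)" by auto
qed

lemma flip_conj: "conj_by (flip T) S1 = S1" "conj_by (flip T) S2 = S2"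
  unfolding conj_by_def inv_flip comp_def flip_S flip_invol by simp_all

lemma reflection_eq_flip:
  assumes "L \<in> Os" shows "reflection S1 S2 L (b L) = flip {L}"
proof
  fix v
  have "v \<in> L \<longleftrightarrow> v \<in> V \<and> ob v = L"
    using assms orbs_eq_orb[OF ff, of L v] orbs_subset[OF ff, of L] by auto
  then show "reflection S1 S2 L (b L) v = flip {L} v" by (auto simp: flip_def reflection_def)
qed

lemma group_G_eq: "group_G k S1 S2 b = flip ` Pow Os"
proof
  show "group_G k S1 S2 b \<subseteq> flip ` Pow Os"
  proof
    fix h assume "h \<in> group_G k S1 S2 b"
    then show "h \<in> flip ` Pow Os"
    proof induction
      case G_id
      have "id = flip {}" by (auto simp: flip_def fun_eq_iff)
      then show ?case by blast
    next
      case (G_step h L)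
      then obtain T where T: "T \<subseteq> Os" "h = flip T" by auto
      have L: "L \<in> Os" using G_step.hyps(2) by (simp add: loops_orbs)
      have "reflection S1 S2 L (b L) \<circ> h = flip (({L} - T) \<union> (T - {L}))"
        using flip_comp[of "{L}" T] by (auto simp: reflection_eq_flip[OF L] T(2) fun_eq_iff)
      then show ?case using T L by blast
    qed
  qed
  show "flip ` Pow Os \<subseteq> group_G k S1 S2 b"
  proof safe
    fix T assume T: "T \<subseteq> Os"
    then have "finite T" using finite_orbs[OF fin] finite_subset by blast
    then show "flip T \<in> group_G k S1 S2 b" using T
    proof (induction T)
      case empty
      have "flip {} = id" by (auto simp: flip_def fun_eq_iff)
      then show ?case using group_G.G_id by metis
    next
      case (insert L T)
      then have "reflection S1 S2 L (b L) \<circ> flip T \<in> group_G k S1 S2 b"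
        by (intro group_G.G_step) (auto simp: loops_orbs)
      moreover have "reflection S1 S2 L (b L) \<circ> flip T = flip (insert L T)"
      proof -
        have "({L} - T) \<union> (T - {L}) = insert L T" using insert.hyps by auto
        then show ?thesis using insert.prems flip_comp[of "{L}" T]
          by (auto simp: reflection_eq_flip fun_eq_iff)
      qed
      ultimately show ?case by simp
    qed
  qed
qed

section \<open>Oriented matchings and the free action\<close>

definition Ps :: "((nat \<Rightarrow> nat) \<times> (nat \<Rightarrow> bool)) set" where
  "Ps = Sigma (matchings V) (\<lambda>S0. alternating V S0 S1)"

lemma P_o_eq: "P_o k S1 = Ps"
  by (auto simp: P_o_def Ps_def pair_partition_matchings orientation_def compatible_def alternating_def labels_def)

lemma finite_Ps: "finite Ps"
proof -
  have "card (alternating V S0 S1) > 0" if "S0 \<in> matchings V" for S0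
    using card_alternating[OF fin matchings_fixfree[OF that] ff(1)] by simp
  then show ?thesis unfolding Ps_def by (intro finite_SigmaI finite_matchings fin card_ge_0_finite)
qed

lemma act_flip: "act (flip T) x = (conj_by (flip T) (fst x), snd x \<circ> flip T)"
  by (simp add: act_def conj_by_def inv_flip)

lemma act_act: "act (flip T) (act (flip U) x) = act (flip ((T - U) \<union> (U - T))) x"
  by (auto simp: act_flip conj_by_def inv_flip comp_def flip_comp fun_eq_iff Un_commute)

lemma act_empty: "act (flip {}) x = x"
  unfolding act_flip conj_by_def inv_flip by (simp add: flip_def[abs_def] comp_def)

lemma act_Ps:
  assumes "x \<in> Ps" shows "act (flip T) x \<in> Ps"
proof -
  obtain S0 \<phi> where x: "x = (S0, \<phi>)" "S0 \<in> matchings V" "\<phi> \<in> alternating V S0 S1" using assms by (auto simp: Ps_def)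
  have al: "\<phi> (S0 v) \<noteq> \<phi> v" "\<phi> (S1 v) \<noteq> \<phi> v" if "v \<in> V" for v using x(3) that by (auto simp: alternating_def)
  have "(\<phi> \<circ> flip T) (conj_by (flip T) S0 v) \<noteq> (\<phi> \<circ> flip T) v \<and> (\<phi> \<circ> flip T) (S1 v) \<noteq> (\<phi> \<circ> flip T) v" if "v \<in> V" for v
    using al[OF flip_V[OF that]] by (simp add: conj_by_def inv_flip flip_invol flip_S)
  moreover have "(\<phi> \<circ> flip T) v = False" if "v \<notin> V" for v using x(3) that by (auto simp: alternating_def flip_out)
  ultimately have "\<phi> \<circ> flip T \<in> alternating V (conj_by (flip T) S0) S1" by (simp add: alternating_def)
  then show ?thesis using conj_by_matchings[OF flip_permutes x(2)] by (simp add: act_flip x(1) Ps_def)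
qed

text \<open>Reflecting a loop moves its base point to the other label of an \<open>S1\<close>-pair,
  which has the opposite colour. The orientation therefore remembers which loops were reflected, and
  this makes the action free.\<close>

lemma act_inj:
  assumes x: "x \<in> Ps" and T: "T \<subseteq> Os" "U \<subseteq> Os" and eq: "act (flip T) x = act (flip U) x"
  shows "T = U"
proof -
  obtain S0 \<phi> where x': "x = (S0, \<phi>)" "\<phi> \<in> alternating V S0 S1" using x by (auto simp: Ps_def)
  have e: "\<phi> (flip T v) = \<phi> (flip U v)" for v using eq by (auto simp: act_flip x'(1) fun_eq_iff)
  have "L \<in> T \<longleftrightarrow> L \<in> U" if L: "L \<in> Os" for L
  proof -
    have gb: "flip W (b L) = (if L \<in> W then S1 (b L) else b L)" for W
      using bV[OF L] ob_b[OF L] reflection_properties(4)[OF L] by (simp add: flip_def)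
    have "\<phi> (S1 (b L)) \<noteq> \<phi> (b L)" using x'(2) bV[OF L] by (auto simp: alternating_def)
    then show ?thesis using e[of "b L"] unfolding gb by (auto split: if_splits)
  qed
  then show ?thesis using T by blast
qed

definition Orb :: "(nat \<Rightarrow> nat) \<times> (nat \<Rightarrow> bool) \<Rightarrow> ((nat \<Rightarrow> nat) \<times> (nat \<Rightarrow> bool)) set" where
  "Orb x = (\<lambda>T. act (flip T) x) ` Pow Os"

lemma orbits_G_eq: "orbits_G k S1 S2 b = Orb ` Ps"
  by (simp add: orbits_G_def group_G_eq P_o_eq Orb_def image_image)

lemma card_Orb: "x \<in> Ps \<Longrightarrow> card (Orb x) = 2 ^ card Os"
  unfolding Orb_def using act_inj[of x] by (subst card_image) (auto simp: inj_on_def card_Pow)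

lemma Orb_self: "x \<in> Orb x"
  unfolding Orb_def by (rule image_eqI[of _ _ "{}"]) (simp_all add: act_empty)

lemma Orb_eq: "y \<in> Orb x \<Longrightarrow> Orb y = Orb x"
proof -
  assume "y \<in> Orb x"
  then obtain U where U: "U \<subseteq> Os" "y = act (flip U) x" by (auto simp: Orb_def)
  have "Orb (act (flip W) z) \<subseteq> Orb z" if "W \<subseteq> Os" for W z
    using that unfolding Orb_def by (auto simp: act_act)
  moreover have "x = act (flip U) y" unfolding U(2) act_act by (simp add: act_empty)
  ultimately show "Orb y = Orb x" using U by (metis subset_antisym)
qed

lemma Orb_Ps: "x \<in> Ps \<Longrightarrow> y \<in> Orb x \<Longrightarrow> y \<in> Ps"
  unfolding Orb_def using act_Ps[of x] by blast

text \<open>By freeness every orbit has 2^loops elements, and \<open>F\<close> is constant on it, so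
  the representative picked by \<open>SOME\<close> does not matter.\<close>

lemma sum_over_orbits:
  fixes F :: "(nat \<Rightarrow> nat) \<Rightarrow> real"
  assumes inv: "\<And>S0 T. S0 \<in> matchings V \<Longrightarrow> F (conj_by (flip T) S0) = F S0"
  shows "2 ^ card Os * (\<Sum>\<Omega>\<in>orbits_G k S1 S2 b. F (fst (SOME x. x \<in> \<Omega>))) = (\<Sum>x\<in>Ps. F (fst x))"
proof -
  have F_eq: "F (fst y) = F (fst x)" if "x \<in> Ps" "y \<in> Orb x" for x y
    using that inv by (auto simp: Orb_def act_flip Ps_def)
  have "(\<Sum>x\<in>Ps. F (fst x)) = (\<Sum>\<Omega>\<in>Orb ` Ps. \<Sum>x\<in>{x\<in>Ps. Orb x = \<Omega>}. F (fst x))"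
    by (rule sum.group[symmetric]) (use finite_Ps in auto)
  also have "\<dots> = (\<Sum>\<Omega>\<in>Orb ` Ps. 2 ^ card Os * F (fst (SOME x. x \<in> \<Omega>)))"
  proof (rule sum.cong[OF refl])
    fix \<Omega> assume "\<Omega> \<in> Orb ` Ps"
    then obtain x where x: "x \<in> Ps" "\<Omega> = Orb x" by auto
    have some: "(SOME x. x \<in> \<Omega>) \<in> \<Omega>" by (rule someI[of _ x]) (simp add: x(2) Orb_self)
    have "{x\<in>Ps. Orb x = \<Omega>} = \<Omega>" using Orb_self Orb_eq Orb_Ps x by blast
    then have "(\<Sum>x\<in>{x\<in>Ps. Orb x = \<Omega>}. F (fst x)) = (\<Sum>y\<in>\<Omega>. F (fst (SOME x. x \<in> \<Omega>)))"
      using F_eq[OF x(1)] some by (intro sum.cong) (auto simp: x(2))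
    then show "(\<Sum>x\<in>{x\<in>Ps. Orb x = \<Omega>}. F (fst x)) = 2 ^ card Os * F (fst (SOME x. x \<in> \<Omega>))"
      using card_Orb[OF x(1)] by (simp add: x(2))
  qed
  finally show ?thesis by (simp add: orbits_G_eq sum_distrib_left)
qed

lemma N1_eq:
  assumes "S0 \<in> matchings V"
  shows "N1 k S0 S1 S2 la = card {f\<in>fillings V S1 S2 la. S0 \<in> matchings_of V f}"
  unfolding N1_def labels_def[symmetric]
  by (rule arg_cong[of _ _ card]) (use assms S1 S2 in \<open>auto simp: fillings_def matchings_of_def\<close>)

text \<open>Composition with the involution is injective on fillings, which gives one inequality;
  applied to the conjugated matching it gives the other.\<close>

lemma N1_conj:
  assumes S0: "S0 \<in> matchings V"
  shows "N1 k (conj_by (flip T) S0) S1 S2 la = N1 k S0 S1 S2 la"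
proof -
  have le: "N1 k S0 S1 S2 la \<le> N1 k (conj_by (flip T) S0) S1 S2 la" if S0: "S0 \<in> matchings V" for S0
  proof -
    have C: "conj_by (flip T) S0 \<in> matchings V" by (rule conj_by_matchings[OF flip_permutes S0])
    show ?thesis unfolding N1_eq[OF S0] N1_eq[OF C]
    proof (rule card_inj_on_le)
      show "inj_on (\<lambda>f. f \<circ> flip T) {f\<in>fillings V S1 S2 la. S0 \<in> matchings_of V f}"
        by (rule inj_onI) (metis (no_types, lifting) comp_apply ext flip_invol)
      show "(\<lambda>f. f \<circ> flip T) ` {f\<in>fillings V S1 S2 la. S0 \<in> matchings_of V f} \<subseteq>
          {f\<in>fillings V S1 S2 la. conj_by (flip T) S0 \<in> matchings_of V f}"
      proof (rule image_subsetI)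
        fix f assume f: "f \<in> {f\<in>fillings V S1 S2 la. S0 \<in> matchings_of V f}"
        then have "f \<circ> flip T \<in> fillings V S1 S2 la"
          using fillings_conj[OF flip_permutes, of f S1 S2 la T] S1 S2 by (simp add: inv_flip flip_conj)
        moreover have "(f \<circ> flip T) \<circ> flip T = f" by (auto simp: flip_invol)
        then have "conj_by (flip T) S0 \<in> matchings_of V (f \<circ> flip T)"
          using conj_by_matchings_of[OF flip_permutes, of S0 "f \<circ> flip T" T] f by simp
        ultimately show "f \<circ> flip T \<in> {f\<in>fillings V S1 S2 la. conj_by (flip T) S0 \<in> matchings_of V f}" by simp
      qed
    qed (use fin in simp)
  qed
  have "conj_by (flip T) (conj_by (flip T) S0) = S0"
    using conj_by_inv(1)[OF flip_permutes, of T S0] by (simp add: inv_flip)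
  then show ?thesis using le[OF S0] le[OF conj_by_matchings[OF flip_permutes S0], of T] by (metis order_antisym)
qed

lemma loop_sign_conj:
  assumes S0: "S0 \<in> matchings V"
  shows "loop_sign k (conj_by (flip T) S0) S1 = loop_sign k S0 S1"
  using num_loops_conj_by(1)[OF flip_permutes S0 S1, of T] by (simp add: loop_sign_def loops_orbs flip_conj)

text \<open>The 2^loops orientations of each matching combine with its sign into the weight;
  exchanging the sums over matchings and fillings then yields the filling sum.\<close>

lemma sum_Ps:
  "(\<Sum>x\<in>Ps. real_of_int (loop_sign k (fst x) S1 * int (N1 k (fst x) S1 S2 la))) = (-1) ^ k * filling_sum V S1 S2 la"
proof -
  have "(\<Sum>x\<in>Ps. real_of_int (loop_sign k (fst x) S1 * int (N1 k (fst x) S1 S2 la))) =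
      (\<Sum>S0\<in>matchings V. \<Sum>\<phi>\<in>alternating V S0 S1. real_of_int (loop_sign k S0 S1 * int (N1 k S0 S1 S2 la)))"
  proof -
    have "finite (alternating V S0 S1)" if "S0 \<in> matchings V" for S0
      using card_alternating[OF fin matchings_fixfree[OF that] ff(1)] by (intro card_ge_0_finite) simp
    then show ?thesis unfolding Ps_def using fin by (subst sum.Sigma) (auto intro!: sum.cong)
  qed
  also have "\<dots> = (\<Sum>S0\<in>matchings V. (-1) ^ k * (weight V S0 S1 * real (N1 k S0 S1 S2 la)))"
  proof (rule sum.cong[OF refl])
    fix S0 assume S0: "S0 \<in> matchings V"
    have "num_loops V S0 S1 \<le> k" using num_loops_le_half[OF fin matchings_fixfree[OF S0] ff(1)] by simp
    then have "(-1::real) ^ (k - num_loops V S0 S1) = (-1) ^ k * (-1) ^ num_loops V S0 S1"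
      by (simp add: power_add[symmetric] minus_one_power_iff)
    then have "2 ^ num_loops V S0 S1 * real_of_int (loop_sign k S0 S1) = (-1) ^ k * weight V S0 S1"
      by (simp add: loop_sign_def loops_orbs weight_def power_mult_distrib[symmetric] mult_ac flip: power_mult_distrib)
    then show "(\<Sum>\<phi>\<in>alternating V S0 S1. real_of_int (loop_sign k S0 S1 * int (N1 k S0 S1 S2 la))) =
        (-1) ^ k * (weight V S0 S1 * real (N1 k S0 S1 S2 la))"
      using card_alternating[OF fin matchings_fixfree[OF S0] ff(1)] by (simp flip: mult.assoc)
  qed
  also have "\<dots> = (-1) ^ k * (\<Sum>S0\<in>matchings V. \<Sum>f\<in>fillings V S1 S2 la. if S0 \<in> matchings_of V f then weight V S0 S1 else 0)"
  proof -
    have "weight V S0 S1 * real (N1 k S0 S1 S2 la) =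
        (\<Sum>f\<in>fillings V S1 S2 la. if S0 \<in> matchings_of V f then weight V S0 S1 else 0)" if "S0 \<in> matchings V" for S0
      using fin by (simp add: N1_eq[OF that] sum.inter_filter[symmetric])
    then show ?thesis by (simp add: sum_distrib_left)
  qed
  also have "(\<Sum>S0\<in>matchings V. \<Sum>f\<in>fillings V S1 S2 la. if S0 \<in> matchings_of V f then weight V S0 S1 else 0) =
      (\<Sum>f\<in>fillings V S1 S2 la. \<Sum>S0\<in>matchings V. if S0 \<in> matchings_of V f then weight V S0 S1 else 0)"
    by (rule sum.swap)
  also have "\<dots> = filling_sum V S1 S2 la"
    unfolding filling_sum_def
  proof (rule sum.cong[OF refl])
    fix f
    have "{S0 \<in> matchings V. S0 \<in> matchings_of V f} = matchings_of V f" by (auto simp: matchings_of_def)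
    then show "(\<Sum>S0\<in>matchings V. if S0 \<in> matchings_of V f then weight V S0 S1 else 0) = (\<Sum>A\<in>matchings_of V f. weight V A S1)"
      using fin by (simp add: sum.inter_filter[symmetric])
  qed
  finally show ?thesis .
qed

end

theorem theorem3p13:
  fixes k :: nat and \<mu> :: "nat list" and S1 S2 :: "nat \<Rightarrow> nat" and b :: "nat set \<Rightarrow> nat"
  assumes "\<mu> \<in> partitions k"
    and "pair_partition k S1" and "pair_partition k S2"
    and "loop_type k S1 S2 = mset \<mu>"
    and "\<forall>L\<in>loops k S1 S2. b L \<in> L"
    and "is_partition la"
  shows "Sigma2 \<mu> la =
    real_of_int (\<Sum>\<Omega>\<in>orbits_G k S1 S2 b.
       loop_sign k (fst (SOME x. x \<in> \<Omega>)) S1 * int (N1 k (fst (SOME x. x \<in> \<Omega>)) S1 S2 la))"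
proof -
  have S: "S1 \<in> matchings (labels k)" "S2 \<in> matchings (labels k)" using assms(2,3) by (simp_all add: pair_partition_matchings)
  interpret loop_reflections k S1 S2 b
    by unfold_locales (use S assms(5) in \<open>auto simp: loops_orbs\<close>)
  define F where "F S0 = real_of_int (loop_sign k S0 S1 * int (N1 k S0 S1 S2 la))" for S0
  have type: "loop_mset (labels k) S1 S2 = mset \<mu>" using assms(4) by (simp add: loops_orbs)
  \<comment> \<open>The order of the group is the power of 2 by which \<open>zee_double\<close>
    exceeds \<open>zee\<close>, so it cancels against the factor of \<open>Sigma2\<close>.\<close>
  have "card Os = length \<mu>" using size_loop_mset[OF fin, of S1 S2] type by simp
  then have "2 ^ length \<mu> * (\<Sum>\<Omega>\<in>orbits_G k S1 S2 b. F (fst (SOME x. x \<in> \<Omega>))) = (\<Sum>x\<in>Ps. F (fst x))"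
    using sum_over_orbits[of F] by (simp add: F_def N1_conj loop_sign_conj)
  also have "\<dots> = (-1) ^ k * filling_sum (labels k) S1 S2 la" unfolding F_def by (rule sum_Ps)
  also have "\<dots> = 2 ^ length \<mu> * Sigma2 \<mu> la"
    using Sigma2_eq_filling_sum[OF assms(1) S type assms(6)] by (simp add: mult.commute)
  finally show ?thesis by (simp add: F_def)
qed

end
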